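(* Let $\mathcal M\subseteq\mathbb R^d$ be a connected, properly embedded Riemannian manifold of intrinsic dimension $m$, and let $p$ be a smooth, strictly positive probability density on $\mathcal M$, stationary for the diffusion with generator $D_p$, that is centered and isotropic: $\mathbb E_{Z\sim p}[Z]=0$ and $\operatorname{Cov}_{Z\sim p}(Z)=c_pI_d$ with $c_p>0$. Assume that $-D_p$ is self-adjoint in $L^2(p)$ with discrete spectrum. Fix $t>0$ and let $\mathcal L_p$ be the alignment loss associated with the time-$t$ transition kernel $K_t$. Assume that $(\mathcal M,p)$ is linearly admissible at scale $\lambda>0$. Then the minimizers of $$\min_{\substack{h:\mathcal M\to\mathcal M\\ h_{\#}p=p}}\mathcal L_p(h)$$ are exactly (up to equality $p$-almost everywhere) the maps $$h^\star(z)=Qz,\qquad Q\in O(d),\quad Q(\mathcal M)=\mathcal M.$$ Consequently, every optimal distribution-preserving map recovers the latent state up to a linear symmetry of $(\mathcal M,p)$.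
   Context: $\mathcal M\subseteq\mathbb R^d$ carries the metric induced from $\mathbb R^d$; $z=(z_1,\dots,z_d)$ denotes the ambient position vector, whose components are viewed as functions on $\mathcal M$. $O(d)$ is the orthogonal group. The symbol $p$ denotes both a probability measure on $\mathcal M$ and its density with respect to Riemannian volume. The weighted Laplacian is $$D_p\phi=\Delta_{\mathcal M}\phi+\langle\nabla_{\mathcal M}\log p,\nabla_{\mathcal M}\phi\rangle_{\mathcal M}=\frac1p\operatorname{div}_{\mathcal M}(p\nabla_{\mathcal M}\phi),$$ the generator of the Langevin diffusion $dZ_s=\nabla_{\mathcal M}\log p(Z_s)\,ds+\sqrt2\,dB^{\mathcal M}_s$ on $\mathcal M$, where $B^{\mathcal M}$ is Brownian motion on $\mathcal M$ with generator $\frac12\Delta_{\mathcal M}$. $K_t(z,\cdot)$ is its time-$t$ transition kernel and $T_t=e^{tD_p}$ its transition operator, $(T_t\phi)(z)=\int\phi(z')\,K_t(z,dz')$. Alignment loss: for measurable $h:\mathcal M\to\mathcal M$, $$\mathcal L_p(h)=\mathbb E\big[\|h(Z')-h(Z)\|^2\big],\qquad Z\sim p,\quad Z'\mid Z=z\sim K_t(z,\cdot),$$ with $\|\cdot\|$ the Euclidean norm of $\mathbb R^d$. The condition $h_{\#}p=p$ means $h(Z)\sim p$ when $Z\sim p$ (distribution-preserving map). Maps are identified when equal $p$-almost everywhere. Linearly admissible: for $\lambda>0$, $(\mathcal M,p)$ is linearly admissible at scale $\lambda$ if (1) $p(z)\propto\exp(-\frac{\lambda}{2}\|z\|^2)$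 for $z\in\mathcal M$; (2) $\Delta_{\mathcal M}z=-\lambda z^\perp$ on $\mathcal M$, where $\Delta_{\mathcal M}$ acts componentwise on the position vector and $z^\perp$ is the component of $z$ normal to $\mathcal M$; (3) the coordinate functions $z_1,\dots,z_d$ span the complete first non-constant eigenspace of $-D_p$ (the eigenspace of its smallest nonzero eigenvalue), and its eigenvalue is $\lambda$. *)

theory Defs
  imports "HOL-Probability.Probability"
begin

subsection \<open>Smooth functions on open sets\<close>

primrec Ck_on :: "nat \<Rightarrow> 'a::real_normed_vector set \<Rightarrow> ('a \<Rightarrow> 'b::real_normed_vector) \<Rightarrow> bool" where
  "Ck_on 0 S f \<longleftrightarrow> continuous_on S f"
| "Ck_on (Suc k) S f \<longleftrightarrow>
     (\<forall>x\<in>S. f differentiable (at x)) \<and> (\<forall>v. Ck_on k S (\<lambda>x. frechet_derivative f (at x) v))"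

definition smooth_on :: "'a::real_normed_vector set \<Rightarrow> ('a \<Rightarrow> 'b::real_normed_vector) \<Rightarrow> bool" where
  "smooth_on S f \<longleftrightarrow> (\<forall>k. Ck_on k S f)"


subsection \<open>Embedded submanifolds of Euclidean space\<close>

definition local_param ::
    "(real^'d) set \<Rightarrow> (real^'m) set \<Rightarrow> (real^'m \<Rightarrow> real^'d) \<Rightarrow> bool" where
  "local_param M V \<phi> \<longleftrightarrow>
     open V \<and> smooth_on V \<phi> \<and> (\<forall>x\<in>V. inj (frechet_derivative \<phi> (at x))) \<and>
     openin (top_of_set M) (\<phi> ` V) \<and> (\<exists>\<psi>. homeomorphism V (\<phi> ` V) \<phi> \<psi>)"

text \<open>The intrinsic dimension is the cardinality of the index type \<open>'m\<close>. An embedded submanifold is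
  properly embedded iff it is a closed subset of the ambient space.\<close>

definition properly_embedded_submanifold :: "'m::finite itself \<Rightarrow> (real^'d) set \<Rightarrow> bool" where
  "properly_embedded_submanifold _ M \<longleftrightarrow>
     closed M \<and> (\<forall>x\<in>M. \<exists>V (\<phi> :: real^'m \<Rightarrow> real^'d). local_param M V \<phi> \<and> x \<in> \<phi> ` V)"

definition tangent_space :: "(real^'d) set \<Rightarrow> real^'d \<Rightarrow> (real^'d) set" where
  "tangent_space M x = {v. \<exists>\<epsilon>>0. \<exists>\<gamma> :: real \<Rightarrow> real^'d.
     smooth_on {-\<epsilon><..<\<epsilon>} \<gamma> \<and> \<gamma> ` {-\<epsilon><..<\<epsilon>} \<subseteq> M \<and> \<gamma> 0 = x \<and> (\<gamma> has_vector_derivative v) (at 0)}"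

definition normal_component :: "(real^'d) set \<Rightarrow> real^'d \<Rightarrow> real^'d \<Rightarrow> real^'d" where
  "normal_component M x v =
     (THE n. v - n \<in> tangent_space M x \<and> (\<forall>w\<in>tangent_space M x. orthogonal n w))"

definition smooth_on_submanifold :: "(real^'d) set \<Rightarrow> (real^'d \<Rightarrow> real) \<Rightarrow> bool" where
  "smooth_on_submanifold M f \<longleftrightarrow>
     (\<forall>x\<in>M. \<exists>U F. open U \<and> x \<in> U \<and> smooth_on U F \<and> (\<forall>y\<in>M \<inter> U. f y = F y))"

definition test_function :: "(real^'d) set \<Rightarrow> (real^'d \<Rightarrow> real) \<Rightarrow> bool" where
  "test_function M f \<longleftrightarrow>
     smooth_on_submanifold M f \<and> (\<exists>C\<subseteq>M. compact C \<and> (\<forall>x\<in>M - C. f x = 0))"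

text \<open>A derivative within \<open>M\<close> is determined only on the tangent space, so its representing vector is
  unique once it is required to be tangent: this is the gradient for the induced metric.\<close>

definition gradient_on :: "(real^'d) set \<Rightarrow> (real^'d \<Rightarrow> real) \<Rightarrow> real^'d \<Rightarrow> real^'d" where
  "gradient_on M f x =
     (THE u. u \<in> tangent_space M x \<and> (f has_derivative (\<lambda>v. v \<bullet> u)) (at x within M))"

text \<open>The Levi-Civita connection of the induced metric is the tangential part of the ambient
  derivative. Hence, for an orthonormal basis \<open>e\<^sub>i\<close> of the tangent space, the divergence of a tangent
  field \<open>X\<close> is the sum of the \<open>e\<^sub>i \<bullet> \<partial>X/\<partial>e\<^sub>i\<close>, which in ambient components is the sum below.\<close>

definition divergence_on :: "(real^'d) set \<Rightarrow> (real^'d \<Rightarrow> real^'d) \<Rightarrow> real^'d \<Rightarrow> real" where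
  "divergence_on M X x = (\<Sum>j\<in>UNIV. gradient_on M (\<lambda>y. X y $ j) x $ j)"

definition laplacian_on :: "(real^'d) set \<Rightarrow> (real^'d \<Rightarrow> real) \<Rightarrow> real^'d \<Rightarrow> real" where
  "laplacian_on M f = divergence_on M (gradient_on M f)"

definition weighted_laplacian ::
    "(real^'d) set \<Rightarrow> (real^'d \<Rightarrow> real) \<Rightarrow> (real^'d \<Rightarrow> real) \<Rightarrow> real^'d \<Rightarrow> real" where
  "weighted_laplacian M p f x =
     laplacian_on M f x + gradient_on M (\<lambda>y. ln (p y)) x \<bullet> gradient_on M f x"

abbreviation borel_of :: "(real^'d) set \<Rightarrow> (real^'d) measure" where
  "borel_of M \<equiv> restrict_space borel M"

text \<open>The Riemannian volume of the induced metric is the unique Borel measure on \<open>M\<close> whose density in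
  every local parametrization is the square root of the Gram determinant.\<close>

definition riemannian_volume ::
    "'m::finite itself \<Rightarrow> (real^'d) set \<Rightarrow> (real^'d) measure \<Rightarrow> bool" where
  "riemannian_volume _ M vol \<longleftrightarrow> space vol = M \<and> sets vol = sets (borel_of M) \<and>
     (\<forall>V (\<phi> :: real^'m \<Rightarrow> real^'d). local_param M V \<phi> \<longrightarrow>
        (\<forall>A\<in>sets borel. A \<subseteq> V \<longrightarrow>
           emeasure vol (\<phi> ` A) =
             (\<integral>\<^sup>+x\<in>A. ennreal (sqrt (det (transpose (matrix (frechet_derivative \<phi> (at x)))
                                       ** matrix (frechet_derivative \<phi> (at x))))) \<partial>lborel)))"

definition law_of :: "(real^'d) measure \<Rightarrow> (real^'d \<Rightarrow> real) \<Rightarrow> (real^'d) measure" where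
  "law_of vol p = density vol (\<lambda>z. ennreal (p z))"

definition covariance_matrix :: "(real^'d) measure \<Rightarrow> real^'d^'d" where
  "covariance_matrix P =
     (\<chi> i j. \<integral>z. (z $ i - (\<integral>y. y $ i \<partial>P)) * (z $ j - (\<integral>y. y $ j \<partial>P)) \<partial>P)"

definition centered_isotropic :: "(real^'d) measure \<Rightarrow> real \<Rightarrow> bool" where
  "centered_isotropic P c \<longleftrightarrow> integrable P (\<lambda>z. (norm z)\<^sup>2) \<and>
     (\<integral>z. z \<partial>P) = 0 \<and> covariance_matrix P = c *\<^sub>R mat 1"


subsection \<open>Unbounded operators in \<open>L\<^sup>2(P)\<close>\<close>

text \<open>Elements of real \<open>L\<^sup>2(P)\<close> are represented by functions, and operators by their graphs. All notions
  below are invariant under almost everywhere equality. Real spectral parameters suffice for a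
  self-adjoint operator with real coefficients.\<close>

type_synonym 'a graph = "(('a \<Rightarrow> real) \<times> ('a \<Rightarrow> real)) set"

definition L2 :: "'a measure \<Rightarrow> ('a \<Rightarrow> real) set" where
  "L2 P = {f \<in> borel_measurable P. integrable P (\<lambda>x. (f x)\<^sup>2)}"

definition L2_norm :: "'a measure \<Rightarrow> ('a \<Rightarrow> real) \<Rightarrow> real" where
  "L2_norm P f = sqrt (\<integral>x. (f x)\<^sup>2 \<partial>P)"

definition adjoint_graph :: "'a measure \<Rightarrow> 'a graph \<Rightarrow> 'a graph" where
  "adjoint_graph P A = {(f, g). f \<in> L2 P \<and> g \<in> L2 P \<and>
     (\<forall>(u, v)\<in>A. (\<integral>x. f x * v x \<partial>P) = (\<integral>x. g x * u x \<partial>P))}"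

definition self_adjoint :: "'a measure \<Rightarrow> 'a graph \<Rightarrow> bool" where
  "self_adjoint P A \<longleftrightarrow>
     (\<forall>f\<in>L2 P. \<forall>\<epsilon>>0. \<exists>(u, v)\<in>A. L2_norm P (\<lambda>x. f x - u x) < \<epsilon>) \<and> adjoint_graph P A = A"

definition resolvent_set :: "'a measure \<Rightarrow> 'a graph \<Rightarrow> real set" where
  "resolvent_set P A = {\<mu>.
     (\<forall>w\<in>L2 P. \<exists>(f, g)\<in>A. AE x in P. g x - \<mu> * f x = w x) \<and>
     (\<exists>C. \<forall>(f, g)\<in>A. L2_norm P f \<le> C * L2_norm P (\<lambda>x. g x - \<mu> * f x))}"

definition spectrum_of :: "'a measure \<Rightarrow> 'a graph \<Rightarrow> real set" where
  "spectrum_of P A = - resolvent_set P A"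

definition eigenspace :: "'a measure \<Rightarrow> 'a graph \<Rightarrow> real \<Rightarrow> ('a \<Rightarrow> real) set" where
  "eigenspace P A \<mu> = {f. (f, \<lambda>x. \<mu> * f x) \<in> A}"

definition eigenvalue_of :: "'a measure \<Rightarrow> 'a graph \<Rightarrow> real \<Rightarrow> bool" where
  "eigenvalue_of P A \<mu> \<longleftrightarrow> (\<exists>f\<in>eigenspace P A \<mu>. \<not> (AE x in P. f x = 0))"

definition discrete_spectrum :: "'a measure \<Rightarrow> 'a graph \<Rightarrow> bool" where
  "discrete_spectrum P A \<longleftrightarrow> (\<forall>\<mu>\<in>spectrum_of P A.
     \<not> \<mu> islimpt spectrum_of P A \<and> eigenvalue_of P A \<mu> \<and>
     (\<exists>(n::nat) b. \<forall>f\<in>eigenspace P A \<mu>. \<exists>a. AE x in P. f x = (\<Sum>i<n. a i * b i x)))"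

text \<open>The operator \<open>-D\<^sub>p\<close> in \<open>L\<^sup>2(p)\<close>: the graph closure of its restriction to compactly supported
  smooth functions.\<close>

definition neg_generator ::
    "(real^'d) set \<Rightarrow> (real^'d) measure \<Rightarrow> (real^'d \<Rightarrow> real) \<Rightarrow> (real^'d) graph" where
  "neg_generator M vol p = {(f, g). f \<in> L2 (law_of vol p) \<and> g \<in> L2 (law_of vol p) \<and>
     (\<exists>\<phi>. (\<forall>n::nat. test_function M (\<phi> n)) \<and>
        (\<lambda>n. L2_norm (law_of vol p) (\<lambda>x. \<phi> n x - f x)) \<longlonglongrightarrow> 0 \<and>
        (\<lambda>n. L2_norm (law_of vol p) (\<lambda>x. - weighted_laplacian M p (\<phi> n) x - g x)) \<longlonglongrightarrow> 0)}"


subsection \<open>The Langevin diffusion\<close>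

definition transition_op :: "(real^'d \<Rightarrow> (real^'d) measure) \<Rightarrow> (real^'d \<Rightarrow> real) \<Rightarrow> real^'d \<Rightarrow> real" where
  "transition_op k f z = (\<integral>z'. f z' \<partial>k z)"

text \<open>\<open>K s z\<close> is the law at time \<open>s\<close> of the diffusion started at \<open>z\<close>. The last condition is Dynkin's
  formula, that is, the expectation of the martingale problem for \<open>D\<^sub>p\<close>, which for a Markov semigroup
  determines the kernels of the (nonexplosive) Langevin diffusion with generator \<open>D\<^sub>p\<close>.\<close>

definition langevin_kernels ::
    "(real^'d) set \<Rightarrow> (real^'d \<Rightarrow> real) \<Rightarrow> (real \<Rightarrow> real^'d \<Rightarrow> (real^'d) measure) \<Rightarrow> bool" where
  "langevin_kernels M p K \<longleftrightarrow>
     (\<forall>s\<ge>0. K s \<in> borel_of M \<rightarrow>\<^sub>M prob_algebra (borel_of M)) \<and>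
     (\<forall>z\<in>M. K 0 z = return (borel_of M) z) \<and>
     (\<forall>s\<ge>0. \<forall>r\<ge>0. \<forall>z\<in>M. K (s + r) z = K s z \<bind> K r) \<and>
     (\<forall>f. test_function M f \<longrightarrow> (\<forall>z\<in>M. \<forall>s\<ge>0.
        ((\<lambda>r. transition_op (K r) (weighted_laplacian M p f) z)
           has_integral (transition_op (K s) f z - f z)) {0..s}))"

definition stationary :: "(real \<Rightarrow> 'a \<Rightarrow> 'a measure) \<Rightarrow> 'a measure \<Rightarrow> bool" where
  "stationary K P \<longleftrightarrow> (\<forall>s\<ge>0. P \<bind> K s = P)"


subsection \<open>Linear admissibility and the alignment problem\<close>

definition linearly_admissible ::
    "(real^'d) set \<Rightarrow> (real^'d) measure \<Rightarrow> (real^'d \<Rightarrow> real) \<Rightarrow> real \<Rightarrow> bool" where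
  "linearly_admissible M vol p lam \<longleftrightarrow>
     (\<exists>C>0. \<forall>z\<in>M. p z = C * exp (- (lam / 2) * (norm z)\<^sup>2)) \<and>
     (\<forall>z\<in>M. \<forall>j. laplacian_on M (\<lambda>y. y $ j) z = - lam * normal_component M z z $ j) \<and>
     (let P = law_of vol p; A = neg_generator M vol p in
        eigenvalue_of P A lam \<and> lam \<noteq> 0 \<and> (\<forall>\<mu>. eigenvalue_of P A \<mu> \<and> \<mu> \<noteq> 0 \<longrightarrow> lam \<le> \<mu>) \<and>
        eigenspace P A lam =
          {f \<in> L2 P. \<exists>a. AE z in P. f z = (\<Sum>j\<in>UNIV. a j * z $ j)})"

text \<open>Extended nonnegative values, so that the expectation is meaningful for every measurable \<open>h\<close>.\<close>

definition alignment_loss ::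
    "(real^'d) measure \<Rightarrow> (real^'d \<Rightarrow> (real^'d) measure) \<Rightarrow> (real^'d \<Rightarrow> real^'d) \<Rightarrow> ennreal" where
  "alignment_loss P k h = (\<integral>\<^sup>+z. (\<integral>\<^sup>+z'. ennreal ((norm (h z' - h z))\<^sup>2) \<partial>k z) \<partial>P)"

definition distribution_preserving ::
    "(real^'d) set \<Rightarrow> (real^'d) measure \<Rightarrow> (real^'d \<Rightarrow> real^'d) set" where
  "distribution_preserving M P = {h \<in> borel_of M \<rightarrow>\<^sub>M borel_of M. distr P (borel_of M) h = P}"

definition alignment_minimizers ::
    "(real^'d) set \<Rightarrow> (real^'d) measure \<Rightarrow> (real^'d \<Rightarrow> (real^'d) measure) \<Rightarrow> (real^'d \<Rightarrow> real^'d) set" where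
  "alignment_minimizers M P k = {h \<in> distribution_preserving M P.
     \<forall>g\<in>distribution_preserving M P. alignment_loss P k h \<le> alignment_loss P k g}"

definition linear_symmetry :: "(real^'d) set \<Rightarrow> (real^'d) measure \<Rightarrow> real^'d^'d \<Rightarrow> bool" where
  "linear_symmetry M P Q \<longleftrightarrow> orthogonal_matrix Q \<and> (\<lambda>z. Q *v z) ` M = M \<and>
     distr P (borel_of M) (\<lambda>z. Q *v z) = P"

end

theory Submission
  imports Defs "HOL-Library.Function_Algebras"
begin

text \<open>By stationarity the loss of a distribution preserving map \<open>h\<close> is the sum over the components of
  \<open>2 (c - \<langle>h\<^sub>j, T\<^sub>t h\<^sub>j\<rangle>)\<close>. The components have mean zero, so the spectral gap bounds the correlation by
  \<open>exp (- \<lambda> t) c\<close>, with equality exactly when \<open>h\<^sub>j\<close> is an eigenfunction for \<open>\<lambda>\<close>, i.e. linear. Then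
  \<open>h = Q\<close> is linear, isotropy makes \<open>Q\<close> orthogonal, and full support of \<open>p\<close> gives \<open>Q M = M\<close>.

  Isolated spectral points of a self-adjoint operator that
  are eigenvalues produce a complete system of eigenvectors (power iteration of the resolvent).
  Dynkin's formula passes from test functions to the closure and shows that \<open>T\<^sub>t\<close> acts by
  \<open>exp (- \<mu> t)\<close> on eigenfunctions. The kernel consists of constants: an invariant set \<open>B\<close> would cut
  the coordinate functions into further eigenfunctions for \<open>\<lambda>\<close>, so that \<open>1\<^sub>B(z) z\<close> is linear in \<open>z\<close>, which on a
  connected submanifold forces \<open>B\<close> to be null or conull.\<close>

section \<open>Completeness of eigenvectors\<close>

text \<open>Members of L2 are functions, so the inner product has null vectors and
  \<open>T s\<close> is additive only almost everywhere. The abstract part therefore works with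
  semidefinite forms on a subspace, states linearity of operators weakly (tested against vectors)
  and forms no quotient. Functional calculus is replaced by Cauchy-Schwarz for well-chosen
  semidefinite forms, which turns nearly extremal vectors into nearly null ones. The generator is
  reached only through compactly supported test functions, and on a noncompact \<open>M\<close>
  neither the constants nor the truncated coordinates are among them. Their membership in the graph
  is proved through self-adjointness, by pairing them with all pairs of the graph in Dynkin's
  formula. This pairing exchanges integrals over time and space, whereas the kernels are given as
  measurable in the starting point for each fixed time; joint measurability has to be extracted from
  continuity in time.\<close>

locale psd_form =
  fixes W :: "'v::real_vector set" and B :: "'v \<Rightarrow> 'v \<Rightarrow> real"
  assumes subsp: "subspace W"
    and form_sym: "x \<in> W \<Longrightarrow> y \<in> W \<Longrightarrow> B x y = B y x"
    and form_add: "x \<in> W \<Longrightarrow> y \<in> W \<Longrightarrow> z \<in> W \<Longrightarrow> B (x + y) z = B x z + B y z"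
    and form_scale: "x \<in> W \<Longrightarrow> z \<in> W \<Longrightarrow> B (a *\<^sub>R x) z = a * B x z"
    and form_nonneg: "x \<in> W \<Longrightarrow> 0 \<le> B x x"
begin

lemma mem_simps [simp]:
  "0 \<in> W" "x \<in> W \<Longrightarrow> y \<in> W \<Longrightarrow> x + y \<in> W" "x \<in> W \<Longrightarrow> y \<in> W \<Longrightarrow> x - y \<in> W"
  "x \<in> W \<Longrightarrow> a *\<^sub>R x \<in> W"
  using subsp by (auto intro: subspace_0 subspace_add subspace_diff subspace_scale)

lemma form_add_right: "x \<in> W \<Longrightarrow> y \<in> W \<Longrightarrow> z \<in> W \<Longrightarrow> B z (x + y) = B z x + B z y"
  using form_add form_sym by simp

lemma form_scale_right: "x \<in> W \<Longrightarrow> z \<in> W \<Longrightarrow> B z (a *\<^sub>R x) = a * B z x"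
  using form_scale form_sym by simp

lemma form_diff: "x \<in> W \<Longrightarrow> y \<in> W \<Longrightarrow> z \<in> W \<Longrightarrow> B (x - y) z = B x z - B y z"
  using form_add[of "x - y" y z] by simp

lemma form_diff_right: "x \<in> W \<Longrightarrow> y \<in> W \<Longrightarrow> z \<in> W \<Longrightarrow> B z (x - y) = B z x - B z y"
  using form_diff form_sym by simp

lemma form_zero: "x \<in> W \<Longrightarrow> B 0 x = 0" "x \<in> W \<Longrightarrow> B x 0 = 0"
  using form_scale[of x x 0] form_scale_right[of x x 0] by auto

lemmas form_simps = form_add form_add_right form_scale form_scale_right form_diff form_diff_right
  form_zero

text \<open>\<open>B\<close> is nonnegative at \<open>x + a *\<^sub>R y\<close> for all
  \<open>a\<close>. Null vectors occur, so \<open>B y y = 0\<close> is a genuine case: the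
  polynomial is then affine in \<open>a\<close>, and a nonzero slope would make it take the value
  -1.\<close>

lemma Cauchy_Schwarz:
  assumes "x \<in> W" "y \<in> W"
  shows "(B x y)\<^sup>2 \<le> B x x * B y y"
proof -
  have q: "0 \<le> B x x + 2 * a * B x y + a\<^sup>2 * B y y" for a
    using form_nonneg[of "x + a *\<^sub>R y"] assms form_sym[of x y]
    by (simp add: form_simps power2_eq_square algebra_simps)
  show ?thesis
  proof (cases "B y y = 0")
    case True
    have "B x y = 0"
    proof (rule ccontr)
      assume "B x y \<noteq> 0"
      with q[of "- (B x x + 1) / (2 * B x y)"] True show False by (simp add: field_simps)
    qed
    then show ?thesis using True by simp
  next
    case False
    then have pos: "B y y > 0" using form_nonneg[OF assms(2)] by simp
    have "0 \<le> B x x - (B x y)\<^sup>2 / B y y"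
      using q[of "- B x y / B y y"] pos by (simp add: field_simps power2_eq_square)
    then show ?thesis using pos by (simp add: field_simps)
  qed
qed

text \<open>Null vectors are orthogonal to everything, so statements tested by the form pass between
  representatives. Applied to a form other than the inner product, this turns equality in an
  estimate into a linear identity.\<close>

lemma form_null: "x \<in> W \<Longrightarrow> y \<in> W \<Longrightarrow> B x x = 0 \<Longrightarrow> B x y = 0"
  using Cauchy_Schwarz[of x y] by simp

definition seminorm :: "'v \<Rightarrow> real" where "seminorm x = sqrt (B x x)"

lemma seminorm_ge_0: "x \<in> W \<Longrightarrow> 0 \<le> seminorm x"
  by (simp add: seminorm_def form_nonneg)

lemma seminorm_square: "x \<in> W \<Longrightarrow> (seminorm x)\<^sup>2 = B x x"
  by (simp add: seminorm_def form_nonneg)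

lemma seminorm_scale: "x \<in> W \<Longrightarrow> seminorm (a *\<^sub>R x) = \<bar>a\<bar> * seminorm x"
  by (simp add: seminorm_def form_simps real_sqrt_mult) 

lemma abs_form_le: "x \<in> W \<Longrightarrow> y \<in> W \<Longrightarrow> \<bar>B x y\<bar> \<le> seminorm x * seminorm y"
  unfolding seminorm_def
  using Cauchy_Schwarz[of x y] by (metis real_sqrt_abs real_sqrt_le_mono real_sqrt_mult)

lemma seminorm_triangle:
  assumes "x \<in> W" "y \<in> W"
  shows "seminorm (x + y) \<le> seminorm x + seminorm y"
proof (rule power2_le_imp_le)
  have "(seminorm (x + y))\<^sup>2 = B x x + 2 * B x y + B y y"
    using assms form_sym[of x y] by (simp add: seminorm_square form_simps)
  also have "\<dots> \<le> (seminorm x + seminorm y)\<^sup>2"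
    using abs_form_le[OF assms] assms by (simp add: power2_sum seminorm_square)
  finally show "(seminorm (x + y))\<^sup>2 \<le> (seminorm x + seminorm y)\<^sup>2" .
qed (use assms seminorm_ge_0 in auto)

lemma seminorm_minus_commute: "x \<in> W \<Longrightarrow> y \<in> W \<Longrightarrow> seminorm (x - y) = seminorm (y - x)"
  using seminorm_scale[of "x - y" "-1"] by (simp add: scaleR_minus1_left)

lemma seminorm_triangle_diff:
  assumes "x \<in> W" "y \<in> W" "z \<in> W"
  shows "seminorm (x - z) \<le> seminorm (x - y) + seminorm (y - z)"
  using seminorm_triangle[of "x - y" "y - z"] assms by simp

lemma seminorm_le_add_diff: "x \<in> W \<Longrightarrow> y \<in> W \<Longrightarrow> seminorm x \<le> seminorm y + seminorm (x - y)"
  using seminorm_triangle[of y "x - y"] by simp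

lemma seminorm_cong:
  assumes "x \<in> W" "y \<in> W" "seminorm (x - y) = 0"
  shows "seminorm x = seminorm y"
  using seminorm_le_add_diff[OF assms(1,2)] seminorm_le_add_diff[OF assms(2,1)]
    seminorm_minus_commute[OF assms(1,2)] assms(3) by simp

lemma seminorm_tendsto:
  assumes s: "\<And>n. s n \<in> W" and x: "x \<in> W" and lim: "(\<lambda>n. seminorm (s n - x)) \<longlonglongrightarrow> 0"
  shows "(\<lambda>n. seminorm (s n)) \<longlonglongrightarrow> seminorm x"
proof (rule LIM_zero_cancel, rule Lim_null_comparison[OF _ lim])
  have "\<bar>seminorm (s n) - seminorm x\<bar> \<le> seminorm (s n - x)" for n
    using seminorm_le_add_diff[OF s x, of n] seminorm_le_add_diff[OF x s, of n]
      seminorm_minus_commute[OF s x, of n] by simp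
  then show "\<forall>\<^sub>F n in sequentially. norm (seminorm (s n) - seminorm x) \<le> seminorm (s n - x)"
    by simp
qed

lemma seminorm_eq_0: "x \<in> W \<Longrightarrow> seminorm x = 0 \<longleftrightarrow> B x x = 0"
  by (simp add: seminorm_def)

end

section \<open>Completeness in a seminorm, orthogonal approximation and extremal
  eigenvectors\<close>

locale semi_hilbert = psd_form V ip for V :: "'v::real_vector set" and ip +
  assumes complete:
    "(\<And>n. s n \<in> V) \<Longrightarrow> (\<And>e. 0 < e \<Longrightarrow> \<exists>N. \<forall>m\<ge>N. \<forall>n\<ge>N. sqrt (ip (s m - s n) (s m - s n)) < e) \<Longrightarrow>
      \<exists>x\<in>V. (\<lambda>n. sqrt (ip (s n - x) (s n - x))) \<longlonglongrightarrow> 0"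
begin

lemma Cauchy_limit:
  assumes "\<And>n. s n \<in> V" and "\<And>e. 0 < e \<Longrightarrow> \<exists>N. \<forall>m\<ge>N. \<forall>n\<ge>N. seminorm (s m - s n) < e"
  obtains x where "x \<in> V" "(\<lambda>n. seminorm (s n - x)) \<longlonglongrightarrow> 0"
proof -
  have "\<exists>x\<in>V. (\<lambda>n. sqrt (ip (s n - x) (s n - x))) \<longlonglongrightarrow> 0"
    using assms(2) unfolding seminorm_def by (rule complete[OF assms(1)])
  then show ?thesis using that unfolding seminorm_def by metis
qed

text \<open>Telescoping against a geometric series. The explicit distance from the starting vector
  later keeps the limit of the power iteration from being null.\<close>

lemma geometric_limit:
  assumes s: "\<And>n. s n \<in> V" and step: "\<And>n. seminorm (s (Suc n) - s n) \<le> a * \<theta> ^ n"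
    and \<theta>: "0 \<le> \<theta>" "\<theta> < 1" and a: "0 \<le> a"
  obtains x where "x \<in> V" "(\<lambda>n. seminorm (s n - x)) \<longlonglongrightarrow> 0"
    "seminorm (s 0 - x) \<le> a / (1 - \<theta>)"
proof -
  have tail: "seminorm (s (n + k) - s n) \<le> a * \<theta> ^ n / (1 - \<theta>)" for n k
  proof -
    have "seminorm (s (n + k) - s n) \<le> (\<Sum>i<k. a * \<theta> ^ (n + i))"
    proof (induction k)
      case 0
      then show ?case by (simp add: seminorm_def form_zero)
    next
      case (Suc k)
      then show ?case
        using seminorm_triangle_diff[of "s (n + Suc k)" "s (n + k)" "s n"] s step[of "n + k"] by simp
    qed
    also have "\<dots> = a * \<theta> ^ n * (\<Sum>i<k. \<theta> ^ i)"
      by (simp add: power_add sum_distrib_left mult.assoc)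
    also have "\<dots> \<le> a * \<theta> ^ n * (1 / (1 - \<theta>))"
    proof (rule mult_left_mono)
      have "(\<Sum>i<k. \<theta> ^ i) = (1 - \<theta> ^ k) / (1 - \<theta>)" using \<theta> by (simp add: sum_gp_strict)
      then show "(\<Sum>i<k. \<theta> ^ i) \<le> 1 / (1 - \<theta>)" using \<theta> by (simp add: divide_right_mono)
    qed (use a \<theta> in simp)
    finally show ?thesis by simp
  qed
  have lim: "(\<lambda>n. a * \<theta> ^ n / (1 - \<theta>)) \<longlonglongrightarrow> 0"
    using LIMSEQ_realpow_zero[OF \<theta>] by (intro tendsto_divide_zero tendsto_mult_right_zero)
  have cau: "\<exists>N. \<forall>m\<ge>N. \<forall>n\<ge>N. seminorm (s m - s n) < e" if "0 < e" for e
  proof -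
    have "\<forall>\<^sub>F n in sequentially. a * \<theta> ^ n / (1 - \<theta>) < e / 2"
      using order_tendstoD(2)[OF lim, of "e/2"] that by simp
    then obtain N where N: "a * \<theta> ^ N / (1 - \<theta>) < e / 2" by (auto simp: eventually_sequentially)
    have "seminorm (s m - s n) < e" if "m \<ge> N" "n \<ge> N" for m n
    proof -
      have "seminorm (s m - s N) \<le> a * \<theta> ^ N / (1 - \<theta>)" "seminorm (s n - s N) \<le> a * \<theta> ^ N / (1 - \<theta>)"
        using tail[of N "m - N"] tail[of N "n - N"] that by simp_all
      then show ?thesis
        using seminorm_triangle_diff[of "s m" "s N" "s n"] s seminorm_minus_commute[of "s n" "s N"] N
        by (smt (verit) field_sum_of_halves)
    qed
    then show ?thesis by blast
  qed
  obtain x where x: "x \<in> V" "(\<lambda>n. seminorm (s n - x)) \<longlonglongrightarrow> 0" using Cauchy_limit[OF s cau] by blast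
  have "seminorm (s 0 - x) \<le> a / (1 - \<theta>) + seminorm (s n - x)" for n
    using seminorm_triangle_diff[of "s 0" "s n" x] s x tail[of 0 n]
      seminorm_minus_commute[of "s n" "s 0"] by simp
  then have "seminorm (s 0 - x) \<le> a / (1 - \<theta>)"
    using tendsto_lowerbound[OF tendsto_add[OF tendsto_const x(2)]] by (auto intro!: always_eventually)
  with x show ?thesis using that by blast
qed

text \<open>Cauchy-Schwarz for \<open>F\<close> at \<open>x\<close> and \<open>g\<close> bounds the
  square of \<open>ip g g = F x g\<close> by \<open>F x x\<close> times \<open>K * ip g g\<close>;
  one factor cancels. A small value of the quadratic form at \<open>x\<close> thus forces a small
  representing vector \<open>g\<close>.\<close>

lemma form_represented_bound:
  assumes F: "psd_form W F" and W: "W \<subseteq> V" and x: "x \<in> W" and g: "g \<in> W"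
    and rep: "\<And>w. w \<in> W \<Longrightarrow> ip g w = F x w" and K: "0 \<le> K" "\<And>w. w \<in> W \<Longrightarrow> F w w \<le> K * ip w w"
  shows "ip g g \<le> K * F x x"
proof -
  interpret F: psd_form W F by fact
  have "(ip g g)\<^sup>2 \<le> F x x * F g g" using F.Cauchy_Schwarz[OF x g] rep[OF g] by simp
  also have "\<dots> \<le> F x x * (K * ip g g)" by (intro mult_left_mono K g F.form_nonneg x)
  finally have *: "ip g g * ip g g \<le> (K * F x x) * ip g g" by (simp add: power2_eq_square ac_simps)
  show ?thesis
  proof (cases "ip g g = 0")
    case True
    then show ?thesis using K(1) F.form_nonneg[OF x] by simp
  next
    case False
    then have "0 < ip g g" using form_nonneg g W by (metis less_eq_real_def subsetD)
    then show ?thesis using * mult_right_le_imp_le by blast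
  qed
qed

text \<open>A minimizing sequence for the distance from \<open>f\<close> to \<open>E\<close> is
  Cauchy, and \<open>f\<close> minus its limit is orthogonal to \<open>E\<close>; by
  \<open>orth\<close> this difference is null, so the infimum is 0. The limit lies in
  \<open>V\<close> and possibly not in \<open>E\<close>.\<close>

lemma projection_dense:
  assumes E: "subspace E" "E \<subseteq> V" and f: "f \<in> V"
    and orth: "\<And>w. w \<in> V \<Longrightarrow> (\<And>e. e \<in> E \<Longrightarrow> ip w e = 0) \<Longrightarrow> ip w w = 0"
  obtains s where "\<And>n. s n \<in> E" "(\<lambda>n. seminorm (f - s n)) \<longlonglongrightarrow> 0"
proof -
  let ?D = "(\<lambda>e. ip (f - e) (f - e)) ` E"
  define d where "d = Inf ?D"
  have EV: "e \<in> E \<Longrightarrow> e \<in> V" for e using E by auto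
  have ne: "?D \<noteq> {}" using subspace_0[OF E(1)] by auto
  have bdd: "bdd_below ?D" by (rule bdd_belowI[of _ 0]) (auto intro!: form_nonneg mem_simps(3) f dest: EV)
  have d_le: "d \<le> ip (f - e) (f - e)" if "e \<in> E" for e
    unfolding d_def by (intro cInf_lower bdd imageI that)
  have d0: "0 \<le> d" unfolding d_def by (intro cInf_greatest ne) (auto intro!: form_nonneg mem_simps(3) f dest: EV)
  have "\<exists>e\<in>E. ip (f - e) (f - e) < d + 1 / Suc n" for n
    using cInf_lessD[OF ne, of "d + 1 / Suc n"] unfolding d_def by auto
  then obtain s where s: "\<And>n. s n \<in> E" and sd: "\<And>n. ip (f - s n) (f - s n) < d + 1 / Suc n" by metis
  \<comment> \<open>Parallelogram law: the midpoint of \<open>x\<close> and \<open>y\<close> lies in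
    \<open>E\<close>, so its squared distance from \<open>f\<close> is at least
    \<open>d\<close>.\<close>
  have par: "ip (x - y) (x - y) \<le> 2 * (ip (f - x) (f - x) - d) + 2 * (ip (f - y) (f - y) - d)"
    if "x \<in> E" "y \<in> E" for x y
  proof -
    have m: "(1/2) *\<^sub>R (x + y) \<in> E" using that E(1) by (auto intro: subspace_add subspace_scale)
    have "ip (x - y) (x - y) = 2 * ip (f - x) (f - x) + 2 * ip (f - y) (f - y)
        - 4 * ip (f - (1/2) *\<^sub>R (x + y)) (f - (1/2) *\<^sub>R (x + y))"
      using EV[OF that(1)] EV[OF that(2)] f form_sym[of x y] form_sym[of x f] form_sym[of y f]
      by (simp add: form_simps algebra_simps)
    then show ?thesis using d_le[OF m] by simp
  qed
  have cau: "\<exists>N. \<forall>m\<ge>N. \<forall>n\<ge>N. seminorm (s m - s n) < e" if "0 < e" for e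
  proof -
    obtain N :: nat where N: "4 / e\<^sup>2 < N" using reals_Archimedean2 by blast
    have "seminorm (s m - s n) < e" if mn: "m \<ge> N" "n \<ge> N" for m n
    proof -
      have "ip (s m - s n) (s m - s n) < 2 / Suc m + 2 / Suc n"
        using par[OF s s, of m n] sd[of m] sd[of n] by simp
      also have "\<dots> \<le> 2 / Suc N + 2 / Suc N"
        using mn by (intro add_mono divide_left_mono) auto
      also have "\<dots> = 4 / Suc N" by simp
      also have "\<dots> < e\<^sup>2"
      proof -
        have "4 < e\<^sup>2 * N" using N \<open>0 < e\<close> by (simp add: field_simps)
        also have "\<dots> \<le> e\<^sup>2 * Suc N" by (intro mult_left_mono) auto
        finally show ?thesis by (simp add: field_simps)
      qed
      finally show ?thesis unfolding seminorm_def using \<open>0 < e\<close> by (simp add: real_less_lsqrt)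
    qed
    then show ?thesis by blast
  qed
  obtain x where x: "x \<in> V" "(\<lambda>n. seminorm (s n - x)) \<longlonglongrightarrow> 0" using Cauchy_limit[OF EV[OF s] cau] by blast
  define w where "w = f - x"
  have wV: "w \<in> V" unfolding w_def using f x by simp
  have x': "(\<lambda>n. seminorm (x - s n)) \<longlonglongrightarrow> 0"
    using x EV[OF s] seminorm_minus_commute by simp
  have lim: "(\<lambda>n. seminorm (f - s n)) \<longlonglongrightarrow> seminorm w"
    using x' EV[OF s] f wV by (intro seminorm_tendsto) (auto simp: w_def)
  have "(\<lambda>n. (seminorm (f - s n))\<^sup>2) \<longlonglongrightarrow> d"
  proof (rule tendsto_sandwich[of "\<lambda>n. d" _ _ "\<lambda>n. d + 1 / Suc n"])
    show "\<forall>\<^sub>F n in sequentially. d \<le> (seminorm (f - s n))\<^sup>2"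
      using d_le[OF s] by (auto simp: seminorm_square f EV[OF s])
    show "\<forall>\<^sub>F n in sequentially. (seminorm (f - s n))\<^sup>2 \<le> d + 1 / Suc n"
      using sd by (auto simp: seminorm_square f EV[OF s] less_imp_le intro!: always_eventually)
    show "(\<lambda>n. d + 1 / Suc n) \<longlonglongrightarrow> d"
      using tendsto_add[OF tendsto_const LIMSEQ_Suc[OF lim_1_over_n]] by simp
  qed simp
  moreover have "(\<lambda>n. (seminorm (f - s n))\<^sup>2) \<longlonglongrightarrow> (seminorm w)\<^sup>2" by (intro tendsto_power lim)
  ultimately have wd: "ip w w = d" using LIMSEQ_unique seminorm_square[OF wV] by auto
  have "ip w e = 0" if e: "e \<in> E" for e
  proof -
    \<comment> \<open>As \<open>w\<close> is only a limit of the differences \<open>f - s n\<close>,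
      minimality is used at \<open>s n + a *\<^sub>R e\<close>, an element of \<open>E\<close>, and
      passed to the limit. A nonnegative quadratic in \<open>a\<close> without constant term has no
      linear term.\<close>
    have q: "0 \<le> - 2 * a * ip w e + a\<^sup>2 * ip e e" for a
    proof -
      have "d \<le> (seminorm (w - a *\<^sub>R e))\<^sup>2"
      proof (rule tendsto_lowerbound)
        have "(\<lambda>n. seminorm (f - (s n + a *\<^sub>R e) - (w - a *\<^sub>R e))) \<longlonglongrightarrow> 0"
          using x' by (simp add: w_def)
        then show "(\<lambda>n. (seminorm (f - (s n + a *\<^sub>R e)))\<^sup>2) \<longlonglongrightarrow> (seminorm (w - a *\<^sub>R e))\<^sup>2"
          using EV[OF s] EV[OF e] f wV by (intro tendsto_power seminorm_tendsto) simp_all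
        have sE: "s n + a *\<^sub>R e \<in> E" for n using s e E(1) by (auto intro: subspace_add subspace_scale)
        have "d \<le> (seminorm (f - (s n + a *\<^sub>R e)))\<^sup>2" for n
          using d_le[OF sE] EV[OF sE] f by (simp add: seminorm_square)
        then show "\<forall>\<^sub>F n in sequentially. d \<le> (seminorm (f - (s n + a *\<^sub>R e)))\<^sup>2" by simp
      qed simp
      moreover have "(seminorm (w - a *\<^sub>R e))\<^sup>2 = ip w w - 2 * a * ip w e + a\<^sup>2 * ip e e"
        unfolding seminorm_square[OF mem_simps(3)[OF wV mem_simps(4)[OF EV[OF e]]]]
        using wV EV[OF e] form_sym[of e w] by (simp add: form_simps power2_eq_square algebra_simps)
      ultimately show ?thesis using wd by linarith
    qed
    show ?thesis
    proof (cases "ip e e = 0")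
      case True
      then show ?thesis using form_null[OF EV[OF e] wV] form_sym[OF wV EV[OF e]] by linarith
    next
      case False
      then have "0 < ip e e" using form_nonneg[OF EV[OF e]] by simp
      then have "(ip w e)\<^sup>2 \<le> 0" using q[of "ip w e / ip e e"] by (simp add: power2_eq_square field_simps)
      then show ?thesis by simp
    qed
  qed
  then have "ip w w = 0" using orth[OF wV] by blast
  then have "seminorm w = 0" by (simp add: seminorm_def)
  with lim have "(\<lambda>n. seminorm (f - s n)) \<longlonglongrightarrow> 0" by simp
  with s show ?thesis by (rule that)
qed


text \<open>The eigenvalue is the supremum \<open>r\<close> of the Rayleigh quotient. By
  \<open>gap\<close> there is no spectrum immediately below \<open>r\<close>, so
  \<open>C = r - R\<close> satisfies \<open>|C x|^2 \<ge> \<epsilon> * ip (C x) x\<close>, and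
  iterating \<open>R / r\<close> damps geometrically what is off the eigenspace. The gap does the
  work that compactness does in the usual argument.\<close>

lemma eigenvector_exists:
  fixes R :: "'v \<Rightarrow> 'v" and K :: real
  assumes subW: "subspace W" and WV: "W \<subseteq> V"
    and closed: "\<And>s x. (\<And>n. s n \<in> W) \<Longrightarrow> x \<in> V \<Longrightarrow> (\<lambda>n. seminorm (s n - x)) \<longlonglongrightarrow> 0 \<Longrightarrow> x \<in> W"
    and RW: "\<And>x. x \<in> W \<Longrightarrow> R x \<in> W"
    and sym: "\<And>x y. x \<in> W \<Longrightarrow> y \<in> W \<Longrightarrow> ip (R x) y = ip x (R y)"
    and pos: "\<And>x. x \<in> W \<Longrightarrow> 0 \<le> ip (R x) x"
    and bound: "\<And>x. x \<in> W \<Longrightarrow> seminorm (R x) \<le> K * seminorm x"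
    and gap: "\<And>\<rho>. 0 < \<rho> \<Longrightarrow> \<exists>\<epsilon>>0. \<forall>\<rho>'. \<rho> - \<epsilon> < \<rho>' \<and> \<rho>' < \<rho> \<longrightarrow>
        (\<exists>c>0. \<forall>x\<in>W. c * seminorm x \<le> seminorm (R x - \<rho>' *\<^sub>R x))"
    and x0: "x0 \<in> W" "ip (R x0) (R x0) \<noteq> 0"
  obtains \<rho> y where "0 < \<rho>" "y \<in> W" "ip y y \<noteq> 0" "seminorm (R y - \<rho> *\<^sub>R y) = 0"
proof -
  have WVD [simp]: "x \<in> W \<Longrightarrow> x \<in> V" for x using WV by auto
  have Wm [simp]: "0 \<in> W" "x \<in> W \<Longrightarrow> y \<in> W \<Longrightarrow> x + y \<in> W" "x \<in> W \<Longrightarrow> y \<in> W \<Longrightarrow> x - y \<in> W"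
    "x \<in> W \<Longrightarrow> a *\<^sub>R x \<in> W" for a x y
    using subW by (auto intro: subspace_0 subspace_add subspace_diff subspace_scale)
  note RW [simp]
  have R_add: "ip (R (x + y)) z = ip (R x) z + ip (R y) z" if "x \<in> W" "y \<in> W" "z \<in> W" for x y z
    using that by (simp add: sym form_simps)
  have R_scale: "ip (R (a *\<^sub>R x)) z = a * ip (R x) z" if "x \<in> W" "z \<in> W" for a x z
    using that by (simp add: sym form_simps)
  have R_diff: "ip (R (x - y)) z = ip (R x) z - ip (R y) z" if "x \<in> W" "y \<in> W" "z \<in> W" for x y z
    using that by (simp add: sym form_simps)
  have Rc: "ip (R x) y = ip (R y) x" if "x \<in> W" "y \<in> W" for x y
    using that sym[of x y] form_sym[of x "R y"] by simp
  have FR: "psd_form W (\<lambda>x y. ip (R x) y)"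
    by unfold_locales (use subW pos Rc R_add R_scale in auto)
  have K0: "0 \<le> K" and x0n: "ip x0 x0 \<noteq> 0"
  proof -
    show x0n: "ip x0 x0 \<noteq> 0"
      using form_null[of x0 "R (R x0)"] sym[of x0 "R x0"] x0 by (metis RW WVD)
    have "0 < seminorm x0" using x0n x0(1) seminorm_ge_0[of x0] seminorm_eq_0[of x0] by simp
    moreover have "0 \<le> K * seminorm x0"
      using bound[OF x0(1)] seminorm_ge_0[of "R x0"] x0(1) by simp
    ultimately show "0 \<le> K" by (simp add: zero_le_mult_iff)
  qed
  have normalise: "ip (a *\<^sub>R x) (a *\<^sub>R x) = 1" if "x \<in> W" "ip x x \<noteq> 0" "a = 1 / seminorm x" for a x
    using that form_nonneg[of x] by (simp add: form_simps seminorm_def)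
  let ?Q = "{ip (R x) x | x. x \<in> W \<and> ip x x = 1}"
  define r where "r = Sup ?Q"
  have bdd: "bdd_above ?Q"
  proof (rule bdd_aboveI)
    fix q assume "q \<in> ?Q"
    then obtain x where x: "x \<in> W" "ip x x = 1" "q = ip (R x) x" by auto
    have "seminorm x = 1" using x by (simp add: seminorm_def)
    then show "q \<le> K" using abs_form_le[of "R x" x] bound[of x] x by auto
  qed
  have ne: "?Q \<noteq> {}" using normalise[OF x0(1) x0n refl] x0(1) Wm(4) by blast
  have r_ge: "ip (R x) x \<le> r * ip x x" if x: "x \<in> W" for x
  proof (cases "ip x x = 0")
    case True
    then show ?thesis using form_null[of x "R x"] form_sym[of x "R x"] x by simp
  next
    case False
    let ?a = "1 / seminorm x"
    have "ip (R (?a *\<^sub>R x)) (?a *\<^sub>R x) \<le> r"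
      unfolding r_def using normalise[OF x False refl] x Wm(4) by (intro cSup_upper bdd) blast
    then have "ip (R x) x / ip x x \<le> r"
      using x form_nonneg[of x] by (simp add: R_scale form_simps seminorm_def)
    then show ?thesis using False form_nonneg[of x] x by (simp add: field_simps)
  qed
  have near: "\<exists>x\<in>W. ip x x = 1 \<and> r - \<delta> < ip (R x) x" if "0 < \<delta>" for \<delta>
    using less_cSupD[OF ne, of "r - \<delta>"] that unfolding r_def by auto
  \<comment> \<open>If \<open>ip (R x0) x0\<close> vanished, \<open>x0\<close> would be a null
    vector of the form of \<open>R\<close>, and pairing it with \<open>R x0\<close> would give
    \<open>ip (R x0) (R x0) = 0\<close>.\<close>
  have r0: "0 < r"
  proof -
    interpret FR: psd_form W "\<lambda>x y. ip (R x) y" by fact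
    have "ip (R x0) x0 \<noteq> 0" using FR.form_null[OF x0(1), of "R x0"] x0 by auto
    then have "0 < r * ip x0 x0" using pos[OF x0(1)] r_ge[OF x0(1)] by simp
    then show ?thesis using form_nonneg[of x0] x0 by (simp add: zero_less_mult_iff)
  qed
  define C where "C x = r *\<^sub>R x - R x" for x
  have CW [simp]: "C x \<in> W" if "x \<in> W" for x using that by (simp add: C_def)
  have C_ip: "ip (C x) y = r * ip x y - ip (R x) y" if "x \<in> W" "y \<in> W" for x y
    using that by (simp add: C_def form_simps)
  have FC: "psd_form W (\<lambda>x y. ip (C x) y)"
  proof
    fix x y z assume W: "x \<in> W" "y \<in> W" "z \<in> W"
    show "ip (C x) y = ip (C y) x" using W Rc[of x y] form_sym[of x y] by (simp add: C_ip)
    show "ip (C (x + y)) z = ip (C x) z + ip (C y) z"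
      using W by (simp add: C_ip R_add form_add algebra_simps)
  next
    fix x z a assume W: "x \<in> W" "z \<in> W"
    show "ip (C (a *\<^sub>R x)) z = a * ip (C x) z"
      using W by (simp add: C_ip R_scale form_scale algebra_simps)
  next
    fix x assume "x \<in> W"
    then show "0 \<le> ip (C x) x" using r_ge by (simp add: C_ip)
  qed (rule subW)
  interpret FC: psd_form W "\<lambda>x y. ip (C x) y" by fact
  have C_le: "ip (C x) x \<le> r * ip x x" if "x \<in> W" for x using that pos[of x] by (simp add: C_ip)
  have CC: "ip (C x) (C x) \<le> r * ip (C x) x" if "x \<in> W" for x
    using that C_le r0 by (intro form_represented_bound[OF FC WV]) auto
  obtain \<epsilon>' where \<epsilon>': "0 < \<epsilon>'" and
    reg': "\<And>\<rho>'. r - \<epsilon>' < \<rho>' \<Longrightarrow> \<rho>' < r \<Longrightarrow> \<exists>c>0. \<forall>x\<in>W. c * seminorm x \<le> seminorm (R x - \<rho>' *\<^sub>R x)"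
    using gap[OF r0] by metis
  \<comment> \<open>The cap at \<open>r\<close> keeps \<open>1 - \<epsilon> / r\<close>, the later
    contraction factor, nonnegative.\<close>
  define \<epsilon> where "\<epsilon> = min \<epsilon>' r"
  have \<epsilon>: "0 < \<epsilon>" "\<epsilon> \<le> r" using \<epsilon>' r0 by (auto simp: \<epsilon>_def)
  have reg: "\<exists>c>0. \<forall>x\<in>W. c * seminorm x \<le> seminorm (R x - \<rho>' *\<^sub>R x)" if "r - \<epsilon> < \<rho>'" "\<rho>' < r" for \<rho>'
    using reg' that by (auto simp: \<epsilon>_def)
  define m where "m = r - \<epsilon> / 2"
  define S where "S \<sigma> x = R x - \<sigma> *\<^sub>R x" for \<sigma> x
  have SW [simp]: "S \<sigma> x \<in> W" if "x \<in> W" for \<sigma> x using that by (simp add: S_def)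
  have S_ip: "ip (S \<sigma> x) y = ip (R x) y - \<sigma> * ip x y" if "x \<in> W" "y \<in> W" for \<sigma> x y
    using that by (simp add: S_def form_simps)
  have S_sym: "ip (S \<sigma> x) y = ip x (S \<sigma> y)" if "x \<in> W" "y \<in> W" for \<sigma> x y
    using that sym by (simp add: S_def form_simps)
  have S_add: "ip (S \<sigma> (x + y)) z = ip (S \<sigma> x) z + ip (S \<sigma> y) z" if "x \<in> W" "y \<in> W" "z \<in> W" for \<sigma> x y z
    using that by (simp add: S_sym form_simps)
  have S_scale: "ip (S \<sigma> (a *\<^sub>R x)) z = a * ip (S \<sigma> x) z" if "x \<in> W" "z \<in> W" for \<sigma> a x z
    using that by (simp add: S_sym form_simps)
  \<comment> \<open>\<open>m\<close> is the midpoint of the gap from \<open>r - \<epsilon>\<close>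
    to \<open>r\<close>. Let \<open>k\<close> be the infimum of \<open>|S m x|^2\<close> over unit
    vectors and \<open>\<kappa> = sqrt k\<close>. If \<open>\<kappa> < \<epsilon> / 2\<close>, both
    \<open>m + \<kappa>\<close> and \<open>m - \<kappa>\<close> lie in the gap, so
    \<open>S (m + \<kappa>) (S (m - \<kappa>) v)\<close> is bounded below; but this vector
    represents the semidefinite form \<open>|S m v|^2 - k * |v|^2\<close>, which gets arbitrarily
    small on unit vectors.\<close>
  have mid: "(\<epsilon> / 2)\<^sup>2 * ip x x \<le> ip (S m x) (S m x)" if xW: "x \<in> W" for x
  proof -
    let ?N = "{ip (S m x) (S m x) | x. x \<in> W \<and> ip x x = 1}"
    define k where "k = Inf ?N"
    have Nne: "?N \<noteq> {}" using normalise[OF x0(1) x0n refl] x0(1) Wm(4) by blast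
    have Nbdd: "bdd_below ?N" by (rule bdd_belowI[of _ 0]) (auto intro!: form_nonneg)
    have k0: "0 \<le> k" unfolding k_def by (intro cInf_greatest Nne) (auto intro!: form_nonneg)
    have k_le: "k * ip x x \<le> ip (S m x) (S m x)" if x: "x \<in> W" for x
    proof (cases "ip x x = 0")
      case True
      then show ?thesis using form_nonneg[of "S m x"] x by simp
    next
      case False
      let ?a = "1 / seminorm x"
      have "k \<le> ip (S m (?a *\<^sub>R x)) (S m (?a *\<^sub>R x))"
        unfolding k_def using normalise[OF x False refl] x Wm(4) by (intro cInf_lower Nbdd) blast
      also have "\<dots> = ip (S m x) (S m x) / ip x x"
        using x form_nonneg[of x] form_sym[of "S m x" "S m (?a *\<^sub>R x)"]
        by (simp add: S_scale form_simps seminorm_def)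
      finally show ?thesis using False form_nonneg[of x] x by (simp add: field_simps)
    qed
    have k_near: "\<exists>x\<in>W. ip x x = 1 \<and> ip (S m x) (S m x) < k + \<delta>" if "0 < \<delta>" for \<delta>
      using cInf_lessD[OF Nne, of "k + \<delta>"] that unfolding k_def by auto
    let ?F = "\<lambda>x y. ip (S m x) (S m y) - k * ip x y"
    have FF: "psd_form W ?F"
    proof
      fix x y z a assume W: "x \<in> W" "y \<in> W" "z \<in> W"
      show "?F x y = ?F y x" using W form_sym[of x y] form_sym[of "S m x" "S m y"] by simp
      show "?F (x + y) z = ?F x z + ?F y z" using W by (simp add: S_add form_simps algebra_simps)
    next
      fix x z a assume W: "x \<in> W" "z \<in> W"
      show "?F (a *\<^sub>R x) z = a * ?F x z" using W by (simp add: S_scale form_simps algebra_simps)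
    qed (use subW k_le in auto)
    show ?thesis
    proof (rule ccontr)
      assume neg: "\<not> ?thesis"
      have "k < (\<epsilon> / 2)\<^sup>2"
      proof (rule ccontr)
        assume "\<not> k < (\<epsilon> / 2)\<^sup>2"
        then have "(\<epsilon> / 2)\<^sup>2 * ip x x \<le> k * ip x x" using form_nonneg[of x] xW by (intro mult_right_mono) auto
        with k_le[OF xW] neg show False by simp
      qed
      define \<kappa> where "\<kappa> = sqrt k"
      have \<kappa>: "0 \<le> \<kappa>" "\<kappa> < \<epsilon> / 2" "\<kappa> * \<kappa> = k"
        using \<open>k < _\<close> k0 \<epsilon> real_sqrt_less_mono[OF \<open>k < _\<close>] by (auto simp: \<kappa>_def)
      have "\<exists>c>0. \<forall>x\<in>W. c * seminorm x \<le> seminorm (S (m + \<kappa>) x)"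
        unfolding S_def using \<kappa> by (intro reg) (auto simp: m_def)
      then obtain c1 where c1: "0 < c1" "\<And>x. x \<in> W \<Longrightarrow> c1 * seminorm x \<le> seminorm (S (m + \<kappa>) x)" by auto
      have "\<exists>c>0. \<forall>x\<in>W. c * seminorm x \<le> seminorm (S (m - \<kappa>) x)"
        unfolding S_def using \<kappa> by (intro reg) (auto simp: m_def)
      then obtain c2 where c2: "0 < c2" "\<And>x. x \<in> W \<Longrightarrow> c2 * seminorm x \<le> seminorm (S (m - \<kappa>) x)" by auto
      define L where "L = (K + \<bar>m\<bar>)\<^sup>2"
      have L: "?F w w \<le> L * ip w w" if w: "w \<in> W" for w
      proof -
        have "seminorm (S m w) \<le> seminorm (R w) + \<bar>m\<bar> * seminorm w"
          using seminorm_triangle[of "R w" "(- m) *\<^sub>R w"] seminorm_scale[of w "- m"] w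
          by (simp add: S_def del: scaleR_minus_left) (simp add: algebra_simps)
        also have "\<dots> \<le> (K + \<bar>m\<bar>) * seminorm w" using bound[OF w] by (simp add: algebra_simps)
        finally have "(seminorm (S m w))\<^sup>2 \<le> ((K + \<bar>m\<bar>) * seminorm w)\<^sup>2"
          using w by (intro power_mono seminorm_ge_0) auto
        then have "ip (S m w) (S m w) \<le> L * ip w w"
          using w by (simp add: seminorm_square power_mult_distrib L_def)
        moreover have "0 \<le> k * ip w w" using k0 form_nonneg w by simp
        ultimately show ?thesis by simp
      qed
      have L0: "0 \<le> L" by (simp add: L_def)
      \<comment> \<open>Small enough that \<open>L * \<delta>\<close> stays below the square of
        \<open>c1 * c2\<close>; the \<open>+ 1\<close> covers \<open>L = 0\<close>.\<close>
      define \<delta> where "\<delta> = (c1 * c2)\<^sup>2 / (L + 1)"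
      have \<delta>: "0 < \<delta>" using c1(1) c2(1) L0 by (simp add: \<delta>_def)
      obtain v where v: "v \<in> W" "ip v v = 1" "ip (S m v) (S m v) < k + \<delta>" using k_near[OF \<delta>] by auto
      define g where "g = S (m + \<kappa>) (S (m - \<kappa>) v)"
      have gW: "g \<in> W" using v by (simp add: g_def)
      have "ip g w = ?F v w" if w: "w \<in> W" for w
      proof -
        have SS: "ip (S a v) (S b w) = ip (R v) (R w) - (a + b) * ip (R v) w + a * b * ip v w" for a b
          using v w sym[of v w] by (simp add: S_def form_simps algebra_simps)
        have "ip g w = ip (S (m - \<kappa>) v) (S (m + \<kappa>) w)"
          unfolding g_def using v w by (intro S_sym) auto
        also have "\<dots> = ip (S m v) (S m w) - (\<kappa> * \<kappa>) * ip v w"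
          unfolding SS by (simp add: algebra_simps)
        finally show ?thesis using \<kappa>(3) by simp
      qed
      then have "ip g g \<le> L * ?F v v"
        using L L0 v gW by (intro form_represented_bound[OF FF WV]) auto
      also have "\<dots> \<le> L * \<delta>" using v L0 by (intro mult_left_mono) auto
      also have "\<dots> < (c1 * c2)\<^sup>2"
        using L0 c1(1) c2(1) by (simp add: \<delta>_def divide_less_eq mult.commute)
      finally have "(seminorm g)\<^sup>2 < (c1 * c2)\<^sup>2" using gW by (simp add: seminorm_square)
      moreover have "c1 * c2 \<le> seminorm g"
      proof -
        have "seminorm v = 1" using v by (simp add: seminorm_def)
        then have "c2 \<le> seminorm (S (m - \<kappa>) v)" using c2(2)[OF v(1)] by simp
        then have "c1 * c2 \<le> c1 * seminorm (S (m - \<kappa>) v)" using c1(1) by simp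
        also have "\<dots> \<le> seminorm g" unfolding g_def using v by (intro c1) simp
        finally show ?thesis .
      qed
      ultimately show False using c1(1) c2(1) by (smt (verit) mult_pos_pos power_mono)
    qed
  qed
  \<comment> \<open>\<open>S m\<close> is \<open>\<epsilon> / 2 - C\<close>, so expanding the square
    in \<open>mid\<close> leaves exactly this.\<close>
  have gapC: "\<epsilon> * ip (C x) x \<le> ip (C x) (C x)" if "x \<in> W" for x
  proof -
    have "ip (S m x) (S m x) = (\<epsilon> / 2)\<^sup>2 * ip x x - \<epsilon> * ip (C x) x + ip (C x) (C x)"
      using that form_sym[of x "R x"]
      by (simp add: S_def C_def m_def form_simps power2_eq_square algebra_simps)
    with mid[OF that] show ?thesis by simp
  qed
  define \<theta> where "\<theta> = sqrt (1 - \<epsilon> / r)"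
  have \<theta>: "0 \<le> \<theta>" "\<theta> < 1" "\<theta>\<^sup>2 = 1 - \<epsilon> / r" using \<epsilon> r0 by (auto simp: \<theta>_def)
  \<comment> \<open>Chosen so that the steps of the iteration are at most
    \<open>a * \<theta> ^ n\<close> with \<open>a = (1 - \<theta>) / 2\<close>. They sum to at most
    1/2, and the limit cannot be null because the start is a unit vector.\<close>
  define \<delta> where "\<delta> = (1 - \<theta>)\<^sup>2 * r / 4"
  have \<delta>0: "0 < \<delta>" using \<theta> r0 by (simp add: \<delta>_def)
  obtain x where x: "x \<in> W" "ip x x = 1" "r - \<delta> < ip (R x) x" using near[OF \<delta>0] by auto
  have Cx: "ip (C x) x < \<delta>" using x by (simp add: C_ip)
  define v where "v n = ((\<lambda>y. (1 / r) *\<^sub>R R y) ^^ n) x" for n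
  have vW [simp]: "v n \<in> W" for n by (induction n) (simp_all add: v_def x)
  have v_Suc: "v (Suc n) = (1 / r) *\<^sub>R R (v n)" for n by (simp add: v_def)
  have v_diff: "v (Suc n) - v n = (- (1 / r)) *\<^sub>R C (v n)" for n
    using r0 by (simp add: v_Suc C_def algebra_simps)
  \<comment> \<open>With \<open>y = v n\<close>, the next iterate is \<open>y - C y / r\<close>. The
    bound \<open>C \<le> r\<close> makes the last term of the expansion cancel half of the cross
    term, and \<open>gapC\<close> turns the other half into \<open>\<epsilon> / r\<close> times the
    form at \<open>y\<close>.\<close>
  have contract: "ip (C (v (Suc n))) (v (Suc n)) \<le> \<theta>\<^sup>2 * ip (C (v n)) (v n)" for n
  proof -
    let ?y = "v n"
    have y: "?y \<in> W" by simp
    have eq: "v (Suc n) = ?y + (- (1 / r)) *\<^sub>R C ?y" using v_diff[of n] by (simp add: algebra_simps)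
    have "ip (C (v (Suc n))) (v (Suc n)) =
        ip (C ?y) ?y - (2 / r) * ip (C ?y) (C ?y) + (1 / r)\<^sup>2 * ip (C (C ?y)) (C ?y)"
      unfolding eq using FC.form_sym[of "C ?y" ?y]
      by (simp add: FC.form_simps power2_eq_square del: scaleR_minus_left)
        (simp add: algebra_simps diff_divide_distrib)
    also have "\<dots> \<le> ip (C ?y) ?y - (2 / r) * ip (C ?y) (C ?y) + (1 / r)\<^sup>2 * (r * ip (C ?y) (C ?y))"
      by (intro add_left_mono mult_left_mono C_le) auto
    also have "\<dots> = ip (C ?y) ?y - (1 / r) * ip (C ?y) (C ?y)"
      using r0 by (simp add: power2_eq_square field_simps)
    also have "\<dots> \<le> ip (C ?y) ?y - (1 / r) * (\<epsilon> * ip (C ?y) ?y)"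
      using gapC[OF y] r0 by (intro diff_left_mono mult_left_mono) auto
    also have "\<dots> = \<theta>\<^sup>2 * ip (C ?y) ?y" unfolding \<theta>(3) by (simp add: algebra_simps)
    finally show ?thesis .
  qed
  have decay: "ip (C (v n)) (v n) \<le> \<delta> * (\<theta> ^ n)\<^sup>2" for n
  proof (induction n)
    case 0
    then show ?case using Cx by (simp add: v_def)
  next
    case (Suc n)
    have "ip (C (v (Suc n))) (v (Suc n)) \<le> \<theta>\<^sup>2 * (\<delta> * (\<theta> ^ n)\<^sup>2)"
      using contract[of n] Suc by (smt (verit) mult_left_mono zero_le_power2)
    then show ?case by (simp add: power_mult_distrib ac_simps)
  qed
  have C_sn: "seminorm (C (v n)) \<le> sqrt (r * \<delta>) * \<theta> ^ n" for n
  proof (rule power2_le_imp_le)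
    have "(seminorm (C (v n)))\<^sup>2 \<le> r * (\<delta> * (\<theta> ^ n)\<^sup>2)"
      using CC[of "v n"] decay[of n] r0 by (simp add: seminorm_square) (smt (verit) mult_left_mono)
    also have "\<dots> = (sqrt (r * \<delta>) * \<theta> ^ n)\<^sup>2" using r0 \<delta>0 by (simp add: power_mult_distrib)
    finally show "(seminorm (C (v n)))\<^sup>2 \<le> (sqrt (r * \<delta>) * \<theta> ^ n)\<^sup>2" .
  qed (use r0 \<delta>0 \<theta> in simp)
  define a where "a = (1 - \<theta>) / 2"
  have sqrt_a: "(1 / r) * sqrt (r * \<delta>) = a"
  proof -
    have "r * \<delta> = (r * a)\<^sup>2" by (simp add: \<delta>_def a_def power2_eq_square)
    then show ?thesis using r0 \<theta> by (simp add: a_def)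
  qed
  have step: "seminorm (v (Suc n) - v n) \<le> a * \<theta> ^ n" for n
  proof -
    have "seminorm (v (Suc n) - v n) = (1 / r) * seminorm (C (v n))"
      unfolding v_diff using seminorm_scale[of "C (v n)" "- (1 / r)"] r0 by simp
    also have "\<dots> \<le> (1 / r) * (sqrt (r * \<delta>) * \<theta> ^ n)" using C_sn[of n] r0 by (intro mult_left_mono) auto
    also have "\<dots> = a * \<theta> ^ n" by (simp only: sqrt_a flip: mult.assoc)
    finally show ?thesis .
  qed
  obtain y where y: "y \<in> V" "(\<lambda>n. seminorm (v n - y)) \<longlonglongrightarrow> 0" "seminorm (v 0 - y) \<le> a / (1 - \<theta>)"
    using geometric_limit[of v a \<theta>] step \<theta> by (auto simp: a_def)
  have yW: "y \<in> W" by (rule closed[OF vW y(1,2)])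
  have "seminorm x = 1" using x by (simp add: seminorm_def)
  moreover have "a / (1 - \<theta>) = 1 / 2" using \<theta> by (simp add: a_def field_simps)
  then have "seminorm (x - y) \<le> 1 / 2" using y(3) by (simp add: v_def)
  ultimately have "seminorm y \<noteq> 0" using seminorm_le_add_diff[of x y] x yW by simp
  then have yn: "ip y y \<noteq> 0" using yW by (simp add: seminorm_eq_0)
  \<comment> \<open>\<open>C\<close> is linear only up to null vectors: the defect of additivity is
    orthogonal to all of \<open>W\<close>, itself included, so it has seminorm 0.\<close>
  have Cdiff: "seminorm (C y) \<le> seminorm (C (v n)) + r * seminorm (v n - y)" for n
  proof -
    have "ip (C y - C (v n) - C (y - v n)) w = 0" if "w \<in> W" for w
      using that yW FC.form_diff[of y "v n" w] by (simp add: form_simps)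
    then have "seminorm (C y - C (v n) - C (y - v n)) = 0" using yW by (simp add: seminorm_def)
    then have "seminorm (C y - C (v n)) \<le> seminorm (C (y - v n))"
      using seminorm_le_add_diff[of "C y - C (v n)" "C (y - v n)"] yW by simp
    moreover have "seminorm (C (y - v n)) \<le> r * seminorm (y - v n)"
    proof (rule power2_le_imp_le)
      have "ip (C (y - v n)) (C (y - v n)) \<le> r * (r * ip (y - v n) (y - v n))"
        using CC[of "y - v n"] C_le[of "y - v n"] r0 yW by (smt (verit) Wm(3) mult_left_mono vW)
      then show "(seminorm (C (y - v n)))\<^sup>2 \<le> (r * seminorm (y - v n))\<^sup>2"
        using yW by (simp add: seminorm_square power_mult_distrib power2_eq_square[of r] mult.assoc)
      show "0 \<le> r * seminorm (y - v n)" using r0 yW by (simp add: seminorm_ge_0)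
    qed
    ultimately show ?thesis
      using seminorm_le_add_diff[of "C y" "C (v n)"] yW seminorm_minus_commute[of y "v n"] by simp
  qed
  have "(\<lambda>n. sqrt (r * \<delta>) * \<theta> ^ n + r * seminorm (v n - y)) \<longlonglongrightarrow> 0"
    using tendsto_add[OF tendsto_mult_right_zero[OF LIMSEQ_realpow_zero[OF \<theta>(1,2)]]
        tendsto_mult_right_zero[OF y(2)]] by simp
  moreover have "seminorm (C y) \<le> sqrt (r * \<delta>) * \<theta> ^ n + r * seminorm (v n - y)" for n
    using Cdiff[of n] C_sn[of n] by simp
  ultimately have "seminorm (C y) \<le> 0" by (intro tendsto_lowerbound) auto
  then have "seminorm (R y - r *\<^sub>R y) = 0"
    using seminorm_ge_0[of "C y"] seminorm_minus_commute[of "r *\<^sub>R y" "R y"] yW by (simp add: C_def)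
  with r0 yW yn show ?thesis by (rule that)
qed

end


section \<open>Self-adjoint graphs with isolated spectrum and the density of their
  eigenvectors\<close>

locale discrete_selfadjoint = semi_hilbert V ip for V :: "'v::real_vector set" and ip +
  fixes A :: "('v \<times> 'v) set"
  assumes dense: "f \<in> V \<Longrightarrow> 0 < e \<Longrightarrow> \<exists>(u, v)\<in>A. seminorm (f - u) < e"
    and adjoint: "(f, g) \<in> A \<longleftrightarrow> f \<in> V \<and> g \<in> V \<and> (\<forall>(u, v)\<in>A. ip f v = ip g u)"
    and discrete: "((\<forall>w\<in>V. \<exists>(f, g)\<in>A. seminorm (g - \<mu> *\<^sub>R f - w) = 0) \<and>
        (\<exists>C. \<forall>(f, g)\<in>A. seminorm f \<le> C * seminorm (g - \<mu> *\<^sub>R f)))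
      \<or> (\<exists>f. (f, \<mu> *\<^sub>R f) \<in> A \<and> seminorm f \<noteq> 0) \<and>
        (\<exists>\<epsilon>>0. \<forall>\<mu>'. \<mu>' \<noteq> \<mu> \<and> \<bar>\<mu>' - \<mu>\<bar> < \<epsilon> \<longrightarrow>
          (\<exists>C. \<forall>(f, g)\<in>A. seminorm f \<le> C * seminorm (g - \<mu>' *\<^sub>R f)))"
    and eigenvalue_nonneg: "(f, \<mu> *\<^sub>R f) \<in> A \<Longrightarrow> seminorm f \<noteq> 0 \<Longrightarrow> 0 \<le> \<mu>"
begin

lemma A_mem: "(f, g) \<in> A \<Longrightarrow> f \<in> V" "(f, g) \<in> A \<Longrightarrow> g \<in> V"
  using adjoint by blast+

lemma A_sym: "(f, g) \<in> A \<Longrightarrow> (u, v) \<in> A \<Longrightarrow> ip f v = ip g u"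
  using adjoint by blast

text \<open>Membership in an adjoint graph is tested by inner products alone, and these do not see
  null vectors.\<close>

lemma A_cong:
  assumes "(f, g) \<in> A" "f' \<in> V" "g' \<in> V" "seminorm (f - f') = 0" "seminorm (g - g') = 0"
  shows "(f', g') \<in> A"
proof -
  have "ip f' v = ip g' u" if uv: "(u, v) \<in> A" for u v
  proof -
    note m = A_mem[OF assms(1)] A_mem[OF uv] assms(2,3)
    have "ip (f - f') v = 0" "ip (g - g') u = 0"
      using assms(4,5) m form_null[of "f - f'" v] form_null[of "g - g'" u] A_mem[OF uv] by (simp_all add: seminorm_def)
    then show ?thesis using A_sym[OF assms(1) uv] m by (simp add: form_simps)
  qed
  then show ?thesis using assms adjoint by blast
qed

lemma A_scale:
  assumes "(f, g) \<in> A"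
  shows "(a *\<^sub>R f, a *\<^sub>R g) \<in> A"
proof -
  have "ip (a *\<^sub>R f) v = ip (a *\<^sub>R g) u" if uv: "(u, v) \<in> A" for u v
    using A_mem[OF assms] A_mem[OF uv] A_sym[OF assms uv] by (simp add: form_simps)
  then show ?thesis using A_mem[OF assms] by (subst adjoint) auto
qed

lemma A_add:
  assumes "(f, g) \<in> A" "(f', g') \<in> A"
  shows "(f + f', g + g') \<in> A"
proof -
  have "ip (f + f') v = ip (g + g') u" if uv: "(u, v) \<in> A" for u v
    using A_mem[OF assms(1)] A_mem[OF assms(2)] A_mem[OF uv] A_sym[OF assms(1) uv] A_sym[OF assms(2) uv]
    by (simp add: form_simps)
  then show ?thesis using A_mem[OF assms(1)] A_mem[OF assms(2)] by (subst adjoint) auto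
qed

text \<open>By density some \<open>u\<close> in the domain is closer to \<open>g\<close> than
  \<open>g\<close> is to 0. Symmetry gives \<open>ip g u = ip f v = 0\<close>, so
  \<open>ip g g = ip g (g - u)\<close> would be smaller than itself. The graph is therefore
  single-valued up to null vectors.\<close>

lemma A_null:
  assumes "(f, g) \<in> A" "seminorm f = 0"
  shows "seminorm g = 0"
proof (rule ccontr)
  assume "seminorm g \<noteq> 0"
  note m = A_mem[OF assms(1)]
  then have pos: "0 < seminorm g" using seminorm_ge_0[of g] \<open>seminorm g \<noteq> 0\<close> by simp
  obtain u v where uv: "(u, v) \<in> A" "seminorm (g - u) < seminorm g" using dense[OF m(2) pos] by auto
  have "ip f v = 0" using assms m A_mem[OF uv(1)] form_null[of f v] by (simp add: seminorm_def)
  then have "ip g u = 0" using A_sym[OF assms(1) uv(1)] by simp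
  then have "ip g g = ip g (g - u)" using m A_mem[OF uv(1)] by (simp add: form_simps)
  also have "\<dots> \<le> seminorm g * seminorm (g - u)"
    using abs_form_le[of g "g - u"] m A_mem[OF uv(1)] by simp
  also have "\<dots> < seminorm g * seminorm g" using pos uv(2) by simp
  finally show False using seminorm_square[OF m(2)] by (simp add: power2_eq_square)
qed

lemma eigenvectors_orthogonal:
  assumes "(f, \<mu> *\<^sub>R f) \<in> A" "(g, \<nu> *\<^sub>R g) \<in> A" "\<mu> \<noteq> \<nu>"
  shows "ip f g = 0"
proof -
  have "\<nu> * ip f g = \<mu> * ip f g"
    using A_sym[OF assms(1,2)] A_mem[OF assms(1)] A_mem[OF assms(2)] by (simp add: form_simps)
  then show ?thesis using assms(3) by simp
qed

(* The resolvent of A at -1, a bounded operator, turns the isolated points of the spectrum of A into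
   gaps of its own spectrum. *)
lemma eigenvectors_total:
  assumes w: "w \<in> V" and orth: "\<And>\<mu> f. (f, \<mu> *\<^sub>R f) \<in> A \<Longrightarrow> ip w f = 0"
  shows "ip w w = 0"
proof -
  \<comment> \<open>A negative number is not an eigenvalue, so the first alternative of
    \<open>discrete\<close> holds for it, in particular at -1.\<close>
  have neg_regular: "(\<forall>w\<in>V. \<exists>(f, g)\<in>A. seminorm (g - \<mu> *\<^sub>R f - w) = 0) \<and>
        (\<exists>C. \<forall>(f, g)\<in>A. seminorm f \<le> C * seminorm (g - \<mu> *\<^sub>R f))" if "\<mu> < 0" for \<mu>
    using discrete[of \<mu>] eigenvalue_nonneg[of _ \<mu>] that by force
  have "\<exists>f. (f, w - f) \<in> A" if w: "w \<in> V" for w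
  proof -
    have "(\<forall>w\<in>V. \<exists>(f, g)\<in>A. seminorm (g - (- 1) *\<^sub>R f - w) = 0)" using neg_regular[of "-1"] by simp
    then obtain f g where fg: "(f, g) \<in> A" "seminorm (g - (- 1) *\<^sub>R f - w) = 0" using w by blast
    have "g - (w - f) = g - (- 1) *\<^sub>R f - w" by (simp add: algebra_simps)
    then have "(f, w - f) \<in> A"
      using fg A_mem[OF fg(1)] w by (intro A_cong[OF fg(1)]) (auto simp: seminorm_def form_simps)
    then show ?thesis by blast
  qed
  then obtain R where R: "\<And>w. w \<in> V \<Longrightarrow> (R w, w - R w) \<in> A" by metis
  have RV [simp]: "R w \<in> V" if "w \<in> V" for w using R[OF that] A_mem by blast
  have Rsym: "ip (R x) y = ip x (R y)" if "x \<in> V" "y \<in> V" for x y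
    using A_sym[OF R R, of x y] that by (simp add: form_simps)
  obtain K0 where K0: "\<And>f g. (f, g) \<in> A \<Longrightarrow> seminorm f \<le> K0 * seminorm (g - (- 1) *\<^sub>R f)"
    using neg_regular[of "-1"] by fastforce
  define K where "K = max K0 0"
  have Rbound: "seminorm (R x) \<le> K * seminorm x" if "x \<in> V" for x
  proof -
    have "seminorm (R x) \<le> K0 * seminorm x" using K0[OF R[OF that]] by simp
    also have "\<dots> \<le> K * seminorm x" using that seminorm_ge_0 by (intro mult_right_mono) (auto simp: K_def)
    finally show ?thesis .
  qed
  \<comment> \<open>On the pair \<open>(R x, x - R x)\<close> of the graph,
    \<open>g - (1 / \<rho> - 1) *\<^sub>R f\<close> is \<open>- (1 / \<rho>)\<close> times
    \<open>R x - \<rho> *\<^sub>R x\<close>. Hence a bound for \<open>A\<close> at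
    \<open>1 / \<rho> - 1\<close> is a lower bound for \<open>R - \<rho>\<close>.\<close>
  have lower: "\<exists>c>0. \<forall>x\<in>V. c * seminorm x \<le> seminorm (R x - \<rho> *\<^sub>R x)"
    if \<rho>: "\<rho> \<noteq> 0" and reg: "\<exists>C. \<forall>(f, g)\<in>A. seminorm f \<le> C * seminorm (g - (1 / \<rho> - 1) *\<^sub>R f)" for \<rho>
  proof -
    obtain C0 where C0: "\<And>f g. (f, g) \<in> A \<Longrightarrow> seminorm f \<le> C0 * seminorm (g - (1 / \<rho> - 1) *\<^sub>R f)"
      using reg by auto
    define C where "C = \<bar>1 / \<rho>\<bar> * (max C0 0 * \<bar>1 / \<rho>\<bar> + 1)"
    have C: "0 < C" using \<rho> unfolding C_def by (intro mult_pos_pos add_nonneg_pos) auto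
    have "seminorm x \<le> C * seminorm (R x - \<rho> *\<^sub>R x)" if x: "x \<in> V" for x
    proof -
      let ?d = "seminorm (R x - \<rho> *\<^sub>R x)"
      have d0: "0 \<le> ?d" using x by (simp add: seminorm_ge_0)
      have "x - R x - (1 / \<rho> - 1) *\<^sub>R R x = (- (1 / \<rho>)) *\<^sub>R (R x - \<rho> *\<^sub>R x)"
        using \<rho> by (simp add: algebra_simps)
      then have "seminorm (R x) \<le> C0 * (\<bar>1 / \<rho>\<bar> * ?d)"
        using C0[OF R[OF x]] x seminorm_scale[of "R x - \<rho> *\<^sub>R x" "- (1 / \<rho>)"] by simp
      also have "\<dots> \<le> max C0 0 * (\<bar>1 / \<rho>\<bar> * ?d)" using d0 by (intro mult_right_mono) auto
      finally have 1: "seminorm (R x) \<le> max C0 0 * (\<bar>1 / \<rho>\<bar> * ?d)" .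
      have "\<bar>\<rho>\<bar> * seminorm x \<le> seminorm (R x) + ?d"
        using seminorm_le_add_diff[of "\<rho> *\<^sub>R x" "R x"] x seminorm_minus_commute[of "R x" "\<rho> *\<^sub>R x"]
        by (simp add: seminorm_scale)
      with 1 have "\<bar>\<rho>\<bar> * seminorm x \<le> (max C0 0 * \<bar>1 / \<rho>\<bar> + 1) * ?d" by (simp add: algebra_simps)
      then have "\<bar>1 / \<rho>\<bar> * (\<bar>\<rho>\<bar> * seminorm x) \<le> \<bar>1 / \<rho>\<bar> * ((max C0 0 * \<bar>1 / \<rho>\<bar> + 1) * ?d)"
        by (intro mult_left_mono) auto
      then show ?thesis using \<rho> by (simp add: C_def mult.assoc abs_mult)
    qed
    then have "\<forall>x\<in>V. (1 / C) * seminorm x \<le> seminorm (R x - \<rho> *\<^sub>R x)"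
      using C by (simp add: field_simps)
    moreover have "0 < 1 / C" using C by simp
    ultimately show ?thesis by blast
  qed
  have lower_neg: "\<exists>c>0. \<forall>x\<in>V. c * seminorm x \<le> seminorm (R x - (- \<sigma>) *\<^sub>R x)" if "0 < \<sigma>" for \<sigma>
  proof (rule lower)
    have "0 < 1 / \<sigma>" using that by simp
    moreover have "1 / (- \<sigma>) = - (1 / \<sigma>)" by simp
    ultimately have "1 / (- \<sigma>) - 1 < 0" by linarith
    then show "\<exists>C. \<forall>(f, g)\<in>A. seminorm f \<le> C * seminorm (g - (1 / (- \<sigma>) - 1) *\<^sub>R f)"
      using neg_regular by blast
  qed (use that in simp)
  \<comment> \<open>\<open>eigenvector_exists\<close> wants a positive operator. Only eigenvalues
    are known to be nonnegative, so positivity of \<open>R\<close> is not at hand; the square of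
    \<open>R\<close> is positive by symmetry. Up to null vectors its shift by
    \<open>\<sigma> * \<sigma>\<close> factors into \<open>R + \<sigma>\<close>, bounded below by
    \<open>lower_neg\<close>, and \<open>R - \<sigma>\<close>.\<close>
  have R2: "R (R x) - (\<sigma> * \<sigma>) *\<^sub>R x = (R (R x - \<sigma> *\<^sub>R x) - (- \<sigma>) *\<^sub>R (R x - \<sigma> *\<^sub>R x)) +
      (R (R x) - \<sigma> *\<^sub>R R x - R (R x - \<sigma> *\<^sub>R x))" for \<sigma> x
    by (simp add: algebra_simps)
  have R2_sn: "seminorm (R (R x) - (\<sigma> * \<sigma>) *\<^sub>R x) = seminorm (R (R x - \<sigma> *\<^sub>R x) - (- \<sigma>) *\<^sub>R (R x - \<sigma> *\<^sub>R x))"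
    if x: "x \<in> V" for \<sigma> x
  proof -
    let ?a = "R (R x - \<sigma> *\<^sub>R x) - (- \<sigma>) *\<^sub>R (R x - \<sigma> *\<^sub>R x)"
    let ?n = "R (R x) - \<sigma> *\<^sub>R R x - R (R x - \<sigma> *\<^sub>R x)"
    have aV: "?a \<in> V" and nV: "?n \<in> V" using x by simp_all
    have "ip ?n v = 0" if "v \<in> V" for v
      using x that by (simp add: form_simps Rsym)
    then have n0: "seminorm ?n = 0" using nV by (simp add: seminorm_def)
    show ?thesis
      using seminorm_cong[OF mem_simps(2)[OF aV nV] aV] n0 unfolding R2 add_diff_cancel_left' by blast
  qed
  have gap: "\<exists>\<epsilon>>0. \<forall>\<rho>'. \<rho> - \<epsilon> < \<rho>' \<and> \<rho>' < \<rho> \<longrightarrow>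
        (\<exists>c>0. \<forall>x\<in>V. c * seminorm x \<le> seminorm (R (R x) - \<rho>' *\<^sub>R x))" if \<rho>: "0 < \<rho>" for \<rho>
  proof -
    define \<mu> where "\<mu> \<rho> = 1 / sqrt \<rho> - 1" for \<rho>
    have "(\<exists>\<epsilon>>0. \<forall>\<mu>'. \<mu>' \<noteq> \<mu> \<rho> \<and> \<bar>\<mu>' - \<mu> \<rho>\<bar> < \<epsilon> \<longrightarrow>
          (\<exists>C. \<forall>(f, g)\<in>A. seminorm f \<le> C * seminorm (g - \<mu>' *\<^sub>R f)))"
    proof -
      \<comment> \<open>A bound with constant \<open>C\<close> at one point survives with constant
        \<open>2 * C\<close> within distance \<open>1 / (2 * C)\<close>. So in either alternative of
        \<open>discrete\<close> there is a bound at all nearby points other than the centre.\<close>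
      have "\<exists>\<epsilon>>0. \<forall>\<mu>'. \<bar>\<mu>' - \<mu> \<rho>\<bar> < \<epsilon> \<longrightarrow>
          (\<exists>C. \<forall>(f, g)\<in>A. seminorm f \<le> C * seminorm (g - \<mu>' *\<^sub>R f))"
        if "\<exists>C. \<forall>(f, g)\<in>A. seminorm f \<le> C * seminorm (g - \<mu> \<rho> *\<^sub>R f)"
      proof -
        obtain C0 where C0: "\<And>f g. (f, g) \<in> A \<Longrightarrow> seminorm f \<le> C0 * seminorm (g - \<mu> \<rho> *\<^sub>R f)"
          using \<open>\<exists>C. _\<close> by auto
        define C where "C = max C0 1"
        have C: "0 < C" "C0 \<le> C" by (auto simp: C_def)
        have "seminorm f \<le> 2 * C * seminorm (g - \<mu>' *\<^sub>R f)"
          if "\<bar>\<mu>' - \<mu> \<rho>\<bar> < 1 / (2 * C)" and fg: "(f, g) \<in> A" for \<mu>' f g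
        proof -
          note m = A_mem[OF fg]
          have "seminorm f \<le> C0 * seminorm (g - \<mu> \<rho> *\<^sub>R f)" by (rule C0[OF fg])
          also have "\<dots> \<le> C * seminorm (g - \<mu> \<rho> *\<^sub>R f)" using C m by (intro mult_right_mono seminorm_ge_0) auto
          also have "\<dots> \<le> C * (seminorm (g - \<mu>' *\<^sub>R f) + \<bar>\<mu>' - \<mu> \<rho>\<bar> * seminorm f)"
          proof (rule mult_left_mono)
            have "g - \<mu> \<rho> *\<^sub>R f - (g - \<mu>' *\<^sub>R f) = (\<mu>' - \<mu> \<rho>) *\<^sub>R f" by (simp add: algebra_simps)
            then show "seminorm (g - \<mu> \<rho> *\<^sub>R f) \<le> seminorm (g - \<mu>' *\<^sub>R f) + \<bar>\<mu>' - \<mu> \<rho>\<bar> * seminorm f"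
              using seminorm_le_add_diff[of "g - \<mu> \<rho> *\<^sub>R f" "g - \<mu>' *\<^sub>R f"] m
                seminorm_scale[of f "\<mu>' - \<mu> \<rho>"] by simp
          qed (use C in simp)
          also have "\<dots> \<le> C * (seminorm (g - \<mu>' *\<^sub>R f) + 1 / (2 * C) * seminorm f)"
            using that(1) C m by (intro mult_left_mono add_left_mono mult_right_mono seminorm_ge_0) auto
          also have "\<dots> = C * seminorm (g - \<mu>' *\<^sub>R f) + seminorm f / 2" using C by (simp add: algebra_simps)
          finally show ?thesis by simp
        qed
        then show ?thesis using C by (intro exI[of _ "1 / (2 * C)"]) auto
      qed
      then show ?thesis using discrete[of "\<mu> \<rho>"] by blast
    qed
    then obtain \<epsilon> where \<epsilon>: "0 < \<epsilon>" and regs: "\<forall>\<mu>'. \<mu>' \<noteq> \<mu> \<rho> \<and> \<bar>\<mu>' - \<mu> \<rho>\<bar> < \<epsilon> \<longrightarrow>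
          (\<exists>C. \<forall>(f, g)\<in>A. seminorm f \<le> C * seminorm (g - \<mu>' *\<^sub>R f))" by blast
    have "isCont \<mu> \<rho>" unfolding \<mu>_def using \<rho> by (intro continuous_intros) auto
    then obtain d where d: "0 < d" "\<And>\<rho>'. \<bar>\<rho>' - \<rho>\<bar> < d \<Longrightarrow> \<bar>\<mu> \<rho>' - \<mu> \<rho>\<bar> < \<epsilon>"
      using \<epsilon> unfolding continuous_at_eps_delta dist_real_def by auto
    have "\<exists>c>0. \<forall>x\<in>V. c * seminorm x \<le> seminorm (R (R x) - \<rho>' *\<^sub>R x)"
      if \<rho>': "\<rho> - min d \<rho> < \<rho>'" "\<rho>' < \<rho>" for \<rho>'
    proof -
      have p: "0 < \<rho>'" "\<bar>\<rho>' - \<rho>\<bar> < d" using \<rho>' by auto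
      let ?s = "sqrt \<rho>'"
      have "?s < sqrt \<rho>" "0 < ?s" using \<rho>' p by auto
      then have "\<mu> \<rho>' \<noteq> \<mu> \<rho>" using \<rho> by (simp add: \<mu>_def)
      then have "\<exists>C. \<forall>(f, g)\<in>A. seminorm f \<le> C * seminorm (g - (1 / ?s - 1) *\<^sub>R f)"
        using regs[rule_format, of "\<mu> \<rho>'"] d(2)[OF p(2)] by (simp add: \<mu>_def)
      then obtain c1 where c1: "0 < c1" "\<And>x. x \<in> V \<Longrightarrow> c1 * seminorm x \<le> seminorm (R x - ?s *\<^sub>R x)"
        using lower[of ?s] p by auto
      obtain c2 where c2: "0 < c2" "\<And>x. x \<in> V \<Longrightarrow> c2 * seminorm x \<le> seminorm (R x - (- ?s) *\<^sub>R x)"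
        using lower_neg[of ?s] p by auto
      have "(c2 * c1) * seminorm x \<le> seminorm (R (R x) - \<rho>' *\<^sub>R x)" if x: "x \<in> V" for x
      proof -
        have "c2 * (c1 * seminorm x) \<le> c2 * seminorm (R x - ?s *\<^sub>R x)" using c1(2)[OF x] c2(1) by simp
        also have "\<dots> \<le> seminorm (R (R x) - (?s * ?s) *\<^sub>R x)" unfolding R2_sn[OF x] using x by (intro c2) simp
        finally show ?thesis using p by (simp add: mult.assoc)
      qed
      then show ?thesis using mult_pos_pos[OF c2(1) c1(1)] by blast
    qed
    then show ?thesis using d(1) \<rho> by (intro exI[of _ "min d \<rho>"]) auto
  qed
  \<comment> \<open>A closed \<open>R\<close>-invariant subspace in which an eigenvector of
    \<open>R\<close> with positive eigenvalue would be an eigenvector of \<open>A\<close> orthogonal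
    to itself.\<close>
  define W where "W = {w \<in> V. \<forall>\<mu> f. (f, \<mu> *\<^sub>R f) \<in> A \<longrightarrow> ip w f = 0}"
  have WV: "W \<subseteq> V" by (auto simp: W_def)
  have subW: "subspace W"
  proof -
    have "ip (x + y) f = ip x f + ip y f" "ip (c *\<^sub>R x) f = c * ip x f"
      if "x \<in> V" "y \<in> V" "(f, \<mu> *\<^sub>R f) \<in> A" for x y f \<mu> c
      using that A_mem(1)[OF that(3)] by (simp_all add: form_simps)
    moreover have "ip 0 f = 0" if "(f, \<mu> *\<^sub>R f) \<in> A" for f \<mu>
      using A_mem(1)[OF that] by (rule form_zero)
    ultimately show ?thesis unfolding W_def subspace_def by auto
  qed
  have closedW: "x \<in> W" if s: "\<And>n. s n \<in> W" and x: "x \<in> V" and lim: "(\<lambda>n. seminorm (s n - x)) \<longlonglongrightarrow> 0" for s x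
  proof -
    have "ip x f = 0" if f: "(f, \<mu> *\<^sub>R f) \<in> A" for \<mu> f
    proof -
      have sV: "s n \<in> V" for n using s WV by auto
      have "\<bar>ip x f\<bar> \<le> seminorm (s n - x) * seminorm f" for n
      proof -
        have "ip (s n) f = 0" using s f by (auto simp: W_def)
        then show ?thesis using abs_form_le[of "s n - x" f] sV x A_mem[OF f] by (simp add: form_simps)
      qed
      moreover have "(\<lambda>n. seminorm (s n - x) * seminorm f) \<longlonglongrightarrow> 0"
        using lim by (rule tendsto_mult_left_zero)
      ultimately have "\<bar>ip x f\<bar> \<le> 0" by (intro tendsto_lowerbound) auto
      then show ?thesis by simp
    qed
    then show ?thesis using x by (auto simp: W_def)
  qed
  have RW: "R x \<in> W" if x: "x \<in> W" for x
  proof -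
    have xV: "x \<in> V" using x WV by auto
    have "ip (R x) f = 0" if f: "(f, \<mu> *\<^sub>R f) \<in> A" for \<mu> f
    proof (cases "seminorm f = 0")
      case True
      then show ?thesis
        using form_null[of f "R x"] form_sym[of f "R x"] A_mem[OF f] xV by (simp add: seminorm_def)
    next
      case False
      then have "0 \<le> \<mu>" using eigenvalue_nonneg f by blast
      have "\<mu> * ip (R x) f = ip x f - ip (R x) f"
        using A_sym[OF R[OF xV] f] A_mem[OF f] xV by (simp add: form_simps)
      moreover have "ip x f = 0" using x f by (auto simp: W_def)
      ultimately have "(\<mu> + 1) * ip (R x) f = 0" by (simp add: algebra_simps)
      then show ?thesis using \<open>0 \<le> \<mu>\<close> by simp
    qed
    then show ?thesis using xV by (auto simp: W_def)
  qed
  have wW: "w \<in> W" unfolding W_def using w orth by blast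
  have "ip (R w) (R w) = 0"
  proof (rule ccontr)
    assume ne: "ip (R w) (R w) \<noteq> 0"
    have ne2: "ip (R (R w)) (R (R w)) \<noteq> 0"
    proof
      assume "ip (R (R w)) (R (R w)) = 0"
      then have "ip (R (R w)) w = 0" using w form_null[of "R (R w)" w] by simp
      then show False using ne Rsym[OF RV[OF w] w] by simp
    qed
    obtain \<rho> y where y: "0 < \<rho>" "y \<in> W" "ip y y \<noteq> 0" "seminorm (R (R y) - \<rho> *\<^sub>R y) = 0"
    proof (rule eigenvector_exists[OF subW WV, of "\<lambda>x. R (R x)" "K * K" w])
      show "ip (R (R x)) y = ip x (R (R y))" if "x \<in> W" "y \<in> W" for x y
      proof -
        have "x \<in> V" "y \<in> V" using that WV by auto
        then show ?thesis using Rsym[of "R x" y] Rsym[of x "R y"] by simp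
      qed
      show "0 \<le> ip (R (R x)) x" if "x \<in> W" for x
      proof -
        have "x \<in> V" using that WV by auto
        then show ?thesis using Rsym[of "R x" x] form_nonneg[of "R x"] by simp
      qed
      show "seminorm (R (R x)) \<le> K * K * seminorm x" if "x \<in> W" for x
      proof -
        have xV: "x \<in> V" using that WV by auto
        have "seminorm (R (R x)) \<le> K * seminorm (R x)" using xV by (intro Rbound) simp
        also have "\<dots> \<le> K * (K * seminorm x)" using Rbound[OF xV] by (intro mult_left_mono) (auto simp: K_def)
        finally show ?thesis by simp
      qed
      show "\<exists>\<epsilon>>0. \<forall>\<rho>'. \<rho> - \<epsilon> < \<rho>' \<and> \<rho>' < \<rho> \<longrightarrow>
        (\<exists>c>0. \<forall>x\<in>W. c * seminorm x \<le> seminorm (R (R x) - \<rho>' *\<^sub>R x))" if pos: "0 < \<rho>" for \<rho>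
      proof -
        obtain \<epsilon> where \<epsilon>: "0 < \<epsilon>" and g: "\<And>\<rho>'. \<rho> - \<epsilon> < \<rho>' \<Longrightarrow> \<rho>' < \<rho> \<Longrightarrow>
            \<exists>c>0. \<forall>x\<in>V. c * seminorm x \<le> seminorm (R (R x) - \<rho>' *\<^sub>R x)"
          using gap[OF pos] by metis
        have "\<exists>c>0. \<forall>x\<in>W. c * seminorm x \<le> seminorm (R (R x) - \<rho>' *\<^sub>R x)"
          if "\<rho> - \<epsilon> < \<rho>'" "\<rho>' < \<rho>" for \<rho>'
          using g[OF that] WV by auto
        then show ?thesis using \<epsilon> by (intro exI[of _ \<epsilon>]) auto
      qed
      show "x \<in> W" if "\<And>n. s n \<in> W" "x \<in> V" "(\<lambda>n. seminorm (s n - x)) \<longlonglongrightarrow> 0" for s x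
        using that by (rule closedW)
    qed (use RW wW ne2 in auto)
    have yV: "y \<in> V" using y WV by auto
    define \<sigma> where "\<sigma> = sqrt \<rho>"
    have \<sigma>: "0 < \<sigma>" "\<sigma> * \<sigma> = \<rho>" using y(1) by (auto simp: \<sigma>_def)
    obtain c where c: "0 < c" "\<And>x. x \<in> V \<Longrightarrow> c * seminorm x \<le> seminorm (R x - (- \<sigma>) *\<^sub>R x)"
      using lower_neg[OF \<sigma>(1)] by auto
    \<comment> \<open>The factor \<open>R + \<sigma>\<close> is bounded below and can be cancelled,
      so \<open>y\<close> is an eigenvector of \<open>R\<close> and not only of its square.\<close>
    have "c * seminorm (R y - \<sigma> *\<^sub>R y) \<le> 0"
      using c(2)[of "R y - \<sigma> *\<^sub>R y"] R2_sn[OF yV, of \<sigma>] y(4) yV \<sigma>(2) by simp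
    then have z0: "seminorm (R y - \<sigma> *\<^sub>R y) = 0"
      using c(1) seminorm_ge_0[of "R y - \<sigma> *\<^sub>R y"] yV by (simp add: mult_le_0_iff)
    have "y - R y - (y - \<sigma> *\<^sub>R y) = \<sigma> *\<^sub>R y - R y" by simp
    then have "(\<sigma> *\<^sub>R y, y - \<sigma> *\<^sub>R y) \<in> A"
      using z0 yV seminorm_minus_commute[of "R y" "\<sigma> *\<^sub>R y"] by (intro A_cong[OF R[OF yV]]) simp_all
    then have "((1 / \<sigma>) *\<^sub>R \<sigma> *\<^sub>R y, (1 / \<sigma>) *\<^sub>R (y - \<sigma> *\<^sub>R y)) \<in> A" by (rule A_scale)
    moreover have "(1 / \<sigma>) *\<^sub>R \<sigma> *\<^sub>R y = y" "(1 / \<sigma>) *\<^sub>R (y - \<sigma> *\<^sub>R y) = (1 / \<sigma> - 1) *\<^sub>R y"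
      using \<sigma> by (simp_all add: algebra_simps)
    ultimately have "(y, (1 / \<sigma> - 1) *\<^sub>R y) \<in> A" by simp
    then have "ip y y = 0" using y(2) by (auto simp: W_def)
    with y(3) show False by simp
  qed
  then have R0: "seminorm (R w) = 0" by (simp add: seminorm_def)
  then have "seminorm (w - R w) = 0" using A_null[OF R[OF w]] by simp
  then have "seminorm w = 0"
    using seminorm_le_add_diff[of w "R w"] w R0 seminorm_ge_0[of w] by simp
  then show ?thesis using w by (simp add: seminorm_eq_0)
qed

definition eigenvectors :: "'v set" where
  "eigenvectors = {f. \<exists>\<mu>. (f, \<mu> *\<^sub>R f) \<in> A}"

lemma eigenspan_subset: "span eigenvectors \<subseteq> V"
  by (rule span_minimal) (use subsp in \<open>auto simp: eigenvectors_def dest: A_mem\<close>)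

lemma eigenspan_dense:
  assumes "f \<in> V"
  obtains s where "\<And>n. s n \<in> span eigenvectors" "(\<lambda>n. seminorm (f - s n)) \<longlonglongrightarrow> 0"
proof -
  have "ip w w = 0" if "w \<in> V" "\<And>e. e \<in> span eigenvectors \<Longrightarrow> ip w e = 0" for w
  proof (rule eigenvectors_total[OF that(1)])
    fix \<mu> f assume "(f, \<mu> *\<^sub>R f) \<in> A"
    then have "f \<in> span eigenvectors" by (intro span_base) (auto simp: eigenvectors_def)
    then show "ip w f = 0" by (rule that(2))
  qed
  then show ?thesis by (rule projection_dense[OF subspace_span eigenspan_subset assms _ that])
qed

text \<open>Eigenvectors for one eigenvalue form a subspace, so a linear combination can be
  collected by eigenvalue, and with one summand per \<open>\<mu>\<close> the sum becomes orthogonal.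
  The zero vector allows \<open>F\<close> to be total.\<close>

lemma eigenspan_cases:
  assumes "x \<in> span eigenvectors"
  obtains S F where "finite S" "\<And>\<mu>. (F \<mu>, \<mu> *\<^sub>R F \<mu>) \<in> A" "x = (\<Sum>\<mu>\<in>S. F \<mu>)"
proof -
  have "ip 0 b = ip 0 a" if "(a, b) \<in> A" for a b using A_mem[OF that] by (simp add: form_zero)
  then have zero: "(0, \<mu> *\<^sub>R 0) \<in> A" for \<mu> by (subst adjoint) auto
  have "\<exists>S F. finite S \<and> (\<forall>\<mu>. (F \<mu>, \<mu> *\<^sub>R F \<mu>) \<in> A) \<and> x = (\<Sum>\<mu>\<in>S. F \<mu>)"
    using assms
  proof (induction rule: span_induct_alt)
    case base
    then show ?case using zero by (intro exI[of _ "{}"] exI[of _ "\<lambda>_. 0"]) auto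
  next
    case (step a f y)
    obtain \<mu> where \<mu>: "(f, \<mu> *\<^sub>R f) \<in> A" using step(1) by (auto simp: eigenvectors_def)
    obtain S F where S: "finite S" and F: "\<And>\<mu>. (F \<mu>, \<mu> *\<^sub>R F \<mu>) \<in> A" and y: "y = (\<Sum>\<mu>\<in>S. F \<mu>)"
      using step(2) by blast
    define G where "G = (\<lambda>\<nu>. if \<nu> \<in> S then F \<nu> else 0)"
    have G: "(G \<nu>, \<nu> *\<^sub>R G \<nu>) \<in> A" for \<nu> using F zero by (auto simp: G_def)
    define H where "H = (\<lambda>\<nu>. G \<nu> + (if \<nu> = \<mu> then a *\<^sub>R f else 0))"
    have "(H \<nu>, \<nu> *\<^sub>R H \<nu>) \<in> A" for \<nu>
      using A_add[OF G A_scale[OF \<mu>, of a], of \<nu>] G[of \<nu>]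
      by (cases "\<nu> = \<mu>") (auto simp: H_def algebra_simps)
    moreover have "a *\<^sub>R f + y = (\<Sum>\<nu>\<in>insert \<mu> S. H \<nu>)"
    proof -
      have "(\<Sum>\<nu>\<in>insert \<mu> S. G \<nu>) = (\<Sum>\<nu>\<in>S. G \<nu>)"
        using S by (intro sum.mono_neutral_right) (auto simp: G_def)
      also have "\<dots> = y" unfolding y by (intro sum.cong) (auto simp: G_def)
      finally show ?thesis using S by (simp add: H_def sum.distrib sum.delta)
    qed
    ultimately show ?case using S by (intro exI[of _ "insert \<mu> S"] exI[of _ H]) auto
  qed
  then show ?thesis using that by blast
qed

text \<open>The functional is continuous and vanishes on a dense span. Applied in one variable at a
  time, it extends bilinear identities from eigenvectors to \<open>V\<close>.\<close>

lemma functional_eq_0: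
  assumes add: "\<And>x y. x \<in> V \<Longrightarrow> y \<in> V \<Longrightarrow> F (x + y) = F x + (F y :: real)"
    and scale: "\<And>a x. x \<in> V \<Longrightarrow> F (a *\<^sub>R x) = a * F x"
    and bound: "\<And>x. x \<in> V \<Longrightarrow> \<bar>F x\<bar> \<le> K * seminorm x"
    and zero: "\<And>f \<mu>. (f, \<mu> *\<^sub>R f) \<in> A \<Longrightarrow> F f = 0"
    and x: "x \<in> V"
  shows "F x = 0"
proof -
  obtain s where s: "\<And>n. s n \<in> span eigenvectors" "(\<lambda>n. seminorm (x - s n)) \<longlonglongrightarrow> 0"
    using eigenspan_dense[OF x] by blast
  have F0: "e \<in> V \<and> F e = 0" if "e \<in> span eigenvectors" for e
    using that
  proof (induction rule: span_induct_alt)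
    case base
    then show ?case using scale[of 0 0] by simp
  next
    case (step c x y)
    then show ?case using add[of "c *\<^sub>R x" y] scale[of x c] zero A_mem by (auto simp: eigenvectors_def)
  qed
  have "\<bar>F x\<bar> \<le> K * seminorm (x - s n)" for n
    using add[of "x - s n" "s n"] F0[OF s(1)[of n]] bound[of "x - s n"] x by simp
  moreover have "(\<lambda>n. K * seminorm (x - s n)) \<longlonglongrightarrow> 0" using s(2) by (rule tendsto_mult_right_zero)
  ultimately have "\<bar>F x\<bar> \<le> 0" by (intro tendsto_lowerbound) auto
  then show ?thesis by simp
qed

end

section \<open>Contractions diagonal in the eigenvectors\<close>

context psd_form
begin

lemma form_sum: "finite S \<Longrightarrow> (\<And>i. i \<in> S \<Longrightarrow> F i \<in> W) \<Longrightarrow> z \<in> W \<Longrightarrow> B (sum F S) z = (\<Sum>i\<in>S. B (F i) z)"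
proof (induction S rule: finite_induct)
  case empty
  then show ?case by (simp add: form_zero)
next
  case (insert i S)
  have "sum F S \<in> W" using insert by (intro subspace_sum[OF subsp]) auto
  then show ?case using insert by (simp add: form_add)
qed

lemma form_tendsto:
  assumes s: "\<And>n. s n \<in> W" "x \<in> W" "(\<lambda>n. seminorm (s n - x)) \<longlonglongrightarrow> 0"
    and t: "\<And>n. t n \<in> W" "y \<in> W" "(\<lambda>n. seminorm (t n - y)) \<longlonglongrightarrow> 0"
  shows "(\<lambda>n. B (s n) (t n)) \<longlonglongrightarrow> B x y"
proof (rule LIM_zero_cancel, rule Lim_null_comparison)
  have "\<bar>B (s n) (t n) - B x y\<bar> \<le> seminorm (s n - x) * seminorm (t n) + seminorm x * seminorm (t n - y)" for n
  proof -
    have "B (s n) (t n) - B x y = B (s n - x) (t n) + B x (t n - y)"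
      using s(1)[of n] t(1)[of n] s(2) t(2) by (simp add: form_simps)
    then show ?thesis
      using abs_form_le[of "s n - x" "t n"] abs_form_le[of x "t n - y"] s(1)[of n] t(1)[of n] s(2) t(2)
      by (simp del: abs_le_iff)
  qed
  then show "\<forall>\<^sub>F n in sequentially. norm (B (s n) (t n) - B x y) \<le>
      seminorm (s n - x) * seminorm (t n) + seminorm x * seminorm (t n - y)" by simp
  show "(\<lambda>n. seminorm (s n - x) * seminorm (t n) + seminorm x * seminorm (t n - y)) \<longlonglongrightarrow> 0"
    using tendsto_add[OF tendsto_mult[OF s(3) seminorm_tendsto[OF t]] tendsto_mult_right_zero[OF t(3)]]
    by simp
qed

end

text \<open>Apart from contractivity and weak linearity, \<open>T\<close> is known on eigenvectors
  only; its symmetry is a consequence. Linearity is stated weakly because transition operators have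
  it only almost everywhere.\<close>

locale spectral_contraction = discrete_selfadjoint V ip A for V :: "'v::real_vector set" and ip A +
  fixes T :: "'v \<Rightarrow> 'v" and \<tau> :: "real \<Rightarrow> real"
  assumes T_mem [simp]: "x \<in> V \<Longrightarrow> T x \<in> V"
    and T_add: "x \<in> V \<Longrightarrow> y \<in> V \<Longrightarrow> z \<in> V \<Longrightarrow> ip (T (x + y)) z = ip (T x) z + ip (T y) z"
    and T_scale: "x \<in> V \<Longrightarrow> z \<in> V \<Longrightarrow> ip (T (a *\<^sub>R x)) z = a * ip (T x) z"
    and T_contraction: "x \<in> V \<Longrightarrow> seminorm (T x) \<le> seminorm x"
    and T_eigen: "(f, \<mu> *\<^sub>R f) \<in> A \<Longrightarrow> seminorm (T f - \<tau> \<mu> *\<^sub>R f) = 0"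
begin

lemma T_eigen_ip:
  assumes "(f, \<mu> *\<^sub>R f) \<in> A" "x \<in> V"
  shows "ip (T f) x = \<tau> \<mu> * ip f x"
proof -
  note m = A_mem(1)[OF assms(1)]
  have "ip (T f - \<tau> \<mu> *\<^sub>R f) x = 0"
    using T_eigen[OF assms(1)] m assms(2) form_null[of "T f - \<tau> \<mu> *\<^sub>R f" x] by (simp add: seminorm_def)
  then show ?thesis using m assms(2) by (simp add: form_simps)
qed

text \<open>The defect \<open>ip (T x) y - ip x (T y)\<close> is continuous in each variable and
  vanishes on pairs of eigenvectors: for equal eigenvalues both terms carry the same
  \<open>\<tau>\<close>, for different ones both are 0 by orthogonality.
  \<open>functional_eq_0\<close> extends this in \<open>x\<close> and then in
  \<open>y\<close>.\<close>

lemma T_sym: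
  assumes "x \<in> V" "y \<in> V"
  shows "ip (T x) y = ip x (T y)"
proof -
  have bound: "\<bar>ip (T x) y - ip x (T y)\<bar> \<le> (2 * seminorm y) * seminorm x" if "x \<in> V" "y \<in> V" for x y
  proof -
    have "\<bar>ip (T x) y\<bar> \<le> seminorm x * seminorm y"
      using abs_form_le[of "T x" y] mult_right_mono[OF T_contraction[of x] seminorm_ge_0[of y]] that by simp
    moreover have "\<bar>ip x (T y)\<bar> \<le> seminorm x * seminorm y"
      using abs_form_le[of x "T y"] mult_left_mono[OF T_contraction[of y] seminorm_ge_0[of x]] that by simp
    ultimately show ?thesis by (simp add: abs_if algebra_simps split: if_splits)
  qed
  have T_right: "ip z (T (x + y)) = ip z (T x) + ip z (T y)" "ip z (T (a *\<^sub>R x)) = a * ip z (T x)"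
    if "x \<in> V" "y \<in> V" "z \<in> V" for x y z a
    using that T_add[of x y z] T_scale[of x z a] form_sym[of z] by simp_all
  have eig: "ip (T x) g - ip x (T g) = 0" if x: "x \<in> V" and g: "(g, \<nu> *\<^sub>R g) \<in> A" for x g \<nu>
  proof (rule functional_eq_0[where F = "\<lambda>x. ip (T x) g - ip x (T g)"])
    note m = A_mem(1)[OF g]
    show "\<bar>ip (T x) g - ip x (T g)\<bar> \<le> (2 * seminorm g) * seminorm x" if "x \<in> V" for x
      using bound that m by blast
    show "ip (T f) g - ip f (T g) = 0" if f: "(f, \<mu> *\<^sub>R f) \<in> A" for f \<mu>
    proof -
      have "ip f (T g) = \<nu> * 0 + \<tau> \<nu> * ip f g"
        using T_eigen_ip[OF g, of f] A_mem(1)[OF f] m form_sym[of f] by simp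
      then show ?thesis
        using T_eigen_ip[OF f m] eigenvectors_orthogonal[OF f g] by (cases "\<mu> = \<nu>") auto
    qed
  qed (use A_mem(1)[OF g] x in \<open>auto simp: T_add T_scale form_simps algebra_simps\<close>)
  have "ip (T x) y - ip x (T y) = 0"
  proof (rule functional_eq_0[where F = "\<lambda>y. ip (T x) y - ip x (T y)"])
    show "\<bar>ip (T x) y - ip x (T y)\<bar> \<le> (2 * seminorm x) * seminorm y" if "y \<in> V" for y
      using bound[OF assms(1) that] by (simp add: ac_simps)
    show "ip (T x) f - ip x (T f) = 0" if "(f, \<mu> *\<^sub>R f) \<in> A" for f \<mu> using eig[OF assms(1) that] .
  qed (use assms in \<open>auto simp: T_right form_simps algebra_simps\<close>)
  then show ?thesis by simp
qed

(* The quadratic form q x = a |x|^2 + (1 - a) <x, e>^2 - <x, T x> is diagonal in the eigenvectors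
   with nonnegative entries, and Cauchy-Schwarz for q identifies its null vectors. *)
context
  fixes e :: 'v and a :: real
  assumes e: "(e, 0) \<in> A" "ip e e = 1"
    and kernel: "\<And>f. (f, 0) \<in> A \<Longrightarrow> seminorm (f - ip f e *\<^sub>R e) = 0"
    and \<tau>0: "\<tau> 0 = 1"
    and \<tau>_le: "\<And>f \<mu>. (f, \<mu> *\<^sub>R f) \<in> A \<Longrightarrow> seminorm f \<noteq> 0 \<Longrightarrow> \<mu> \<noteq> 0 \<Longrightarrow> \<tau> \<mu> \<le> a"
begin

lemma eV [simp]: "e \<in> V"
  using e A_mem by blast

lemma contraction_bound_span:
  assumes "x \<in> span eigenvectors"
  shows "ip x (T x) \<le> a * ip x x + (1 - a) * (ip x e)\<^sup>2"
proof -
  obtain S F where S: "finite S" and F: "\<And>\<mu>. (F \<mu>, \<mu> *\<^sub>R F \<mu>) \<in> A" and x: "x = (\<Sum>\<mu>\<in>S. F \<mu>)"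
    using eigenspan_cases[OF assms] by blast
  have FV [simp]: "F \<mu> \<in> V" for \<mu> using A_mem(1)[OF F] .
  have xV [simp]: "x \<in> V" using assms eigenspan_subset by auto
  have Fx: "ip (F \<mu>) x = ip (F \<mu>) (F \<mu>)" if "\<mu> \<in> S" for \<mu>
  proof -
    have "ip (F \<mu>) x = ip x (F \<mu>)" by (rule form_sym) auto
    also have "\<dots> = (\<Sum>\<nu>\<in>S. ip (F \<nu>) (F \<mu>))" unfolding x by (intro form_sum S) auto
    also have "\<dots> = (\<Sum>\<nu>\<in>S. if \<nu> = \<mu> then ip (F \<mu>) (F \<mu>) else 0)"
      by (intro sum.cong refl) (use eigenvectors_orthogonal[OF F F] in auto)
    also have "\<dots> = ip (F \<mu>) (F \<mu>)" using S that by simp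
    finally show ?thesis .
  qed
  have xx: "ip x x = (\<Sum>\<mu>\<in>S. ip (F \<mu>) (F \<mu>))"
  proof -
    have "ip x x = (\<Sum>\<mu>\<in>S. ip (F \<mu>) x)" by (subst x, intro form_sum S) auto
    then show ?thesis using Fx by simp
  qed
  have xTx: "ip x (T x) = (\<Sum>\<mu>\<in>S. \<tau> \<mu> * ip (F \<mu>) (F \<mu>))"
  proof -
    have "ip x (T x) = (\<Sum>\<mu>\<in>S. ip (F \<mu>) (T x))" by (subst x, intro form_sum S) auto
    also have "\<dots> = (\<Sum>\<mu>\<in>S. \<tau> \<mu> * ip (F \<mu>) (F \<mu>))"
      using Fx T_eigen_ip[OF F, of x] T_sym[OF FV xV] by (intro sum.cong) auto
    finally show ?thesis .
  qed
  have Fe: "ip (F \<mu>) e = 0" if "\<mu> \<noteq> 0" for \<mu>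
    using eigenvectors_orthogonal[OF F, of e 0 \<mu>] e that by simp
  have xe: "ip x e = (\<Sum>\<mu>\<in>S. if \<mu> = 0 then ip (F 0) e else 0)"
  proof -
    have "ip x e = (\<Sum>\<mu>\<in>S. ip (F \<mu>) e)" by (subst x, intro form_sum S) auto
    then show ?thesis using Fe by (simp cong: if_cong sum.cong add: if_distrib) (intro sum.cong; auto)
  qed
  have F0: "ip (F 0) (F 0) = (ip (F 0) e)\<^sup>2"
  proof -
    let ?c = "ip (F 0) e"
    have "seminorm (F 0 - ?c *\<^sub>R e) = 0" using kernel[of "F 0"] F[of 0] by simp
    then have "ip (F 0 - ?c *\<^sub>R e) (F 0) = 0" using form_null[of "F 0 - ?c *\<^sub>R e" "F 0"] by (simp add: seminorm_def)
    then show ?thesis using form_sym[of e "F 0"] by (simp add: form_simps power2_eq_square)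
  qed
  \<comment> \<open>The entry at \<open>\<mu> = 0\<close> vanishes identically, because
    \<open>\<tau> 0 = 1\<close> and \<open>F 0\<close> is a multiple of the unit vector
    \<open>e\<close> up to null vectors. All others are nonnegative by
    \<open>\<tau>_le\<close>.\<close>
  have "0 \<le> (\<Sum>\<mu>\<in>S. (a - \<tau> \<mu>) * ip (F \<mu>) (F \<mu>) + (if \<mu> = 0 then (1 - a) * (ip (F 0) e)\<^sup>2 else 0))"
  proof (rule sum_nonneg)
    fix \<mu>
    show "0 \<le> (a - \<tau> \<mu>) * ip (F \<mu>) (F \<mu>) + (if \<mu> = 0 then (1 - a) * (ip (F 0) e)\<^sup>2 else 0)"
    proof (cases "\<mu> = 0 \<or> seminorm (F \<mu>) = 0")
      case True
      then show ?thesis using F0 \<tau>0 seminorm_eq_0[OF FV] by (auto simp: algebra_simps)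
    next
      case False
      then show ?thesis using \<tau>_le[OF F[of \<mu>]] form_nonneg[OF FV] by simp
    qed
  qed
  also have "\<dots> = a * ip x x - ip x (T x) + (1 - a) * (ip x e)\<^sup>2"
  proof -
    have "(\<Sum>\<mu>\<in>S. if \<mu> = 0 then (1 - a) * (ip (F 0) e)\<^sup>2 else 0) = (1 - a) * (ip x e)\<^sup>2"
      unfolding xe using S by (simp add: sum.delta)
    then show ?thesis unfolding xx xTx by (simp add: sum.distrib sum_distrib_left sum_subtractf algebra_simps)
  qed
  finally show ?thesis by simp
qed

lemma contraction_bound:
  assumes x: "x \<in> V"
  shows "ip x (T x) \<le> a * ip x x + (1 - a) * (ip x e)\<^sup>2"
proof -
  obtain s where s: "\<And>n. s n \<in> span eigenvectors" "(\<lambda>n. seminorm (x - s n)) \<longlonglongrightarrow> 0"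
    using eigenspan_dense[OF x] by blast
  have sV [simp]: "s n \<in> V" for n using s(1)[of n] eigenspan_subset by auto
  have lim: "(\<lambda>n. seminorm (s n - x)) \<longlonglongrightarrow> 0" using s(2) x by (simp add: seminorm_minus_commute[of x])
  have Tlim: "(\<lambda>n. seminorm (T (s n) - T x)) \<longlonglongrightarrow> 0"
  proof (rule Lim_null_comparison[OF _ lim])
    have "seminorm (T (s n) - T x) \<le> seminorm (s n - x)" for n
    proof -
      have "ip (T (s n) - T x - T (s n - x)) v = 0" if "v \<in> V" for v
        using that x T_add[of "s n - x" x v] by (simp add: form_simps)
      then have "seminorm (T (s n) - T x - T (s n - x)) = 0" using x by (simp add: seminorm_def)
      then have "seminorm (T (s n) - T x) = seminorm (T (s n - x))" using x by (intro seminorm_cong) auto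
      then show ?thesis using T_contraction[of "s n - x"] x by simp
    qed
    then show "\<forall>\<^sub>F n in sequentially. norm (seminorm (T (s n) - T x)) \<le> seminorm (s n - x)"
      using x by (simp add: seminorm_ge_0)
  qed
  have const: "(\<lambda>n. seminorm (e - e)) \<longlonglongrightarrow> 0" by (simp add: seminorm_def form_zero)
  show ?thesis
  proof (rule LIMSEQ_le)
    show "(\<lambda>n. ip (s n) (T (s n))) \<longlonglongrightarrow> ip x (T x)"
      using x by (intro form_tendsto lim Tlim) auto
    show "(\<lambda>n. a * ip (s n) (s n) + (1 - a) * (ip (s n) e)\<^sup>2) \<longlonglongrightarrow> a * ip x x + (1 - a) * (ip x e)\<^sup>2"
      using x by (intro tendsto_intros form_tendsto lim const) auto
    show "\<exists>N. \<forall>n\<ge>N. ip (s n) (T (s n)) \<le> a * ip (s n) (s n) + (1 - a) * (ip (s n) e)\<^sup>2"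
      using contraction_bound_span[OF s(1)] by blast
  qed
qed

lemma contraction_equality:
  assumes x: "x \<in> V" and eq: "ip x (T x) = a * ip x x + (1 - a) * (ip x e)\<^sup>2"
    and f: "(f, \<mu> *\<^sub>R f) \<in> A" "\<mu> \<noteq> 0" "\<tau> \<mu> < a"
  shows "ip x f = 0"
proof -
  let ?Q = "\<lambda>x y. a * ip x y + (1 - a) * (ip x e * ip y e) - ip (T x) y"
  have "psd_form V ?Q"
  proof
    fix x y assume "x \<in> V" "y \<in> V"
    then show "?Q x y = ?Q y x" using T_sym[of x y] form_sym[of x y] form_sym[of x "T y"] by simp
  next
    fix x assume "x \<in> V"
    then show "0 \<le> ?Q x x" using contraction_bound[of x] T_sym[of x x] by (simp add: power2_eq_square)
  qed (use subsp in \<open>auto simp: form_simps T_add T_scale algebra_simps\<close>)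
  then interpret Q: psd_form V ?Q .
  have fV: "f \<in> V" using A_mem(1)[OF f(1)] .
  have "?Q x f = 0"
    using Q.form_null[OF x fV] eq T_sym[OF x x] by (simp add: power2_eq_square)
  moreover have "ip f e = 0" using eigenvectors_orthogonal[OF f(1), of e 0] e f(2) by simp
  moreover have "ip (T x) f = \<tau> \<mu> * ip x f"
    using T_eigen_ip[OF f(1) x] T_sym[OF x fV] form_sym[of x "T f"] form_sym[of x f] x fV by simp
  ultimately have "(a - \<tau> \<mu>) * ip x f = 0" by (simp add: algebra_simps)
  then show ?thesis using f(3) by simp
qed

end

end

section \<open>The space of square integrable functions\<close>

text \<open>With pointwise scaling all real functions form a vector space, and the abstract results
  apply to \<open>L2 P\<close> as a subspace of it, without classes modulo null sets.\<close>

instantiation "fun" :: (type, real_vector) real_vector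
begin

definition scaleR_fun :: "real \<Rightarrow> ('a \<Rightarrow> 'b) \<Rightarrow> 'a \<Rightarrow> 'b" where
  "scaleR_fun a f = (\<lambda>x. a *\<^sub>R f x)"

instance
  by standard (auto simp: scaleR_fun_def fun_eq_iff algebra_simps)

end

definition L2_inner :: "'a measure \<Rightarrow> ('a \<Rightarrow> real) \<Rightarrow> ('a \<Rightarrow> real) \<Rightarrow> real" where
  "L2_inner P f g = (\<integral>x. f x * g x \<partial>P)"

lemma L2_measurable: "f \<in> L2 P \<Longrightarrow> f \<in> borel_measurable P"
  by (simp add: L2_def)

lemma L2_square_integrable: "f \<in> L2 P \<Longrightarrow> integrable P (\<lambda>x. (f x)\<^sup>2)"
  by (simp add: L2_def)

lemma L2_mult_integrable:
  assumes "f \<in> L2 P" "g \<in> L2 P"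
  shows "integrable P (\<lambda>x. f x * g x)"
proof (rule Bochner_Integration.integrable_bound)
  show "integrable P (\<lambda>x. (f x)\<^sup>2 + (g x)\<^sup>2)" using assms by (auto simp: L2_def)
  show "(\<lambda>x. f x * g x) \<in> borel_measurable P" using assms by (auto simp: L2_def)
  have "\<bar>a * b\<bar> \<le> a\<^sup>2 + b\<^sup>2" for a b :: real
  proof -
    have "0 \<le> \<bar>a\<bar> * \<bar>b\<bar>" by simp
    then show ?thesis using sum_squares_bound[of "\<bar>a\<bar>" "\<bar>b\<bar>"] unfolding abs_mult power2_abs by linarith
  qed
  then show "AE x in P. norm (f x * g x) \<le> norm ((f x)\<^sup>2 + (g x)\<^sup>2)" by simp
qed

lemma L2_add:
  assumes "f \<in> L2 P" "g \<in> L2 P"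
  shows "(\<lambda>x. f x + g x) \<in> L2 P"
proof -
  have "integrable P (\<lambda>x. (f x)\<^sup>2 + (g x)\<^sup>2 + 2 * (f x * g x))"
    using assms L2_mult_integrable[OF assms] by (auto simp: L2_def)
  then show ?thesis using assms by (auto simp: L2_def power2_sum mult.assoc)
qed

lemma L2_cmult: "f \<in> L2 P \<Longrightarrow> (\<lambda>x. a * f x) \<in> L2 P"
  by (auto simp: L2_def power_mult_distrib)

lemma L2_diff: "f \<in> L2 P \<Longrightarrow> g \<in> L2 P \<Longrightarrow> (\<lambda>x. f x - g x) \<in> L2 P"
  using L2_add[of f P "\<lambda>x. (-1) * g x"] L2_cmult[of g P "-1"] by simp

lemma L2_subspace: "subspace (L2 P)"
  unfolding subspace_def
proof (intro conjI ballI allI)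
  show "0 \<in> L2 P" by (auto simp: L2_def zero_fun_def)
qed (auto simp: plus_fun_def scaleR_fun_def L2_add L2_cmult)

interpretation L2: psd_form "L2 P" "L2_inner P" for P
proof
  show "subspace (L2 P)" by (rule L2_subspace)
  show "L2_inner P x y = L2_inner P y x" for x y by (simp add: L2_inner_def mult.commute)
  show "L2_inner P (x + y) z = L2_inner P x z + L2_inner P y z"
    if "x \<in> L2 P" "y \<in> L2 P" "z \<in> L2 P" for x y z
    using L2_mult_integrable[OF that(1,3)] L2_mult_integrable[OF that(2,3)]
    by (simp add: L2_inner_def distrib_right)
  show "L2_inner P (a *\<^sub>R x) z = a * L2_inner P x z" for x z a
    by (simp add: L2_inner_def scaleR_fun_def mult.assoc)
  show "0 \<le> L2_inner P x x" for x by (simp add: L2_inner_def)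
qed

lemma seminorm_L2: "L2.seminorm P f = L2_norm P f"
  by (simp add: L2.seminorm_def L2_inner_def L2_norm_def power2_eq_square)

lemma L2_norm_eq_0: "f \<in> L2 P \<Longrightarrow> L2_norm P f = 0 \<longleftrightarrow> (AE x in P. f x = 0)"
  using integral_nonneg_eq_0_iff_AE[of P "\<lambda>x. (f x)\<^sup>2"] by (simp add: L2_norm_def L2_def)

lemma nn_integral_L2: "f \<in> L2 P \<Longrightarrow> (\<integral>\<^sup>+x. ennreal ((f x)\<^sup>2) \<partial>P) = ennreal ((L2_norm P f)\<^sup>2)"
  by (subst nn_integral_eq_integral) (auto simp: L2_def L2_norm_def)

lemma L2_const: "finite_measure P \<Longrightarrow> (\<lambda>x. c) \<in> L2 P"
  by (auto simp: L2_def intro: finite_measure.integrable_const)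

lemma L2_integrable:
  assumes "finite_measure P" "f \<in> L2 P"
  shows "integrable P f"
  using L2_mult_integrable[OF assms(2) L2_const[OF assms(1), of 1]] by simp

lemma (in prob_space) L1_le_L2:
  assumes "f \<in> L2 M"
  shows "(\<integral>x. \<bar>f x\<bar> \<partial>M) \<le> L2_norm M f"
proof -
  have abs: "(\<lambda>x. \<bar>f x\<bar>) \<in> L2 M" using assms by (auto simp: L2_def)
  have "\<bar>L2_inner M (\<lambda>x. \<bar>f x\<bar>) (\<lambda>x. 1)\<bar> \<le> L2_norm M (\<lambda>x. \<bar>f x\<bar>) * L2_norm M (\<lambda>x. 1)"
    using L2.abs_form_le[OF abs L2_const[OF finite_measure_axioms, of 1]] by (simp add: seminorm_L2)
  then show ?thesis by (simp add: L2_inner_def L2_norm_def prob_space)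
qed

text \<open>Riesz-Fischer. A fast subsequence has increments summable in L1, which L2 dominates on a
  probability space, so it converges almost everywhere; Fatou's lemma along it makes the pointwise
  limit an L2 limit of the whole sequence.\<close>

lemma (in prob_space) L2_complete:
  assumes s: "\<And>n. s n \<in> L2 M"
    and cauchy: "\<And>e. 0 < e \<Longrightarrow> \<exists>N. \<forall>m\<ge>N. \<forall>n\<ge>N. L2_norm M (\<lambda>x. s m x - s n x) < e"
  shows "\<exists>f\<in>L2 M. (\<lambda>n. L2_norm M (\<lambda>x. s n x - f x)) \<longlonglongrightarrow> 0"
proof -
  have "\<exists>N. \<forall>m\<ge>N. \<forall>n\<ge>N. L2_norm M (\<lambda>x. s m x - s n x) < (1/2) ^ k" for k
    by (rule cauchy) simp
  then obtain N where N: "\<And>k m n. m \<ge> N k \<Longrightarrow> n \<ge> N k \<Longrightarrow> L2_norm M (\<lambda>x. s m x - s n x) < (1/2) ^ k" by metis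
  \<comment> \<open>Nondecreasing, beyond \<open>N k\<close> for the fast Cauchy rate, and at least
    \<open>k\<close> so that it runs to infinity where Fatou's lemma is applied.\<close>
  define r where "r k = k + Max (N ` {..k})" for k
  have rN: "N k \<le> r k" for k
    unfolding r_def by (intro trans_le_add2 Max_ge) auto
  have rmono: "r k \<le> r (Suc k)" for k
    unfolding r_def by (intro add_mono Max_mono) auto
  define d where "d k x = s (r (Suc k)) x - s (r k) x" for k x
  have dL2: "d k \<in> L2 M" for k unfolding d_def by (intro L2_diff s)
  have d_int: "(\<integral>\<^sup>+x. ennreal \<bar>d k x\<bar> \<partial>M) \<le> ennreal ((1/2) ^ k)" for k
  proof -
    have "(\<integral>\<^sup>+x. ennreal \<bar>d k x\<bar> \<partial>M) = ennreal (\<integral>x. \<bar>d k x\<bar> \<partial>M)"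
      using L2_integrable[OF finite_measure_axioms dL2[of k]] by (intro nn_integral_eq_integral) auto
    also have "\<dots> \<le> ennreal ((1/2) ^ k)"
    proof (rule ennreal_leI)
      have "L2_norm M (d k) < (1/2) ^ k" unfolding d_def
        using rN[of k] rmono[of k] by (intro N) auto
      then show "(\<integral>x. \<bar>d k x\<bar> \<partial>M) \<le> (1/2) ^ k" using L1_le_L2[OF dL2[of k]] by simp
    qed
    finally show ?thesis .
  qed
  have "(\<integral>\<^sup>+x. (\<Sum>k. ennreal \<bar>d k x\<bar>) \<partial>M) = (\<Sum>k. \<integral>\<^sup>+x. ennreal \<bar>d k x\<bar> \<partial>M)"
    using L2_measurable[OF dL2] by (intro nn_integral_suminf) auto
  also have "\<dots> \<le> (\<Sum>k. ennreal ((1/2) ^ k))" by (intro suminf_le d_int) auto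
  also have "\<dots> = ennreal (\<Sum>k. (1/2) ^ k)" by (intro suminf_ennreal2 summable_geometric) auto
  also have "\<dots> < \<infinity>" by simp
  finally have "AE x in M. (\<Sum>k. ennreal \<bar>d k x\<bar>) \<noteq> \<infinity>"
    using L2_measurable[OF dL2] by (intro nn_integral_PInf_AE) auto
  then have conv: "AE x in M. convergent (\<lambda>k. s (r k) x)"
  proof eventually_elim
    case (elim x)
    then have "summable (\<lambda>k. \<bar>d k x\<bar>)" by (intro summable_suminf_not_top) auto
    then have "summable (\<lambda>k. d k x)" by (rule summable_rabs_cancel)
    then have "convergent (\<lambda>n. \<Sum>k<n. d k x)" by (simp add: summable_iff_convergent)
    moreover have "(\<Sum>k<n. d k x) = s (r n) x - s (r 0) x" for n
      unfolding d_def by (induction n) auto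
    ultimately have "convergent (\<lambda>n. s (r n) x - s (r 0) x)" by simp
    then show ?case using convergent_add[OF _ convergent_const[of "s (r 0) x"]] by fastforce
  qed
  define f where "f x = lim (\<lambda>k. s (r k) x)" for x
  have fm: "f \<in> borel_measurable M" unfolding f_def
    using L2_measurable[OF s] by (intro borel_measurable_lim_metric) auto
  have lim: "AE x in M. (\<lambda>k. s (r k) x) \<longlonglongrightarrow> f x"
    using conv by eventually_elim (simp add: f_def convergent_LIMSEQ_iff)
  have fatou: "(\<integral>\<^sup>+x. ennreal ((s n x - f x)\<^sup>2) \<partial>M) \<le> ennreal (e\<^sup>2)"
    if n: "\<And>m. m \<ge> N' \<Longrightarrow> L2_norm M (\<lambda>x. s n x - s m x) < e" for n e N'
  proof -
    have "(\<integral>\<^sup>+x. ennreal ((s n x - f x)\<^sup>2) \<partial>M) = (\<integral>\<^sup>+x. liminf (\<lambda>k. ennreal ((s n x - s (r k) x)\<^sup>2)) \<partial>M)"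
    proof (rule nn_integral_cong_AE)
      show "AE x in M. ennreal ((s n x - f x)\<^sup>2) = liminf (\<lambda>k. ennreal ((s n x - s (r k) x)\<^sup>2))"
        using lim
      proof eventually_elim
        case (elim x)
        have "(\<lambda>k. ennreal ((s n x - s (r k) x)\<^sup>2)) \<longlonglongrightarrow> ennreal ((s n x - f x)\<^sup>2)"
          by (intro tendsto_intros elim tendsto_ennrealI)
        then show ?case by (rule lim_imp_Liminf[OF trivial_limit_sequentially, symmetric])
      qed
    qed
    also have "\<dots> \<le> liminf (\<lambda>k. \<integral>\<^sup>+x. ennreal ((s n x - s (r k) x)\<^sup>2) \<partial>M)"
      using L2_measurable[OF s] by (intro nn_integral_liminf) auto
    also have "\<dots> \<le> limsup (\<lambda>k. \<integral>\<^sup>+x. ennreal ((s n x - s (r k) x)\<^sup>2) \<partial>M)"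
      by (intro Liminf_le_Limsup) simp
    also have "\<dots> \<le> ennreal (e\<^sup>2)"
    proof (rule Limsup_bounded)
      show "\<forall>\<^sub>F k in sequentially. (\<integral>\<^sup>+x. ennreal ((s n x - s (r k) x)\<^sup>2) \<partial>M) \<le> ennreal (e\<^sup>2)"
        unfolding eventually_sequentially
      proof (intro exI allI impI)
        fix k assume "N' \<le> k"
        then have "L2_norm M (\<lambda>x. s n x - s (r k) x) < e" by (intro n) (simp add: r_def)
        moreover have "0 \<le> L2_norm M (\<lambda>x. s n x - s (r k) x)" by (simp add: L2_norm_def)
        ultimately have "(L2_norm M (\<lambda>x. s n x - s (r k) x))\<^sup>2 \<le> e\<^sup>2" by (intro power_mono) auto
        then show "(\<integral>\<^sup>+x. ennreal ((s n x - s (r k) x)\<^sup>2) \<partial>M) \<le> ennreal (e\<^sup>2)"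
          using nn_integral_L2[OF L2_diff[OF s s], of n "r k"] by (simp add: ennreal_leI)
      qed
    qed
    finally show ?thesis .
  qed
  have diff: "(\<lambda>x. s n x - f x) \<in> L2 M \<and> L2_norm M (\<lambda>x. s n x - f x) \<le> e"
    if e: "0 < e" and n: "\<And>m. m \<ge> N' \<Longrightarrow> L2_norm M (\<lambda>x. s n x - s m x) < e" for n e N'
  proof -
    have bound: "(\<integral>\<^sup>+x. ennreal ((s n x - f x)\<^sup>2) \<partial>M) \<le> ennreal (e\<^sup>2)" using n by (rule fatou)
    then have "integrable M (\<lambda>x. (s n x - f x)\<^sup>2)"
      using L2_measurable[OF s] fm by (intro integrableI_bounded) (auto simp: le_less_trans)
    then have L: "(\<lambda>x. s n x - f x) \<in> L2 M"
      using L2_measurable[OF s] fm by (simp add: L2_def)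
    have "(L2_norm M (\<lambda>x. s n x - f x))\<^sup>2 \<le> e\<^sup>2" using bound nn_integral_L2[OF L] by simp
    then show ?thesis using L e by (auto intro: power2_le_imp_le)
  qed
  show ?thesis
  proof (intro bexI LIMSEQ_I)
    fix e :: real assume "0 < e"
    then obtain N' where N': "\<And>m n. m \<ge> N' \<Longrightarrow> n \<ge> N' \<Longrightarrow> L2_norm M (\<lambda>x. s m x - s n x) < e / 2"
      using cauchy[of "e / 2"] by auto
    have "norm (L2_norm M (\<lambda>x. s n x - f x) - 0) < e" if "n \<ge> N'" for n
      using diff[of "e / 2" N' n] N' that \<open>0 < e\<close> by (simp add: L2_norm_def)
    then show "\<exists>no. \<forall>n\<ge>no. norm (L2_norm M (\<lambda>x. s n x - f x) - 0) < e" by blast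
  next
    obtain N' where "\<And>m n. m \<ge> N' \<Longrightarrow> n \<ge> N' \<Longrightarrow> L2_norm M (\<lambda>x. s m x - s n x) < 1"
      using cauchy[of 1] by auto
    then have "(\<lambda>x. s N' x - f x) \<in> L2 M" using diff[of 1 N' N'] by simp
    from L2_diff[OF s[of N'] this] show "f \<in> L2 M" by simp
  qed
qed

lemma (in prob_space) semi_hilbert_L2: "semi_hilbert (L2 M) (L2_inner M)"
proof
  fix s :: "nat \<Rightarrow> 'a \<Rightarrow> real"
  assume s: "\<And>n. s n \<in> L2 M"
    and c: "\<And>e. 0 < e \<Longrightarrow> \<exists>N. \<forall>m\<ge>N. \<forall>n\<ge>N. sqrt (L2_inner M (s m - s n) (s m - s n)) < e"
  have eq: "sqrt (L2_inner M (g - h) (g - h)) = L2_norm M (\<lambda>x. g x - h x)" for g h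
    by (simp add: L2_inner_def L2_norm_def power2_eq_square)
  show "\<exists>x\<in>L2 M. (\<lambda>n. sqrt (L2_inner M (s n - x) (s n - x))) \<longlonglongrightarrow> 0"
    unfolding eq by (rule L2_complete[OF s]) (use c in \<open>simp add: eq\<close>)
qed

section \<open>Test functions and joint measurability of the kernels\<close>

lemma Ck_on_cong:
  assumes "open S" "\<And>x. x \<in> S \<Longrightarrow> f x = g x" "Ck_on k S f"
  shows "Ck_on k S g"
  using assms(2,3)
proof (induction k arbitrary: f g)
  case 0
  then show ?case using continuous_on_cong by force
next
  case (Suc k)
  have diff: "f differentiable (at x)" if "x \<in> S" for x using Suc.prems(2) that by simp
  have eq: "frechet_derivative f (at x) = frechet_derivative g (at x)" if "x \<in> S" for x
    using frechet_derivative_transform_within_open[OF diff[OF that] assms(1) that] Suc.prems(1) by blast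
  have "g differentiable (at x)" if "x \<in> S" for x
    using has_derivative_transform_within_open[OF iffD1[OF frechet_derivative_works diff[OF that]] assms(1) that]
      Suc.prems(1) by (auto simp: differentiable_def)
  moreover have "Ck_on k S (\<lambda>x. frechet_derivative g (at x) v)" for v
    by (rule Suc.IH[of "\<lambda>x. frechet_derivative f (at x) v"]) (use eq Suc.prems(2) in auto)
  ultimately show ?case by simp
qed

lemma Ck_on_SucI:
  assumes "open S" "\<And>x. x \<in> S \<Longrightarrow> (f has_derivative f' x) (at x)" "\<And>v. Ck_on k S (\<lambda>x. f' x v)"
  shows "Ck_on (Suc k) S f"
proof -
  have "Ck_on k S (\<lambda>x. frechet_derivative f (at x) v)" for v
    using frechet_derivative_at[OF assms(2)] by (intro Ck_on_cong[OF assms(1) _ assms(3)[of v]]) metis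
  then show ?thesis using assms(2) by (auto simp: differentiable_def)
qed

lemma Ck_on_Suc_derivative:
  "Ck_on (Suc k) S f \<Longrightarrow> x \<in> S \<Longrightarrow> (f has_derivative frechet_derivative f (at x)) (at x)"
  by (auto simp: frechet_derivative_works)

lemma Ck_on_SucD: "Ck_on (Suc k) S f \<Longrightarrow> Ck_on k S f"
proof (induction k arbitrary: f)
  case 0
  then show ?case
    by (auto intro!: continuous_at_imp_continuous_on differentiable_imp_continuous_within)
next
  case (Suc k)
  then show ?case by (metis Ck_on.simps(2))
qed

lemma Ck_on_const: "open S \<Longrightarrow> Ck_on k S (\<lambda>x. c)"
proof (induction k arbitrary: c)
  case (Suc k)
  show ?case by (rule Ck_on_SucI[where f' = "\<lambda>x v. 0"]) (use Suc in auto)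
qed simp

lemma Ck_on_bounded_linear:
  "open S \<Longrightarrow> bounded_linear L \<Longrightarrow> Ck_on k S f \<Longrightarrow> Ck_on k S (\<lambda>x. L (f x))"
proof (induction k arbitrary: f)
  case 0
  then show ?case by (auto intro: bounded_linear.continuous_on)
next
  case (Suc k)
  show ?case
  proof (rule Ck_on_SucI[OF Suc.prems(1)])
    show "((\<lambda>x. L (f x)) has_derivative (\<lambda>v. L (frechet_derivative f (at x) v))) (at x)" if "x \<in> S" for x
      by (rule bounded_linear.has_derivative[OF Suc.prems(2) Ck_on_Suc_derivative[OF Suc.prems(3) that]])
    show "Ck_on k S (\<lambda>x. L (frechet_derivative f (at x) v))" for v
      using Suc.prems by (intro Suc.IH) auto
  qed
qed

lemma Ck_on_add: "open S \<Longrightarrow> Ck_on k S f \<Longrightarrow> Ck_on k S g \<Longrightarrow> Ck_on k S (\<lambda>x. f x + g x)"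
proof (induction k arbitrary: f g)
  case (Suc k)
  show ?case
  proof (rule Ck_on_SucI[OF Suc.prems(1)])
    show "((\<lambda>x. f x + g x) has_derivative
        (\<lambda>v. frechet_derivative f (at x) v + frechet_derivative g (at x) v)) (at x)" if "x \<in> S" for x
      by (intro has_derivative_add Ck_on_Suc_derivative[OF Suc.prems(2) that]
          Ck_on_Suc_derivative[OF Suc.prems(3) that])
    show "Ck_on k S (\<lambda>x. frechet_derivative f (at x) v + frechet_derivative g (at x) v)" for v
      using Suc.prems by (intro Suc.IH) auto
  qed
qed (auto intro: continuous_on_add)

lemma Ck_on_mult:
  fixes f g :: "'a::real_normed_vector \<Rightarrow> real"
  shows "open S \<Longrightarrow> Ck_on k S f \<Longrightarrow> Ck_on k S g \<Longrightarrow> Ck_on k S (\<lambda>x. f x * g x)"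
proof (induction k arbitrary: f g)
  case (Suc k)
  show ?case
  proof (rule Ck_on_SucI[OF Suc.prems(1)])
    show "((\<lambda>x. f x * g x) has_derivative
        (\<lambda>v. f x * frechet_derivative g (at x) v + frechet_derivative f (at x) v * g x)) (at x)"
      if "x \<in> S" for x
      by (intro has_derivative_mult Ck_on_Suc_derivative[OF Suc.prems(2) that]
          Ck_on_Suc_derivative[OF Suc.prems(3) that])
    show "Ck_on k S (\<lambda>x. f x * frechet_derivative g (at x) v + frechet_derivative f (at x) v * g x)" for v
      using Suc.prems Ck_on_SucD[of k S f] Ck_on_SucD[of k S g] by (intro Ck_on_add Suc.IH) auto
  qed
qed (auto intro: continuous_on_mult)

lemma Ck_on_prod:
  fixes f :: "'i \<Rightarrow> 'a::real_normed_vector \<Rightarrow> real"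
  assumes "open S" "\<And>i. i \<in> I \<Longrightarrow> Ck_on k S (f i)"
  shows "Ck_on k S (\<lambda>x. \<Prod>i\<in>I. f i x)"
  using assms(2)
proof (induction I rule: infinite_finite_induct)
  case (insert i I)
  then show ?case by (simp add: Ck_on_mult[OF assms(1)])
qed (simp_all add: Ck_on_const[OF assms(1)])

section \<open>Smooth bump functions of boxes\<close>

definition flat_exp :: "nat \<Rightarrow> real \<Rightarrow> real" where
  "flat_exp n x = (if x > 0 then exp (- (1 / x)) / x ^ n else 0)"

lemma flat_exp_tendsto_0: "(flat_exp n \<longlongrightarrow> 0) (at 0)"
proof (rule filterlim_split_at)
  show "(flat_exp n \<longlongrightarrow> 0) (at_left 0)"
    by (rule tendsto_eventually) (auto simp: eventually_at_filter flat_exp_def)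
  have "((\<lambda>x::real. inverse x ^ n / exp (inverse x)) \<longlongrightarrow> 0) (at_right 0)"
    by (rule filterlim_compose[OF tendsto_power_div_exp_0 filterlim_inverse_at_top_right])
  moreover have "\<forall>\<^sub>F x::real in at_right 0. inverse x ^ n / exp (inverse x) = flat_exp n x"
    by (auto simp: eventually_at_filter flat_exp_def exp_minus field_simps)
  ultimately show "(flat_exp n \<longlongrightarrow> 0) (at_right 0)"
    by (rule Lim_transform_eventually)
qed

text \<open>The index \<open>n\<close> exists for this formula: the derivatives of the classical
  flat exponential stay in the span of the family. At 0 the difference quotient of
  \<open>flat_exp n\<close> is \<open>flat_exp (n + 1)\<close>, which tends to 0.\<close>

lemma flat_exp_derivative:
  "(flat_exp n has_real_derivative (flat_exp (n + 2) x - n * flat_exp (n + 1) x)) (at x)"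
proof (cases x "0::real" rule: linorder_cases)
  case less
  have "((\<lambda>x. 0) has_real_derivative 0) (at x)" by simp
  then have "(flat_exp n has_real_derivative 0) (at x)"
    by (rule has_field_derivative_transform_within_open[of _ _ _ "{..<0}"]) (use less in \<open>auto simp: flat_exp_def\<close>)
  then show ?thesis using less by (simp add: flat_exp_def)
next
  case equal
  have "((\<lambda>h. (flat_exp n (0 + h) - flat_exp n 0) / h) \<longlongrightarrow> 0) (at 0)"
    by (rule Lim_transform_eventually[OF flat_exp_tendsto_0[of "n + 1"]])
      (auto simp: eventually_at_filter flat_exp_def)
  then show ?thesis unfolding equal by (simp add: DERIV_def flat_exp_def)
next
  case greater
  have "((\<lambda>x. x ^ n) has_real_derivative n * x ^ n / x) (at x)"
    by (rule DERIV_cong[OF DERIV_pow]) (use greater in \<open>cases n; simp\<close>)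
  moreover have "((\<lambda>x. exp (- (1 / x))) has_real_derivative exp (- (1 / x)) / (x * x)) (at x)"
    using greater by (auto intro!: derivative_eq_intros)
  ultimately have "((\<lambda>x. exp (- (1 / x)) / x ^ n) has_real_derivative
      (exp (- (1 / x)) / (x * x) * x ^ n - exp (- (1 / x)) * (n * x ^ n / x)) / (x ^ n * x ^ n)) (at x)"
    using greater by (intro DERIV_divide) auto
  moreover have "(exp (- (1 / x)) / (x * x) * x ^ n - exp (- (1 / x)) * (n * x ^ n / x)) / (x ^ n * x ^ n)
      = exp (- (1 / x)) / x ^ (n + 2) - n * (exp (- (1 / x)) / x ^ (n + 1))"
    using greater by (simp add: field_simps)
  ultimately have "((\<lambda>x. exp (- (1 / x)) / x ^ n) has_real_derivative
      (exp (- (1 / x)) / x ^ (n + 2) - n * (exp (- (1 / x)) / x ^ (n + 1)))) (at x)"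
    by simp
  then have "(flat_exp n has_real_derivative
      (exp (- (1 / x)) / x ^ (n + 2) - n * (exp (- (1 / x)) / x ^ (n + 1)))) (at x)"
    by (rule has_field_derivative_transform_within_open[of _ _ _ "{0<..}"])
      (use greater in \<open>auto simp: flat_exp_def\<close>)
  then show ?thesis using greater by (simp add: flat_exp_def)
qed

text \<open>A derivative combines members with larger \<open>n\<close>, so the induction on
  \<open>k\<close> leaves \<open>n\<close> arbitrary.\<close>

lemma Ck_on_flat_exp_affine:
  assumes l: "bounded_linear (l :: 'a::real_normed_vector \<Rightarrow> real)"
  shows "Ck_on k UNIV (\<lambda>x. flat_exp n (l x + c))"
proof (induction k arbitrary: n)
  case 0
  have "continuous_on UNIV (flat_exp n)"
    using flat_exp_derivative DERIV_isCont by (intro continuous_at_imp_continuous_on) blast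
  then show ?case
    by (auto intro!: continuous_on_compose2[of UNIV "flat_exp n"] continuous_intros
        bounded_linear.continuous_on[OF l])
next
  case (Suc k)
  show ?case
  proof (rule Ck_on_SucI)
    fix x
    have "((\<lambda>x. l x + c) has_derivative l) (at x)"
      using has_derivative_add_const[OF bounded_linear_imp_has_derivative[OF l]] by simp
    moreover have "(flat_exp n has_derivative
        (\<lambda>h. (flat_exp (n + 2) (l x + c) - n * flat_exp (n + 1) (l x + c)) * h)) (at (l x + c))"
      using flat_exp_derivative[of n "l x + c"] by (simp add: has_field_derivative_def)
    ultimately have "((\<lambda>x. flat_exp n (l x + c)) has_derivative
        (\<lambda>v. (flat_exp (n + 2) (l x + c) - n * flat_exp (n + 1) (l x + c)) * l v)) (at x)"
      by (rule has_derivative_compose)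
    then show "((\<lambda>x. flat_exp n (l x + c)) has_derivative
        (\<lambda>v. flat_exp (n + 2) (l x + c) * l v + (- real n) * flat_exp (n + 1) (l x + c) * l v)) (at x)"
      by (rule has_derivative_eq_rhs) (simp add: fun_eq_iff algebra_simps)
    show "Ck_on k UNIV (\<lambda>x. flat_exp (n + 2) (l x + c) * l v + (- real n) * flat_exp (n + 1) (l x + c) * l v)" for v
      by (intro Ck_on_add Ck_on_mult Ck_on_const Suc) auto
  qed simp
qed

text \<open>A product over the faces of the box. \<open>n\<close> is a steepness: as it grows the
  functions tend to the indicator of the open box, so the mass that a kernel gives to a box is a
  limit of transition operators applied to test functions.\<close>

definition box_bump :: "real^'d \<Rightarrow> real^'d \<Rightarrow> nat \<Rightarrow> real^'d \<Rightarrow> real" where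
  "box_bump a b n z = (\<Prod>j\<in>UNIV. flat_exp 0 (n * (z $ j - a $ j)) * flat_exp 0 (n * (b $ j - z $ j)))"

lemma flat_exp_0_bounds: "0 \<le> flat_exp 0 x" "flat_exp 0 x \<le> 1"
  by (auto simp: flat_exp_def)

lemma box_bump_bounds: "0 \<le> box_bump a b n z" "box_bump a b n z \<le> 1"
  unfolding box_bump_def
  by (auto intro!: prod_nonneg prod_le_1 mult_le_one flat_exp_0_bounds mult_nonneg_nonneg)

lemma mem_box_vec: "z \<in> box a b \<longleftrightarrow> (\<forall>j. a $ j < z $ j \<and> z $ j < b $ j)" for z :: "real^'d"
  by (auto simp: mem_box_cart)

lemma box_bump_outside:
  assumes "z \<notin> box a b"
  shows "box_bump a b n z = 0"
proof -
  obtain j where j: "\<not> (a $ j < z $ j \<and> z $ j < b $ j)" using assms mem_box_vec by blast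
  then have "real n * (z $ j - a $ j) \<le> 0 \<or> real n * (b $ j - z $ j) \<le> 0"
    by (auto simp: mult_le_0_iff not_less)
  then have "flat_exp 0 (n * (z $ j - a $ j)) * flat_exp 0 (n * (b $ j - z $ j)) = 0"
    by (auto simp: flat_exp_def)
  then show ?thesis unfolding box_bump_def by (intro prod_zero) (auto intro!: bexI[of _ j])
qed

lemma box_bump_tendsto: "(\<lambda>n. box_bump a b n z) \<longlonglongrightarrow> indicator (box a b) z"
proof (cases "z \<in> box a b")
  case True
  have flat: "(\<lambda>n. flat_exp 0 (real n * x)) \<longlonglongrightarrow> 1" if "0 < x" for x
  proof -
    have "(\<lambda>n. exp (- (inverse (real n) * (1 / x)))) \<longlonglongrightarrow> exp (- (0 * (1 / x)))"
      by (intro tendsto_intros lim_inverse_n)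
    moreover have "\<forall>\<^sub>F n in sequentially. exp (- (inverse (real n) * (1 / x))) = flat_exp 0 (real n * x)"
      using eventually_gt_at_top[of 0] by eventually_elim (use that in \<open>simp add: flat_exp_def field_simps\<close>)
    ultimately show ?thesis using Lim_transform_eventually by fastforce
  qed
  have "(\<lambda>n. box_bump a b n z) \<longlonglongrightarrow> (\<Prod>j\<in>(UNIV :: 'a set). 1 * 1)"
    unfolding box_bump_def using True by (intro tendsto_prod tendsto_mult flat) (auto simp: mem_box_vec)
  then show ?thesis using True by simp
qed (simp add: box_bump_outside)

lemma smooth_on_box_bump: "smooth_on UNIV (box_bump a b n)"
  unfolding smooth_on_def
proof
  fix k
  have "Ck_on k UNIV (\<lambda>z. flat_exp 0 (n * (z $ j - a $ j)) * flat_exp 0 (n * (b $ j - z $ j)))" for j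
  proof (rule Ck_on_mult)
    have l: "bounded_linear (\<lambda>z::real^'a. real n * z $ j)" "bounded_linear (\<lambda>z::real^'a. - real n * z $ j)"
      by (intro bounded_linear_const_mult bounded_linear_vec_nth)+
    show "Ck_on k UNIV (\<lambda>z. flat_exp 0 (n * (z $ j - a $ j)))"
      using Ck_on_flat_exp_affine[OF l(1), of k 0 "- n * a $ j"] by (simp add: algebra_simps)
    show "Ck_on k UNIV (\<lambda>z. flat_exp 0 (n * (b $ j - z $ j)))"
      using Ck_on_flat_exp_affine[OF l(2), of k 0 "n * b $ j"] by (simp add: algebra_simps)
  qed simp
  then show "Ck_on k UNIV (box_bump a b n)"
    unfolding box_bump_def[abs_def] by (intro Ck_on_prod) auto
qed

lemma test_function_box_bump:
  assumes "closed M"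
  shows "test_function M (box_bump a b n)"
  unfolding test_function_def smooth_on_submanifold_def
proof
  show "\<forall>x\<in>M. \<exists>U F. open U \<and> x \<in> U \<and> smooth_on U F \<and> (\<forall>y\<in>M \<inter> U. box_bump a b n y = F y)"
    using smooth_on_box_bump by (intro ballI exI[of _ UNIV] exI[of _ "box_bump a b n"]) auto
  show "\<exists>C\<subseteq>M. compact C \<and> (\<forall>x\<in>M - C. box_bump a b n x = 0)"
    using assms box_subset_cbox[of a b]
    by (intro exI[of _ "M \<inter> cbox a b"]) (auto intro!: closed_Int_compact box_bump_outside)
qed

lemma smooth_on_submanifold_continuous_on:
  assumes "smooth_on_submanifold M f"
  shows "continuous_on M f"
proof (clarsimp simp: continuous_on_eq_continuous_within)
  fix x assume x: "x \<in> M"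
  then obtain U F where U: "open U" "x \<in> U" "smooth_on U F" "\<forall>y\<in>M \<inter> U. f y = F y"
    using assms by (auto simp: smooth_on_submanifold_def)
  have "Ck_on 0 U F" using U(3) unfolding smooth_on_def by blast
  then have "continuous (at x within M) F"
    using U by (simp add: continuous_on_eq_continuous_at continuous_at_imp_continuous_at_within)
  moreover have "\<forall>\<^sub>F y in at x within M. F y = f y"
    using U by (auto simp: eventually_at_topological)
  ultimately show "continuous (at x within M) f"
    using U x by (auto simp: continuous_within intro: Lim_transform_eventually)
qed

lemma test_function_continuous_on: "test_function M f \<Longrightarrow> continuous_on M f"
  by (simp add: test_function_def smooth_on_submanifold_continuous_on)

lemma test_function_bounded:
  assumes "test_function M f"
  obtains B where "\<And>x. x \<in> M \<Longrightarrow> \<bar>f x\<bar> \<le> B"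
proof -
  obtain C where C: "C \<subseteq> M" "compact C" "\<forall>x\<in>M - C. f x = 0" using assms by (auto simp: test_function_def)
  have "compact (f ` C)"
    using test_function_continuous_on[OF assms] C by (intro compact_continuous_image) (auto elim: continuous_on_subset)
  then obtain B where B: "\<And>y. y \<in> f ` C \<Longrightarrow> norm y \<le> B" using compact_imp_bounded bounded_iff by metis
  have "\<bar>f x\<bar> \<le> max B 0" if "x \<in> M" for x
    using B[of "f x"] C that by (cases "x \<in> C") auto
  then show ?thesis by (rule that)
qed

lemma test_function_measurable:
  assumes "test_function M f"
  shows "f \<in> borel_measurable (borel_of M)"
  using borel_measurable_continuous_on_restrict[OF test_function_continuous_on[OF assms]] .

section \<open>Measurability of the kernels jointly in time and starting point\<close>

lemma borel_of_generator:
  assumes "closed (M :: (real^'d) set)"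
  shows "sets (borel_of M) = sigma_sets M ((\<inter>) M ` range (\<lambda>(a, b). box a b))"
proof -
  have "sets (borel_of M) = (\<inter>) M ` sigma_sets UNIV (range (\<lambda>(a, b). box a b))"
    unfolding sets_restrict_space by (subst borel_eq_box) simp
  also have "\<dots> = sigma_sets M ((\<inter>) M ` range (\<lambda>(a, b). box a b))"
  proof (rule sigma_sets_Int)
    have "M \<in> sets borel" using assms by simp
    then show "M \<in> sigma_sets UNIV (range (\<lambda>(a, b). box a b))"
      by (subst (asm) borel_eq_box) simp
  qed simp
  finally show ?thesis .
qed

text \<open>A Caratheodory function. Rounding the time down to a multiple of
  \<open>1 / Suc m\<close> leaves a countable choice among measurable functions of the second
  variable, and continuity in time gives the limit.\<close>

lemma borel_measurable_right_continuous_pair: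
  fixes f :: "real \<Rightarrow> 'a \<Rightarrow> real"
  assumes cont: "\<And>z. z \<in> space N \<Longrightarrow> continuous_on {0..} (\<lambda>r. f r z)"
    and meas: "\<And>r. 0 \<le> r \<Longrightarrow> f r \<in> borel_measurable N"
  shows "(\<lambda>(r, z). f r z) \<in> borel_measurable (restrict_space borel {0..} \<Otimes>\<^sub>M N)"
proof -
  let ?P = "restrict_space borel {0::real..} \<Otimes>\<^sub>M N"
  define g where "g m x = f (real (nat \<lfloor>real (Suc m) * fst x\<rfloor>) / real (Suc m)) (snd x)" for m and x :: "real \<times> 'a"
  have "fst \<in> ?P \<rightarrow>\<^sub>M restrict_space borel {0..}" by (rule measurable_fst)
  then have [measurable]: "fst \<in> borel_measurable ?P" by (simp add: measurable_restrict_space2_iff)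
  have "g m \<in> borel_measurable ?P" for m
    unfolding g_def
  proof (rule measurable_compose_countable[where f = "\<lambda>i x. f (real i / real (Suc m)) (snd x)"])
    show "(\<lambda>x. f (real i / real (Suc m)) (snd x)) \<in> borel_measurable ?P" for i
      by (rule measurable_compose[OF measurable_snd meas]) simp
    show "(\<lambda>x. nat \<lfloor>real (Suc m) * fst x\<rfloor>) \<in> ?P \<rightarrow>\<^sub>M count_space UNIV" by measurable
  qed
  then show ?thesis
  proof (rule borel_measurable_LIMSEQ_real[rotated])
    fix x assume "x \<in> space ?P"
    then obtain r z where x: "x = (r, z)" "0 \<le> r" "z \<in> space N" by (auto simp: space_pair_measure space_restrict_space)
    have nat_eq: "real (nat \<lfloor>real (Suc m) * r\<rfloor>) = of_int \<lfloor>real (Suc m) * r\<rfloor>" for m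
      using x(2) by (intro of_nat_nat) simp
    have "(\<lambda>m. real (nat \<lfloor>real (Suc m) * r\<rfloor>) / real (Suc m)) \<longlonglongrightarrow> r"
    proof (rule tendsto_sandwich)
      have "r - 1 / real (Suc m) \<le> of_int \<lfloor>real (Suc m) * r\<rfloor> / real (Suc m)" for m
      proof -
        have "real (Suc m) * r - 1 \<le> of_int \<lfloor>real (Suc m) * r\<rfloor>" by linarith
        then have "(real (Suc m) * r - 1) / real (Suc m) \<le> of_int \<lfloor>real (Suc m) * r\<rfloor> / real (Suc m)"
          by (intro divide_right_mono) auto
        then show ?thesis by (simp add: diff_divide_distrib)
      qed
      then show "\<forall>\<^sub>F m in sequentially. r - 1 / real (Suc m) \<le> real (nat \<lfloor>real (Suc m) * r\<rfloor>) / real (Suc m)"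
        unfolding nat_eq by simp
      have "of_int \<lfloor>real (Suc m) * r\<rfloor> / real (Suc m) \<le> (real (Suc m) * r) / real (Suc m)" for m
        by (intro divide_right_mono) auto
      then show "\<forall>\<^sub>F m in sequentially. real (nat \<lfloor>real (Suc m) * r\<rfloor>) / real (Suc m) \<le> r"
        unfolding nat_eq by simp
      show "(\<lambda>m. r - 1 / real (Suc m)) \<longlonglongrightarrow> r"
        using tendsto_diff[OF tendsto_const LIMSEQ_Suc[OF lim_1_over_n], of r] by simp
    qed simp
    then show "(\<lambda>m. g m x) \<longlonglongrightarrow> (case x of (r, z) \<Rightarrow> f r z)"
      unfolding g_def x(1) fst_conv snd_conv case_prod_conv
      by (rule continuous_on_tendsto_compose[OF cont[OF x(3)]]) (use x(2) in auto)
  qed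
qed

lemma langevin_kernels_space:
  assumes "langevin_kernels M p K" "0 \<le> s" "z \<in> M"
  shows "prob_space (K s z)" "sets (K s z) = sets (borel_of M)" "space (K s z) = M"
proof -
  have "K s z \<in> space (prob_algebra (borel_of M))"
  proof -
    have "K s \<in> borel_of M \<rightarrow>\<^sub>M prob_algebra (borel_of M)" using assms by (simp add: langevin_kernels_def)
    from measurable_space[OF this] show ?thesis using assms(3) by (simp add: space_restrict_space)
  qed
  then show "prob_space (K s z)" "sets (K s z) = sets (borel_of M)" by (auto simp: space_prob_algebra)
  then show "space (K s z) = M" 
    using sets_eq_imp_space_eq[of "K s z" "borel_of M"] by (simp add: space_restrict_space)
qed

text \<open>Dynkin's formula exhibits this function of time as a constant plus an indefinite
  integral, which is continuous in its upper limit.\<close>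

lemma langevin_transition_continuous:
  assumes K: "langevin_kernels M p K" and f: "test_function M f" and z: "z \<in> M"
  shows "continuous_on {0..} (\<lambda>s. transition_op (K s) f z)"
proof -
  let ?u = "\<lambda>r. transition_op (K r) (weighted_laplacian M p f) z"
  have hi: "(?u has_integral (transition_op (K s) f z - f z)) {0..s}" if "0 \<le> s" for s
    using K f z that by (auto simp: langevin_kernels_def)
  have "continuous_on {0..S} (\<lambda>s. transition_op (K s) f z)" if "0 \<le> S" for S
  proof -
    have "continuous_on {0..S} (\<lambda>s. f z + integral {0..s} ?u)"
      using hi[OF that] by (intro continuous_intros indefinite_integral_continuous_1) auto
    then show ?thesis
      by (rule continuous_on_eq) (simp add: integral_unique[OF hi])
  qed
  then show ?thesis
    unfolding continuous_on_eq_continuous_within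
  proof (intro ballI)
    fix x :: real assume *: "\<And>S. 0 \<le> S \<Longrightarrow> \<forall>x\<in>{0..S}. continuous (at x within {0..S}) (\<lambda>s. transition_op (K s) f z)"
      and x: "x \<in> {0..}"
    have "continuous (at x within {0..x + 1}) (\<lambda>s. transition_op (K s) f z)" using *[of "x + 1"] x by auto
    moreover have "at x within {0..x + 1} = at x within {0..}"
      by (rule at_within_nhd[of _ "{..<x + 1}"]) auto
    ultimately show "continuous (at x within {0..}) (\<lambda>s. transition_op (K s) f z)"
      by (simp add: continuous_within)
  qed
qed

text \<open>Needed for Fubini's theorem in time and space. The traces of boxes on \<open>M\<close>
  generate the sigma-algebra and are stable under intersection; the mass of such a trace is a limit
  of transitions of bump functions, which are continuous in time and measurable in the starting
  point.\<close>

lemma langevin_kernels_jointly_measurable: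
  assumes M: "closed M" and K: "langevin_kernels M p K"
  shows "(\<lambda>(r, z). K r z) \<in> restrict_space borel {0..} \<Otimes>\<^sub>M borel_of M \<rightarrow>\<^sub>M prob_algebra (borel_of M)"
proof (rule measurable_prob_algebra_generated[OF borel_of_generator[OF M]])
  let ?P = "restrict_space borel {0::real..} \<Otimes>\<^sub>M borel_of M"
  have sp: "0 \<le> fst x \<and> snd x \<in> M" if "x \<in> space ?P" for x
    using that by (auto simp: space_pair_measure space_restrict_space)
  show "Int_stable ((\<inter>) M ` range (\<lambda>(a, b). box a b))"
    unfolding Int_stable_def
  proof (intro ballI)
    fix A B :: "(real^'a) set"
    assume "A \<in> (\<inter>) M ` range (\<lambda>(a, b). box a b)" "B \<in> (\<inter>) M ` range (\<lambda>(a, b). box a b)"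
    then obtain a b c d where "A = M \<inter> box a b" "B = M \<inter> box c d" by auto
    then have "A \<inter> B = M \<inter> (box a b \<inter> box c d)" by auto
    then show "A \<inter> B \<in> (\<inter>) M ` range (\<lambda>(a, b). box a b)" unfolding box_Int_box by auto
  qed
  show "(\<inter>) M ` range (\<lambda>(a, b). box a b) \<subseteq> Pow M" by auto
  show "prob_space (case x of (r, z) \<Rightarrow> K r z)" if "x \<in> space ?P" for x
    using langevin_kernels_space(1)[OF K] sp[OF that] by (auto simp: case_prod_beta)
  show "sets (case x of (r, z) \<Rightarrow> K r z) = sets (borel_of M)" if "x \<in> space ?P" for x
    using langevin_kernels_space(2)[OF K] sp[OF that] by (auto simp: case_prod_beta)
  fix A assume "A \<in> (\<inter>) M ` range (\<lambda>(a, b). box a b)"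
  then obtain a b where A: "A = M \<inter> box a b" by auto
  have lim: "(\<lambda>n. transition_op (K r) (box_bump a b n) z) \<longlonglongrightarrow> measure (K r z) A"
    if r: "0 \<le> r" and z: "z \<in> M" for r z
  proof -
    interpret K: prob_space "K r z" by (rule langevin_kernels_space(1)[OF K r z])
    note [simp] = langevin_kernels_space(2,3)[OF K r z]
    have AS: "A \<in> sets (K r z)" using A M by (auto simp: sets_restrict_space)
    have "(\<lambda>n. \<integral>y. box_bump a b n y \<partial>K r z) \<longlonglongrightarrow> (\<integral>y. indicator (box a b) y \<partial>K r z)"
    proof (rule integral_dominated_convergence[where w = "\<lambda>_. 1"])
      show "box_bump a b n \<in> borel_measurable (K r z)" for n
        using test_function_measurable[OF test_function_box_bump[OF M]]
        by (simp cong: measurable_cong_sets)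
      show "indicator (box a b) \<in> borel_measurable (K r z)"
        by (simp cong: measurable_cong_sets add: measurable_restrict_space1)
    qed (auto simp: box_bump_tendsto box_bump_bounds)
    also have "(\<integral>y. indicator (box a b) y \<partial>K r z) = (\<integral>y. indicator A y \<partial>K r z)"
      by (intro Bochner_Integration.integral_cong) (auto simp: A indicator_def)
    also have "\<dots> = measure (K r z) (A \<inter> M)" using AS by simp
    also have "A \<inter> M = A" using A by auto
    finally show ?thesis by (simp add: transition_op_def)
  qed
  have "(\<lambda>x. measure (case x of (r, z) \<Rightarrow> K r z) A) \<in> borel_measurable ?P"
  proof (rule borel_measurable_LIMSEQ_real)
    show "(\<lambda>n. case x of (r, z) \<Rightarrow> transition_op (K r) (box_bump a b n) z) \<longlonglongrightarrow> measure (case x of (r, z) \<Rightarrow> K r z) A"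
      if "x \<in> space ?P" for x
      using lim sp[OF that] by (auto simp: case_prod_beta)
    show "(\<lambda>(r, z). transition_op (K r) (box_bump a b n) z) \<in> borel_measurable ?P" for n
    proof (rule borel_measurable_right_continuous_pair)
      show "continuous_on {0..} (\<lambda>r. transition_op (K r) (box_bump a b n) z)" if "z \<in> space (borel_of M)" for z
        using that by (intro langevin_transition_continuous[OF K] test_function_box_bump M)
          (simp add: space_restrict_space)
      show "transition_op (K r) (box_bump a b n) \<in> borel_measurable (borel_of M)" if "0 \<le> r" for r
      proof -
        have "K r \<in> borel_of M \<rightarrow>\<^sub>M prob_algebra (borel_of M)" using K that by (simp add: langevin_kernels_def)
        then have "K r \<in> borel_of M \<rightarrow>\<^sub>M subprob_algebra (borel_of M)" by (rule measurable_prob_algebraD)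
        then show ?thesis unfolding transition_op_def[abs_def]
          by (rule measurable_compose[OF _ integral_measurable_subprob_algebra])
            (rule test_function_measurable[OF test_function_box_bump[OF M]])
      qed
    qed
  qed
  moreover have "emeasure (case x of (r, z) \<Rightarrow> K r z) A = ennreal (measure (case x of (r, z) \<Rightarrow> K r z) A)"
    if "x \<in> space ?P" for x
  proof -
    interpret prob_space "case x of (r, z) \<Rightarrow> K r z"
      using langevin_kernels_space(1)[OF K] sp[OF that] by (auto simp: case_prod_beta)
    show ?thesis by (rule emeasure_eq_measure)
  qed
  ultimately show "(\<lambda>x. emeasure (case x of (r, z) \<Rightarrow> K r z) A) \<in> borel_measurable ?P"
    by (simp cong: measurable_cong)
qed

section \<open>The transition operators and Dynkin's formula\<close>

lemma L2_inner_add_right: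
  "w \<in> L2 P \<Longrightarrow> f \<in> L2 P \<Longrightarrow> g \<in> L2 P \<Longrightarrow> L2_inner P w (\<lambda>x. f x + g x) = L2_inner P w f + L2_inner P w g"
  using L2.form_add_right[of f P g w] by (simp add: plus_fun_def)

lemma L2_inner_diff_right:
  "w \<in> L2 P \<Longrightarrow> f \<in> L2 P \<Longrightarrow> g \<in> L2 P \<Longrightarrow> L2_inner P w (\<lambda>x. f x - g x) = L2_inner P w f - L2_inner P w g"
  using L2.form_diff_right[of f P g w] by (simp add: fun_diff_def)

lemma L2_inner_cmult_right: "L2_inner P w (\<lambda>x. a * f x) = a * L2_inner P w f"
  by (simp add: L2_inner_def mult.left_commute)

lemma L2_inner_cong_AE:
  assumes "w \<in> L2 P" "f \<in> L2 P" "g \<in> L2 P" "AE x in P. f x = g x"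
  shows "L2_inner P w f = L2_inner P w g"
  unfolding L2_inner_def
  using assms by (intro integral_cong_AE) (auto simp: L2_def)

lemma abs_L2_inner_le: "f \<in> L2 P \<Longrightarrow> g \<in> L2 P \<Longrightarrow> \<bar>L2_inner P f g\<bar> \<le> L2_norm P f * L2_norm P g"
  using L2.abs_form_le[of f P g] by (simp add: seminorm_L2)

lemma L2_norm_nonneg: "0 \<le> L2_norm P f"
  by (simp add: L2_norm_def)

lemma L2_norm_minus: "L2_norm P (\<lambda>x. - f x) = L2_norm P f"
  by (simp add: L2_norm_def)

lemma L2_eq_AE_if_inner_eq:
  assumes "f \<in> L2 P" "g \<in> L2 P" "\<And>w. w \<in> L2 P \<Longrightarrow> L2_inner P w f = L2_inner P w g"
  shows "AE x in P. f x = g x"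
proof -
  have d: "(\<lambda>x. f x - g x) \<in> L2 P" using assms by (intro L2_diff)
  have "L2_inner P (\<lambda>x. f x - g x) (\<lambda>x. f x - g x) = 0"
    using assms d by (simp add: L2_inner_diff_right)
  then have "L2_norm P (\<lambda>x. f x - g x) = 0"
    by (simp add: L2_norm_def L2_inner_def power2_eq_square)
  then show ?thesis using L2_norm_eq_0[OF d] by simp
qed

text \<open>The equation makes \<open>y\<close> first continuous and then differentiable with
  derivative \<open>c * y\<close>, so \<open>exp (- c * r) * y r\<close> is constant. Regularity is
  derived here because the application is to inner products with \<open>T r f\<close>, of which only
  integrability in time is known beforehand.\<close>

lemma exponential_integral_equation:
  fixes y :: "real \<Rightarrow> real"
  assumes y: "\<And>s. 0 \<le> s \<Longrightarrow> (y has_integral I s) {0..s}" "\<And>s. 0 \<le> s \<Longrightarrow> y s = y 0 + c * I s"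
    and s: "0 \<le> s"
  shows "y s = exp (c * s) * y 0"
proof -
  have I: "I r = integral {0..r} y" if "0 \<le> r" for r using y(1)[OF that] by (simp add: integral_unique)
  have eq: "y 0 + c * integral {0..r} y = y r" if "r \<in> {0..s}" for r
    using y(2)[of r] I[of r] that by auto
  have int: "y integrable_on {0..s}" using y(1)[OF s] by (rule has_integral_integrable)
  have cont: "continuous_on {0..s} y"
  proof -
    have "continuous_on {0..s} (\<lambda>r. y 0 + c * integral {0..r} y)"
      using int by (intro continuous_intros indefinite_integral_continuous_1)
    then show ?thesis by (rule continuous_on_eq) (rule eq)
  qed
  have D: "(y has_real_derivative c * y r) (at r within {0..s})" if r: "r \<in> {0..s}" for r
  proof -
    have "((\<lambda>r. integral {0..r} y) has_real_derivative y r) (at r within {0..s})"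
      using integral_has_real_derivative[OF cont r] .
    then have "((\<lambda>r. y 0 + c * integral {0..r} y) has_real_derivative c * y r) (at r within {0..s})"
      by (auto intro!: derivative_eq_intros)
    then show ?thesis
      by (rule has_field_derivative_transform_within[OF _ zero_less_one r]) (rule eq)
  qed
  have "\<exists>k. \<forall>r\<in>{0..s}. exp (- c * r) * y r = k"
    by (rule has_field_derivative_zero_constant) (auto intro!: derivative_eq_intros D)
  then obtain k where k: "\<And>r. r \<in> {0..s} \<Longrightarrow> exp (- c * r) * y r = k" by blast
  have "exp (- c * s) * y s = exp (- c * 0) * y 0" using k[of s] k[of 0] s by simp
  then show ?thesis by (simp add: exp_minus field_simps)
qed

section \<open>The semigroup on L2 of the stationary law and Dynkin's formula on the graph\<close>

locale langevin =
  fixes M :: "(real^'d) set" and vol :: "(real^'d) measure" and p :: "real^'d \<Rightarrow> real"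
    and K :: "real \<Rightarrow> real^'d \<Rightarrow> (real^'d) measure"
  assumes closed_M: "closed M" and sets_vol: "sets vol = sets (borel_of M)"
    and prob_space_law: "prob_space (law_of vol p)"
    and kernels: "langevin_kernels M p K"
    and stationary: "stationary K (law_of vol p)"
    and self_adjoint: "self_adjoint (law_of vol p) (neg_generator M vol p)"
begin

abbreviation "P \<equiv> law_of vol p"
abbreviation "A \<equiv> neg_generator M vol p"
abbreviation "T s \<equiv> transition_op (K s)"

sublocale P: prob_space P by (rule prob_space_law)

lemma sets_P [measurable_cong]: "sets P = sets (borel_of M)"
  using sets_vol by (simp add: law_of_def)

lemma space_P: "space P = M"
  using sets_eq_imp_space_eq[OF sets_P] by (simp add: space_restrict_space)

lemma measurable_P: "measurable P N = measurable (borel_of M) N"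
  by (rule measurable_cong_sets[OF sets_P refl])

lemma K_measurable: "0 \<le> s \<Longrightarrow> K s \<in> P \<rightarrow>\<^sub>M subprob_algebra (borel_of M)"
  unfolding measurable_P using kernels by (auto simp: langevin_kernels_def intro: measurable_prob_algebraD)

lemmas K_space = langevin_kernels_space[OF kernels]

lemma measurable_K: "0 \<le> s \<Longrightarrow> z \<in> M \<Longrightarrow> measurable (K s z) N = measurable (borel_of M) N"
  by (rule measurable_cong_sets[OF K_space(2) refl])

lemma nn_integral_stationary:
  assumes "f \<in> borel_measurable (borel_of M)" "0 \<le> s"
  shows "(\<integral>\<^sup>+z. (\<integral>\<^sup>+z'. f z' \<partial>K s z) \<partial>P) = (\<integral>\<^sup>+z. f z \<partial>P)"
  using nn_integral_bind[OF assms(1) K_measurable[OF assms(2)]] stationary assms(2)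
  by (simp add: stationary_def)

lemma nn_integral_K_measurable:
  assumes "f \<in> borel_measurable (borel_of M)" "0 \<le> s"
  shows "(\<lambda>z. \<integral>\<^sup>+z'. f z' \<partial>K s z) \<in> borel_measurable P"
  by (rule measurable_compose[OF K_measurable[OF assms(2)] nn_integral_measurable_subprob_algebra[OF assms(1)]])

lemma T_measurable:
  assumes "f \<in> borel_measurable (borel_of M)" "0 \<le> s"
  shows "T s f \<in> borel_measurable P"
  unfolding transition_op_def[abs_def]
  by (rule measurable_compose[OF K_measurable[OF assms(2)] integral_measurable_subprob_algebra[OF assms(1)]])

lemma L2_measurable_M: "f \<in> L2 P \<Longrightarrow> f \<in> borel_measurable (borel_of M)"
  using L2_measurable measurable_P by blast

text \<open>By stationarity the kernel integrals of the square of \<open>f\<close> have a finite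
  mean, hence are finite almost everywhere. The exceptional null set is the reason why
  \<open>T s\<close> is linear only almost everywhere.\<close>

lemma AE_K_L2:
  assumes f: "f \<in> L2 P" and s: "0 \<le> s"
  shows "AE z in P. f \<in> L2 (K s z)"
proof -
  have fm: "f \<in> borel_measurable (borel_of M)" using L2_measurable_M[OF f] .
  have "(\<integral>\<^sup>+z. (\<integral>\<^sup>+z'. ennreal ((f z')\<^sup>2) \<partial>K s z) \<partial>P) < \<infinity>"
    using fm s nn_integral_L2[OF f] by (subst nn_integral_stationary) auto
  then have "AE z in P. (\<integral>\<^sup>+z'. ennreal ((f z')\<^sup>2) \<partial>K s z) \<noteq> \<infinity>"
    using fm s by (intro nn_integral_PInf_AE nn_integral_K_measurable) auto
  then show ?thesis
  proof (rule AE_mp, intro AE_I2 impI)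
    fix z assume "z \<in> space P" and fin: "(\<integral>\<^sup>+z'. ennreal ((f z')\<^sup>2) \<partial>K s z) \<noteq> \<infinity>"
    then have z: "z \<in> M" by (simp add: space_P)
    have "f \<in> borel_measurable (K s z)" using fm by (simp add: measurable_K[OF s z])
    then show "f \<in> L2 (K s z)"
      using fin by (auto simp: L2_def top.not_eq_extremum intro!: integrableI_bounded)
  qed
qed

text \<open>Jensen's inequality for the probability measure \<open>K s z\<close>, in the form
  \<open>L1_le_L2\<close>. Integrated with stationarity, it makes \<open>T s\<close> a
  contraction.\<close>

lemma T_square_le:
  assumes f: "f \<in> L2 P" and s: "0 \<le> s"
  shows "AE z in P. ennreal ((T s f z)\<^sup>2) \<le> (\<integral>\<^sup>+z'. ennreal ((f z')\<^sup>2) \<partial>K s z)"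
  using AE_K_L2[OF f s]
proof (rule AE_mp, intro AE_I2 impI)
  fix z assume "z \<in> space P" and L: "f \<in> L2 (K s z)"
  then interpret K: prob_space "K s z" using K_space(1)[OF s] by (simp add: space_P)
  have "\<bar>T s f z\<bar> \<le> (\<integral>x. \<bar>f x\<bar> \<partial>K s z)" unfolding transition_op_def by (rule integral_abs_bound)
  then have "\<bar>T s f z\<bar> \<le> L2_norm (K s z) f" using K.L1_le_L2[OF L] by simp
  then have "\<bar>T s f z\<bar>\<^sup>2 \<le> (L2_norm (K s z) f)\<^sup>2" by (intro power_mono) auto
  then show "ennreal ((T s f z)\<^sup>2) \<le> (\<integral>\<^sup>+z'. ennreal ((f z')\<^sup>2) \<partial>K s z)"
    unfolding nn_integral_L2[OF L] by (intro ennreal_leI) simp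
qed

lemma T_nn_integral_le:
  assumes f: "f \<in> L2 P" and s: "0 \<le> s"
  shows "(\<integral>\<^sup>+z. ennreal ((T s f z)\<^sup>2) \<partial>P) \<le> ennreal ((L2_norm P f)\<^sup>2)"
proof -
  have "(\<integral>\<^sup>+z. ennreal ((T s f z)\<^sup>2) \<partial>P) \<le> (\<integral>\<^sup>+z. (\<integral>\<^sup>+z'. ennreal ((f z')\<^sup>2) \<partial>K s z) \<partial>P)"
    by (rule nn_integral_mono_AE[OF T_square_le[OF f s]])
  also have "\<dots> = ennreal ((L2_norm P f)\<^sup>2)"
    using L2_measurable_M[OF f] s nn_integral_L2[OF f] by (subst nn_integral_stationary) auto
  finally show ?thesis .
qed

lemma T_L2:
  assumes f: "f \<in> L2 P" and s: "0 \<le> s"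
  shows "T s f \<in> L2 P"
proof -
  have Tm: "T s f \<in> borel_measurable P" using T_measurable[OF L2_measurable_M[OF f] s] .
  have "integrable P (\<lambda>z. (T s f z)\<^sup>2)"
    using Tm T_nn_integral_le[OF f s]
    by (intro integrableI_bounded) (auto intro: le_less_trans)
  with Tm show ?thesis by (simp add: L2_def)
qed

lemma T_contraction:
  assumes f: "f \<in> L2 P" and s: "0 \<le> s"
  shows "L2_norm P (T s f) \<le> L2_norm P f"
proof (rule power2_le_imp_le)
  show "(L2_norm P (T s f))\<^sup>2 \<le> (L2_norm P f)\<^sup>2"
    using T_nn_integral_le[OF f s] nn_integral_L2[OF T_L2[OF f s]] by simp
qed (rule L2_norm_nonneg)

lemma AE_T_add:
  assumes f: "f \<in> L2 P" and g: "g \<in> L2 P" and s: "0 \<le> s"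
  shows "AE z in P. T s (\<lambda>x. f x + g x) z = T s f z + T s g z"
  using AE_K_L2[OF f s] AE_K_L2[OF g s]
proof (rule AE_mp[OF AE_conjI], intro AE_I2 impI)
  fix z assume "z \<in> space P" and L: "f \<in> L2 (K s z) \<and> g \<in> L2 (K s z)"
  then interpret K: prob_space "K s z" using K_space(1)[OF s] by (simp add: space_P)
  show "T s (\<lambda>x. f x + g x) z = T s f z + T s g z"
    using L L2_integrable[OF K.finite_measure_axioms] by (simp add: transition_op_def)
qed

lemma T_cmult: "T s (\<lambda>x. a * f x) z = a * T s f z"
  by (simp add: transition_op_def)

lemma inner_T_add:
  assumes "w \<in> L2 P" "f \<in> L2 P" "g \<in> L2 P" "0 \<le> s"
  shows "L2_inner P w (T s (\<lambda>x. f x + g x)) = L2_inner P w (T s f) + L2_inner P w (T s g)"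
proof -
  have "L2_inner P w (T s (\<lambda>x. f x + g x)) = L2_inner P w (\<lambda>z. T s f z + T s g z)"
    using assms by (intro L2_inner_cong_AE T_L2 L2_add AE_T_add)
  then show ?thesis using assms by (simp add: L2_inner_add_right T_L2)
qed

lemma inner_T_cmult: "L2_inner P w (T s (\<lambda>x. a * f x)) = a * L2_inner P w (T s f)"
proof -
  have "T s (\<lambda>x. a * f x) = (\<lambda>z. a * T s f z)" by (rule ext) (rule T_cmult)
  then show ?thesis by (simp add: L2_inner_cmult_right)
qed

lemma inner_T_diff:
  assumes "w \<in> L2 P" "f \<in> L2 P" "g \<in> L2 P" "0 \<le> s"
  shows "L2_inner P w (T s (\<lambda>x. f x - g x)) = L2_inner P w (T s f) - L2_inner P w (T s g)"
  using inner_T_add[of w f "\<lambda>x. (-1) * g x" s] L2_cmult[of g P "-1"] inner_T_cmult[of w s "-1" g] assms by simp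

lemma abs_inner_T_le:
  assumes "w \<in> L2 P" "f \<in> L2 P" "0 \<le> s"
  shows "\<bar>L2_inner P w (T s f)\<bar> \<le> L2_norm P w * L2_norm P f"
  using abs_L2_inner_le[OF assms(1) T_L2[OF assms(2,3)]]
    mult_left_mono[OF T_contraction[OF assms(2,3)] L2_norm_nonneg[of P w]] by simp

text \<open>Lebesgue measure on a bounded time interval as a finite measure space of its own, ready
  to be paired with \<open>P\<close> in Fubini's theorem.\<close>

definition timeline :: "real \<Rightarrow> real measure" where
  "timeline s = restrict_space lborel {0..s}"

lemma finite_timeline: "finite_measure (timeline s)"
  by (rule finite_measureI)
    (simp add: timeline_def space_restrict_space emeasure_restrict_space emeasure_lborel_Icc_eq)

lemma space_timeline: "space (timeline s) = {0..s}"
  by (simp add: timeline_def space_restrict_space)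

lemma T_joint_measurable:
  assumes "f \<in> borel_measurable (borel_of M)"
  shows "(\<lambda>(r, z). T r f z) \<in> borel_measurable (timeline s \<Otimes>\<^sub>M P)"
proof -
  let ?P = "restrict_space borel {0::real..} \<Otimes>\<^sub>M borel_of M"
  have "(\<lambda>x. integral\<^sup>L (case x of (r, z) \<Rightarrow> K r z) f) \<in> borel_measurable ?P"
    by (rule measurable_compose[OF measurable_prob_algebraD[OF langevin_kernels_jointly_measurable[OF closed_M kernels]]
          integral_measurable_subprob_algebra[OF assms]])
  moreover have "(\<lambda>x. (fst x, snd x)) \<in> timeline s \<Otimes>\<^sub>M P \<rightarrow>\<^sub>M ?P"
  proof (rule measurable_Pair)
    have f: "fst \<in> timeline s \<Otimes>\<^sub>M P \<rightarrow>\<^sub>M timeline s" by (rule measurable_fst)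
    have "(\<lambda>r. r) \<in> timeline s \<rightarrow>\<^sub>M restrict_space borel {0..}"
      unfolding timeline_def
      by (intro measurable_restrict_space2 measurable_restrict_space1) (auto simp: space_restrict_space)
    from measurable_compose[OF f this]
    show "fst \<in> timeline s \<Otimes>\<^sub>M P \<rightarrow>\<^sub>M restrict_space borel {0..}" by simp
    show "snd \<in> timeline s \<Otimes>\<^sub>M P \<rightarrow>\<^sub>M borel_of M"
      using measurable_snd[of "timeline s" P] measurable_cong_sets[OF refl sets_P] by blast
  qed
  ultimately have "(\<lambda>x. integral\<^sup>L (case (fst x, snd x) of (r, z) \<Rightarrow> K r z) f) \<in> borel_measurable (timeline s \<Otimes>\<^sub>M P)"
    by (rule measurable_compose[rotated])
  then show ?thesis by (simp add: transition_op_def case_prod_beta)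
qed

lemma inner_T_integrable:
  assumes w: "w \<in> L2 P" and f: "f \<in> L2 P"
  shows "integrable (timeline s) (\<lambda>r. L2_inner P w (T r f))"
proof -
  interpret t: finite_measure "timeline s" by (rule finite_timeline)
  have wm: "(\<lambda>x. w (snd x)) \<in> borel_measurable (timeline s \<Otimes>\<^sub>M P)"
    by (rule measurable_compose[OF measurable_snd L2_measurable[OF w]])
  have "(\<lambda>(r, z). w z * T r f z) \<in> borel_measurable (timeline s \<Otimes>\<^sub>M P)"
    using borel_measurable_times[OF wm T_joint_measurable[OF L2_measurable_M[OF f]]]
    by (simp add: case_prod_beta)
  then have "(\<lambda>r. L2_inner P w (T r f)) \<in> borel_measurable (timeline s)"
    unfolding L2_inner_def by (rule P.borel_measurable_lebesgue_integral)
  moreover have "AE r in timeline s. norm (L2_inner P w (T r f)) \<le> L2_norm P w * L2_norm P f"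
    using abs_inner_T_le[OF w f] by (intro AE_I2) (simp add: space_timeline)
  ultimately show ?thesis by (intro t.integrable_const_bound) auto
qed

lemma test_function_L2:
  assumes f: "test_function M f"
  shows "f \<in> L2 P"
proof -
  obtain B where B: "\<And>x. x \<in> M \<Longrightarrow> \<bar>f x\<bar> \<le> B" using test_function_bounded[OF f] by blast
  have fm: "f \<in> borel_measurable P" using test_function_measurable[OF f] by (simp add: measurable_P)
  have "(f x)\<^sup>2 \<le> B\<^sup>2" if "x \<in> M" for x
    using power_mono[OF B[OF that], of 2] by simp
  then have "integrable P (\<lambda>x. (f x)\<^sup>2)"
    using fm by (intro P.integrable_const_bound[of _ "B\<^sup>2"]) (auto simp: space_P)
  with fm show ?thesis by (simp add: L2_def)
qed

text \<open>The pointwise formula is multiplied by \<open>w\<close>, integrated, and the integrals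
  are exchanged. The time integral in \<open>langevin_kernels\<close> is a gauge integral; Fubini's
  theorem supplies Lebesgue integrability in time for almost every starting point, and this
  identifies the two integrals.\<close>

lemma dynkin_test_function:
  assumes f: "test_function M f" and u: "weighted_laplacian M p f \<in> L2 P"
    and w: "w \<in> L2 P" and s: "0 \<le> s"
  shows "L2_inner P w (T s f) - L2_inner P w f =
    (\<integral>r. L2_inner P w (T r (weighted_laplacian M p f)) \<partial>timeline s)"
proof -
  let ?u = "weighted_laplacian M p f"
  interpret t: finite_measure "timeline s" by (rule finite_timeline)
  interpret pr: pair_sigma_finite "timeline s" P ..
  define h where "h r z = w z * T r ?u z" for r z
  have fL: "f \<in> L2 P" by (rule test_function_L2[OF f])
  have wm: "(\<lambda>x. w (snd x)) \<in> borel_measurable (timeline s \<Otimes>\<^sub>M P)"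
    by (rule measurable_compose[OF measurable_snd L2_measurable[OF w]])
  have hm: "(\<lambda>(r, z). h r z) \<in> borel_measurable (timeline s \<Otimes>\<^sub>M P)"
    using borel_measurable_times[OF wm T_joint_measurable[OF L2_measurable_M[OF u]]]
    by (simp add: case_prod_beta h_def)
  have h_abs: "(\<integral>z. \<bar>h r z\<bar> \<partial>P) \<le> L2_norm P w * L2_norm P ?u" if r: "0 \<le> r" for r
  proof -
    have abs: "(\<lambda>z. \<bar>g z\<bar>) \<in> L2 P" "L2_norm P (\<lambda>z. \<bar>g z\<bar>) = L2_norm P g" if "g \<in> L2 P" for g
      using that by (auto simp: L2_def L2_norm_def)
    have "\<bar>L2_inner P (\<lambda>z. \<bar>w z\<bar>) (\<lambda>z. \<bar>T r ?u z\<bar>)\<bar> \<le> L2_norm P w * L2_norm P (T r ?u)"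
      using abs_L2_inner_le[OF abs(1)[OF w] abs(1)[OF T_L2[OF u r]]] abs(2)[OF w] abs(2)[OF T_L2[OF u r]] by simp
    also have "\<dots> \<le> L2_norm P w * L2_norm P ?u"
      by (intro mult_left_mono T_contraction u r L2_norm_nonneg)
    finally show ?thesis by (simp add: L2_inner_def h_def abs_mult)
  qed
  have int: "integrable (timeline s \<Otimes>\<^sub>M P) (\<lambda>(r, z). h r z)"
  proof (rule pr.Fubini_integrable[OF hm])
    have "(\<lambda>(r, z). \<bar>h r z\<bar>) \<in> borel_measurable (timeline s \<Otimes>\<^sub>M P)"
      using borel_measurable_abs[OF hm] by (simp add: case_prod_beta)
    then have "(\<lambda>r. \<integral>z. \<bar>h r z\<bar> \<partial>P) \<in> borel_measurable (timeline s)"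
      by (rule P.borel_measurable_lebesgue_integral)
    then have "integrable (timeline s) (\<lambda>r. \<integral>z. \<bar>h r z\<bar> \<partial>P)"
      using h_abs by (intro t.integrable_const_bound[of _ "L2_norm P w * L2_norm P ?u"])
        (auto simp: space_timeline intro!: AE_I2)
    then show "integrable (timeline s) (\<lambda>r. \<integral>z. norm (case (r, z) of (r, z) \<Rightarrow> h r z) \<partial>P)" by simp
    show "AE r in timeline s. integrable P (\<lambda>z. case (r, z) of (r, z) \<Rightarrow> h r z)"
      using L2_mult_integrable[OF w T_L2[OF u]] by (intro AE_I2) (simp add: space_timeline h_def)
  qed
  have inner: "AE z in P. (\<integral>r. h r z \<partial>timeline s) = w z * (T s f z - f z)"
    using pr.AE_integrable_snd[OF int]
  proof (rule AE_mp, intro AE_I2 impI)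
    fix z assume z: "z \<in> space P" and i: "integrable (timeline s) (\<lambda>r. h r z)"
    show "(\<integral>r. h r z \<partial>timeline s) = w z * (T s f z - f z)"
    \<comment> \<open>Integrability of the product with \<open>w z\<close> says nothing about the
      transition itself where \<open>w\<close> vanishes, but there both sides are 0.\<close>
    proof (cases "w z = 0")
      case True
      then show ?thesis by (simp add: h_def)
    next
      case False
      then have i: "integrable (timeline s) (\<lambda>r. T r ?u z)" using i by (simp add: h_def)
      then have si: "set_integrable lborel {0..s} (\<lambda>r. T r ?u z)"
        unfolding timeline_def set_integrable_def by (subst (asm) integrable_restrict_space) auto
      have "(\<integral>r. T r ?u z \<partial>timeline s) = (LINT r:{0..s}|lborel. T r ?u z)"
        unfolding timeline_def set_lebesgue_integral_def by (subst integral_restrict_space) auto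
      also have "\<dots> = integral {0..s} (\<lambda>r. T r ?u z)" by (rule set_borel_integral_eq_integral(2)[OF si])
      also have "\<dots> = T s f z - f z"
        using kernels f z s by (intro integral_unique) (auto simp: langevin_kernels_def space_P)
      finally show ?thesis by (simp add: h_def)
    qed
  qed
  have "(\<integral>r. L2_inner P w (T r ?u) \<partial>timeline s) = (\<integral>r. (\<integral>z. h r z \<partial>P) \<partial>timeline s)"
    by (simp add: L2_inner_def h_def)
  also have "\<dots> = (\<integral>z. (\<integral>r. h r z \<partial>timeline s) \<partial>P)"
    by (rule pr.Fubini_integral[OF int, symmetric])
  also have "\<dots> = (\<integral>z. w z * (T s f z - f z) \<partial>P)"
  proof (rule integral_cong_AE)
    show "(\<lambda>z. \<integral>r. h r z \<partial>timeline s) \<in> borel_measurable P"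
      using t.borel_measurable_lebesgue_integral[of "\<lambda>z r. h r z" P]
        measurable_pair_swap[OF hm] by (simp add: case_prod_beta)
    show "(\<lambda>z. w z * (T s f z - f z)) \<in> borel_measurable P"
      using L2_measurable[OF w] L2_measurable[OF T_L2[OF fL s]] L2_measurable[OF fL] by simp
  qed (rule inner)
  also have "\<dots> = L2_inner P w (T s f) - L2_inner P w f"
    using L2_inner_diff_right[OF w T_L2[OF fL s] fL] by (simp add: L2_inner_def)
  finally show ?thesis by simp
qed


lemma A_iff: "(f, g) \<in> A \<longleftrightarrow> f \<in> L2 P \<and> g \<in> L2 P \<and> (\<forall>(u, v)\<in>A. L2_inner P f v = L2_inner P g u)"
proof -
  have "A = adjoint_graph P A" using self_adjoint by (simp add: self_adjoint_def)
  then have "(f, g) \<in> A \<longleftrightarrow> (f, g) \<in> adjoint_graph P A" by (rule arg_cong)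
  also have "\<dots> \<longleftrightarrow> f \<in> L2 P \<and> g \<in> L2 P \<and> (\<forall>(u, v)\<in>A. L2_inner P f v = L2_inner P g u)"
    unfolding adjoint_graph_def L2_inner_def by simp
  finally show ?thesis .
qed

lemma A_dense: "f \<in> L2 P \<Longrightarrow> 0 < e \<Longrightarrow> \<exists>(u, v)\<in>A. L2_norm P (\<lambda>x. f x - u x) < e"
  using self_adjoint unfolding self_adjoint_def by blast

(* The L2 distance in the definition of the generator is 0 whenever the integral diverges. Were the
   image of a test function f not square integrable, f would be paired with (nearly) every element of
   L2 in the graph, and symmetry would force the domain to consist of null functions. *)
lemma weighted_laplacian_L2:
  assumes f: "test_function M f"
  shows "weighted_laplacian M p f \<in> L2 P"
proof (rule ccontr)
  let ?X = "weighted_laplacian M p f"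
  assume notL2: "?X \<notin> L2 P"
  \<comment> \<open>Failure of measurability is included, as nothing is known yet about the
    measurability of \<open>?X\<close>.\<close>
  define bad where "bad g \<longleftrightarrow> g \<in> L2 P \<and> \<not> integrable P (\<lambda>x. (- ?X x - g x)\<^sup>2)" for g
  have bad_A: "(f, g) \<in> A" if "bad g" for g
  proof -
    have "L2_norm P (\<lambda>x. - ?X x - g x) = 0"
      using that by (simp add: bad_def L2_norm_def not_integrable_integral_eq)
    moreover have "L2_norm P (\<lambda>x. f x - f x) = 0" by (simp add: L2_norm_def)
    ultimately show ?thesis
      using f test_function_L2[OF f] that unfolding neg_generator_def bad_def
      by (auto intro!: exI[of _ "\<lambda>_. f"])
  qed
  \<comment> \<open>If both squares were integrable, \<open>- ?X x - g x\<close> could be solved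
    for, being linear in the difference of the squares. Division by \<open>2 * w x\<close> is safe
    since \<open>w\<close> is at least 1, and the solution also makes \<open>?X\<close>
    measurable.\<close>
  have alternative: "bad g \<or> bad (\<lambda>x. g x + w x)"
    if g: "g \<in> L2 P" and w: "w \<in> L2 P" and w1: "\<And>x. 1 \<le> w x" for g w
  proof (rule ccontr)
    assume "\<not> ?thesis"
    then have i: "integrable P (\<lambda>x. (- ?X x - g x)\<^sup>2)" "integrable P (\<lambda>x. (- ?X x - (g x + w x))\<^sup>2)"
      using g L2_add[OF g w] by (auto simp: bad_def)
    have wm: "w \<in> borel_measurable P" and gm: "g \<in> borel_measurable P"
      using w g L2_measurable by auto
    have "(\<lambda>x. ((- ?X x - g x)\<^sup>2 - (- ?X x - (g x + w x))\<^sup>2 + (w x)\<^sup>2) / (2 * w x)) \<in> borel_measurable P"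
      using i wm by (intro borel_measurable_divide borel_measurable_add borel_measurable_diff) auto
    moreover have "((- ?X x - g x)\<^sup>2 - (- ?X x - (g x + w x))\<^sup>2 + (w x)\<^sup>2) / (2 * w x) = - ?X x - g x" for x
      using w1[of x] by (simp add: power2_eq_square field_simps)
    ultimately have "(\<lambda>x. - ?X x - g x) \<in> L2 P" using i(1) by (simp add: L2_def)
    from L2_cmult[OF L2_add[OF this g], of "-1"] notL2 show False by simp
  qed
  have null: "L2_norm P u = 0" if uv: "(u, v) \<in> A" for u v
  proof -
    have uL: "u \<in> L2 P" using uv A_iff by blast
    have const: "L2_inner P u g = L2_inner P v f" if "bad g" for g
      using uv bad_A[OF that] A_iff by blast
    \<comment> \<open>Start from a bad \<open>g\<close>. Of \<open>g + w\<close> and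
      \<open>g + 2 w\<close> at least one is bad, and pairing with \<open>u\<close> has the same
      value on all bad functions; so the inner product of \<open>u\<close> and \<open>w\<close>, or
      its double, is 0.\<close>
    have orth: "L2_inner P u w = 0" if w: "w \<in> L2 P" and w1: "\<And>x. 1 \<le> w x" for w
    proof -
      have "bad (\<lambda>x. 0) \<or> bad (\<lambda>x. 0 + 1)"
        by (rule alternative) (auto intro: L2_const[OF P.finite_measure_axioms])
      then obtain g where g: "bad g" by blast
      then have gL: "g \<in> L2 P" by (simp add: bad_def)
      have g1: "L2_inner P u (\<lambda>x. g x + w x) = L2_inner P u g + L2_inner P u w"
        using uL gL w by (rule L2_inner_add_right)
      have g2: "L2_inner P u (\<lambda>x. (g x + w x) + w x) = L2_inner P u (\<lambda>x. g x + w x) + L2_inner P u w"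
        by (rule L2_inner_add_right[OF uL L2_add[OF gL w] w])
      from alternative[OF L2_add[OF gL w] w w1] show ?thesis
        using g1 g2 const[OF g] const by fastforce
    qed
    \<comment> \<open>\<open>u\<close> is the difference of \<open>2 + \<bar>u\<bar> + u\<close> and
      \<open>2 + \<bar>u\<bar>\<close>, both of which are at least 1.\<close>
    have w: "(\<lambda>x. 2 + \<bar>u x\<bar>) \<in> L2 P"
    proof (rule L2_add[OF L2_const])
      show "(\<lambda>x. \<bar>u x\<bar>) \<in> L2 P" using uL by (auto simp: L2_def)
    qed (rule P.finite_measure_axioms)
    have "L2_inner P u (\<lambda>x. (2 + \<bar>u x\<bar>) + u x) = L2_inner P u (\<lambda>x. 2 + \<bar>u x\<bar>) + L2_inner P u u"
      by (rule L2_inner_add_right[OF uL w uL])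
    moreover have "L2_inner P u (\<lambda>x. (2 + \<bar>u x\<bar>) + u x) = 0"
      by (rule orth[OF L2_add[OF w uL]]) (simp add: abs_if)
    moreover have "L2_inner P u (\<lambda>x. 2 + \<bar>u x\<bar>) = 0" by (rule orth[OF w]) simp
    ultimately have "L2_inner P u u = 0" by simp
    then show ?thesis by (simp add: L2_norm_def L2_inner_def power2_eq_square)
  qed
  have one: "(\<lambda>x. 1) \<in> L2 P" by (rule L2_const[OF P.finite_measure_axioms])
  obtain u v where uv: "(u, v) \<in> A" "L2_norm P (\<lambda>x. 1 - u x) < 1" using A_dense[OF one, of 1] by auto
  have uL: "u \<in> L2 P" using uv A_iff by blast
  have "AE x in P. u x = 0" using null[OF uv(1)] L2_norm_eq_0[OF uL] by simp
  then have "(\<integral>x. (1 - u x)\<^sup>2 \<partial>P) = (\<integral>x. 1 \<partial>P)"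
    using L2_measurable[OF uL] by (intro integral_cong_AE) auto
  then show False using uv(2) by (simp add: L2_norm_def P.prob_space)
qed

text \<open>Both sides are continuous in the graph norm: the left by contractivity, the right
  likewise with the length of the time interval as a factor. The sign appears because
  \<open>A\<close> is the negative of the generator.\<close>

lemma dynkin:
  assumes fg: "(f, g) \<in> A" and w: "w \<in> L2 P" and s: "0 \<le> s"
  shows "L2_inner P w (T s f) - L2_inner P w f = - (\<integral>r. L2_inner P w (T r g) \<partial>timeline s)"
proof -
  interpret t: finite_measure "timeline s" by (rule finite_timeline)
  have fL: "f \<in> L2 P" and gL: "g \<in> L2 P" using fg A_iff by blast+
  obtain \<phi> where \<phi>: "\<And>n. test_function M (\<phi> n)"
    and lim1: "(\<lambda>n. L2_norm P (\<lambda>x. \<phi> n x - f x)) \<longlonglongrightarrow> 0"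
    and lim2: "(\<lambda>n. L2_norm P (\<lambda>x. - weighted_laplacian M p (\<phi> n) x - g x)) \<longlonglongrightarrow> 0"
    using fg unfolding neg_generator_def by auto
  define u where "u n = weighted_laplacian M p (\<phi> n)" for n
  have uL: "u n \<in> L2 P" for n unfolding u_def by (rule weighted_laplacian_L2[OF \<phi>])
  have \<phi>L: "\<phi> n \<in> L2 P" for n by (rule test_function_L2[OF \<phi>])
  have T_lim: "(\<lambda>n. L2_inner P w (T s (\<phi> n))) \<longlonglongrightarrow> L2_inner P w (T s f)"
  proof (rule LIM_zero_cancel, rule Lim_null_comparison)
    show "\<forall>\<^sub>F n in sequentially. norm (L2_inner P w (T s (\<phi> n)) - L2_inner P w (T s f)) \<le>
        L2_norm P w * L2_norm P (\<lambda>x. \<phi> n x - f x)"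
      using abs_inner_T_le[OF w L2_diff[OF \<phi>L fL] s] inner_T_diff[OF w \<phi>L fL s] by simp
  qed (rule tendsto_mult_right_zero[OF lim1])
  have lim: "(\<lambda>n. L2_inner P w (\<phi> n)) \<longlonglongrightarrow> L2_inner P w f"
  proof (rule LIM_zero_cancel, rule Lim_null_comparison)
    show "\<forall>\<^sub>F n in sequentially. norm (L2_inner P w (\<phi> n) - L2_inner P w f) \<le>
        L2_norm P w * L2_norm P (\<lambda>x. \<phi> n x - f x)"
      using abs_L2_inner_le[OF w L2_diff[OF \<phi>L fL]] L2_inner_diff_right[OF w \<phi>L fL] by simp
  qed (rule tendsto_mult_right_zero[OF lim1])
  define c where "c = measure (timeline s) (space (timeline s))"
  have int_lim: "(\<lambda>n. \<integral>r. L2_inner P w (T r (u n)) \<partial>timeline s) \<longlonglongrightarrow> - (\<integral>r. L2_inner P w (T r g) \<partial>timeline s)"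
  proof (rule LIM_zero_cancel, rule Lim_null_comparison)
    have "norm ((\<integral>r. L2_inner P w (T r (u n)) \<partial>timeline s) - (- (\<integral>r. L2_inner P w (T r g) \<partial>timeline s)))
        \<le> L2_norm P w * L2_norm P (\<lambda>x. - u n x - g x) * c" for n
    proof -
      have "(\<integral>r. L2_inner P w (T r (u n)) \<partial>timeline s) - (- (\<integral>r. L2_inner P w (T r g) \<partial>timeline s))
          = (\<integral>r. L2_inner P w (T r (u n)) + L2_inner P w (T r g) \<partial>timeline s)"
        using inner_T_integrable[OF w uL] inner_T_integrable[OF w gL] by simp
      moreover have "norm (\<integral>r. L2_inner P w (T r (u n)) + L2_inner P w (T r g) \<partial>timeline s)
          \<le> (\<integral>r. L2_norm P w * L2_norm P (\<lambda>x. - u n x - g x) \<partial>timeline s)"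
      proof (rule Bochner_Integration.integral_norm_bound_integral)
        show "integrable (timeline s) (\<lambda>r. L2_inner P w (T r (u n)) + L2_inner P w (T r g))"
          using inner_T_integrable[OF w uL] inner_T_integrable[OF w gL] by simp
        fix r assume "r \<in> space (timeline s)"
        then have r: "0 \<le> r" by (simp add: space_timeline)
        have "L2_norm P (\<lambda>x. - u n x - g x) = L2_norm P (\<lambda>x. u n x + g x)"
          using L2_norm_minus[of P "\<lambda>x. u n x + g x"] by simp
        then show "norm (L2_inner P w (T r (u n)) + L2_inner P w (T r g))
            \<le> L2_norm P w * L2_norm P (\<lambda>x. - u n x - g x)"
          using abs_inner_T_le[OF w L2_add[OF uL gL] r, of n] inner_T_add[OF w uL gL r, of n] by simp
      qed (rule t.integrable_const)
      ultimately show ?thesis by (simp add: c_def ac_simps)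
    qed
    then show "\<forall>\<^sub>F n in sequentially. norm ((\<integral>r. L2_inner P w (T r (u n)) \<partial>timeline s) -
        (- (\<integral>r. L2_inner P w (T r g) \<partial>timeline s))) \<le> L2_norm P w * L2_norm P (\<lambda>x. - u n x - g x) * c" by simp
    show "(\<lambda>n. L2_norm P w * L2_norm P (\<lambda>x. - u n x - g x) * c) \<longlonglongrightarrow> 0"
      using lim2 unfolding u_def by (intro tendsto_mult_left_zero tendsto_mult_right_zero)
  qed
  have "L2_inner P w (T s (\<phi> n)) - L2_inner P w (\<phi> n) = (\<integral>r. L2_inner P w (T r (u n)) \<partial>timeline s)" for n
    unfolding u_def by (rule dynkin_test_function[OF \<phi> weighted_laplacian_L2[OF \<phi>] w s])
  then show ?thesis using LIMSEQ_unique[OF tendsto_diff[OF T_lim lim]] int_lim by simp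
qed

lemma timeline_has_integral:
  assumes "integrable (timeline s) (f :: real \<Rightarrow> real)"
  shows "(f has_integral (\<integral>r. f r \<partial>timeline s)) {0..s}"
proof -
  have si: "set_integrable lborel {0..s} f"
    using assms unfolding timeline_def set_integrable_def by (subst (asm) integrable_restrict_space) auto
  have "(\<integral>r. f r \<partial>timeline s) = (LINT r:{0..s}|lborel. f r)"
    unfolding timeline_def set_lebesgue_integral_def by (subst integral_restrict_space) auto
  then show ?thesis
    using integrable_integral[OF set_borel_integral_eq_integral(1)[OF si]]
      set_borel_integral_eq_integral(2)[OF si] by simp
qed

lemma K_0: "z \<in> M \<Longrightarrow> f \<in> borel_measurable (borel_of M) \<Longrightarrow> T 0 f z = f z"
  using kernels by (simp add: langevin_kernels_def transition_op_def integral_return space_restrict_space)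

text \<open>Paired with any \<open>w\<close>, Dynkin's formula becomes a scalar integral equation
  with rate \<open>- \<mu>\<close>.\<close>

lemma eigenfunction_decay:
  assumes f: "(f, \<lambda>x. \<mu> * f x) \<in> A" and s: "0 \<le> s"
  shows "AE z in P. T s f z = exp (- \<mu> * s) * f z"
proof -
  have fL: "f \<in> L2 P" using f A_iff by blast
  show ?thesis
  proof (rule L2_eq_AE_if_inner_eq)
    fix w assume w: "w \<in> L2 P"
    have T0: "L2_inner P w (T 0 f) = L2_inner P w f"
      using w fL T_L2[OF fL] K_0[OF _ L2_measurable_M[OF fL]]
      by (intro L2_inner_cong_AE AE_I2) (auto simp: space_P)
    have "L2_inner P w (T s f) = exp (- \<mu> * s) * L2_inner P w (T 0 f)"
    proof (rule exponential_integral_equation[OF _ _ s])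
      show "((\<lambda>r. L2_inner P w (T r f)) has_integral (\<integral>r. L2_inner P w (T r f) \<partial>timeline s)) {0..s}" for s
        by (rule timeline_has_integral[OF inner_T_integrable[OF w fL]])
      show "L2_inner P w (T s f) = L2_inner P w (T 0 f) + - \<mu> * (\<integral>r. L2_inner P w (T r f) \<partial>timeline s)"
        if "0 \<le> s" for s
        using dynkin[OF f w that] by (simp add: T0 inner_T_cmult)
    qed
    then show "L2_inner P w (T s f) = L2_inner P w (\<lambda>z. exp (- \<mu> * s) * f z)"
      by (simp add: L2_inner_cmult_right T0)
  qed (use fL s T_L2 L2_cmult in auto)
qed

lemma transition_nonneg:
  assumes g: "integrable P g" and g0: "\<And>z. 0 \<le> g z" and s: "0 \<le> s"
  shows "(\<integral>z. T s g z \<partial>P) = (\<integral>z. g z \<partial>P)" "integrable P (T s g)" "AE z in P. integrable (K s z) g"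
proof -
  have gm: "g \<in> borel_measurable (borel_of M)" using borel_measurable_integrable[OF g] by (simp add: measurable_P)
  have eq: "(\<integral>\<^sup>+z. (\<integral>\<^sup>+z'. ennreal (g z') \<partial>K s z) \<partial>P) = ennreal (\<integral>z. g z \<partial>P)"
    using gm s nn_integral_eq_integral[OF g] g0 by (subst nn_integral_stationary) auto
  then have "AE z in P. (\<integral>\<^sup>+z'. ennreal (g z') \<partial>K s z) \<noteq> \<infinity>"
    using gm s by (intro nn_integral_PInf_AE nn_integral_K_measurable) auto
  then have i: "AE z in P. integrable (K s z) g"
  proof (rule AE_mp, intro AE_I2 impI)
    fix z assume "z \<in> space P" "(\<integral>\<^sup>+z'. ennreal (g z') \<partial>K s z) \<noteq> \<infinity>"
    then show "integrable (K s z) g"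
      using gm g0 by (intro integrableI_nonneg) (auto simp: measurable_K[OF s] space_P top.not_eq_extremum)
  qed
  then have "(\<integral>\<^sup>+z. ennreal (T s g z) \<partial>P) = (\<integral>\<^sup>+z. (\<integral>\<^sup>+z'. ennreal (g z') \<partial>K s z) \<partial>P)"
    using g0 by (intro nn_integral_cong_AE) (auto simp: transition_op_def nn_integral_eq_integral)
  then have nn: "(\<integral>\<^sup>+z. ennreal (T s g z) \<partial>P) = ennreal (\<integral>z. g z \<partial>P)" using eq by simp
  have T0: "0 \<le> T s g z" for z using g0 by (simp add: transition_op_def)
  have Ti: "integrable P (T s g)"
    using T_measurable[OF gm s] nn T0 by (intro integrableI_nonneg) auto
  have "ennreal (\<integral>z. T s g z \<partial>P) = ennreal (\<integral>z. g z \<partial>P)"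
    using nn nn_integral_eq_integral[OF Ti] T0 by simp
  then show "(\<integral>z. T s g z \<partial>P) = (\<integral>z. g z \<partial>P)" using T0 g0 by simp
  show "integrable P (T s g)" "AE z in P. integrable (K s z) g" by fact+
qed

lemma integral_stationary:
  assumes f: "integrable P f" and s: "0 \<le> s"
  shows "(\<integral>z. T s f z \<partial>P) = (\<integral>z. f z \<partial>P)"
proof -
  have fm: "f \<in> borel_measurable (borel_of M)" using borel_measurable_integrable[OF f] by (simp add: measurable_P)
  let ?g = "\<lambda>z. max 0 (f z)" and ?h = "\<lambda>z. max 0 (- f z)"
  have gi: "integrable P ?g" and hi: "integrable P ?h" using f by auto
  have "AE z in P. T s f z = T s ?g z - T s ?h z"
    using transition_nonneg(3)[OF gi _ s] transition_nonneg(3)[OF hi _ s]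
  proof (rule AE_mp[OF AE_conjI], simp_all, intro AE_I2 impI)
    fix z assume i: "integrable (K s z) ?g \<and> integrable (K s z) ?h"
    have "T s f z = (\<integral>x. ?g x - ?h x \<partial>K s z)"
      unfolding transition_op_def by (intro Bochner_Integration.integral_cong) auto
    then show "T s f z = T s ?g z - T s ?h z" using i by (simp add: transition_op_def)
  qed
  then have "(\<integral>z. T s f z \<partial>P) = (\<integral>z. T s ?g z - T s ?h z \<partial>P)"
    using T_measurable[OF fm s] fm s by (intro integral_cong_AE borel_measurable_diff T_measurable) auto
  also have "\<dots> = (\<integral>z. ?g z \<partial>P) - (\<integral>z. ?h z \<partial>P)"
    using transition_nonneg(1,2)[OF gi _ s] transition_nonneg(1,2)[OF hi _ s] by simp
  also have "\<dots> = (\<integral>z. ?g z - ?h z \<partial>P)" using gi hi by simp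
  also have "\<dots> = (\<integral>z. f z \<partial>P)"
    by (intro Bochner_Integration.integral_cong) auto
  finally show ?thesis .
qed

text \<open>The constant 1 need not have compact support, so self-adjointness takes the place of
  approximation. In Dynkin's formula paired with 1, stationarity preserves every mean, so each
  \<open>v\<close> in the range of \<open>A\<close> has mean 0, which is orthogonality to 1.\<close>

lemma constant_in_kernel: "(\<lambda>x. 1, \<lambda>x. 0) \<in> A"
proof -
  have one: "(\<lambda>x. 1) \<in> L2 P" and zero: "(\<lambda>x. 0) \<in> L2 P" by (rule L2_const[OF P.finite_measure_axioms])+
  have T_mean: "L2_inner P (\<lambda>x. 1) (T s f) = L2_inner P (\<lambda>x. 1) f" if f: "f \<in> L2 P" and s: "0 \<le> s" for f s
    using integral_stationary[OF L2_integrable[OF P.finite_measure_axioms f] s] by (simp add: L2_inner_def)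
  have "L2_inner P (\<lambda>x. 1) v = 0" if uv: "(u, v) \<in> A" for u v
  proof -
    have uL: "u \<in> L2 P" and vL: "v \<in> L2 P" using uv A_iff by blast+
    have "0 = (\<integral>r. L2_inner P (\<lambda>x. 1) (T r v) \<partial>timeline 1)"
      using dynkin[OF uv one, of 1] T_mean[OF uL] by simp
    also have "\<dots> = (\<integral>r. L2_inner P (\<lambda>x. 1) v \<partial>timeline 1)"
      using T_mean[OF vL] by (intro Bochner_Integration.integral_cong) (auto simp: space_timeline)
    also have "\<dots> = L2_inner P (\<lambda>x. 1) v"
      by (simp add: timeline_def measure_restrict_space space_restrict_space)
    finally show ?thesis by simp
  qed
  moreover have "L2_inner P (\<lambda>x. 0) u = 0" for u by (simp add: L2_inner_def)
  ultimately show ?thesis using one zero by (subst A_iff) auto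
qed

end

section \<open>Riemannian volume of submanifolds\<close>

lemma continuous_on_det:
  fixes F :: "'a::topological_space \<Rightarrow> real^'n^'n"
  assumes "\<And>i j. continuous_on S (\<lambda>x. F x $ i $ j)"
  shows "continuous_on S (\<lambda>x. det (F x))"
  unfolding det_def by (intro continuous_intros assms)

(* The determinant does not vanish on the segment from the identity to the Gram matrix. *)
lemma det_gram_pos:
  fixes B :: "real^'m^'d"
  assumes inj: "inj ((*v) B)"
  shows "0 < det (transpose B ** B)"
proof (rule ccontr)
  assume neg: "\<not> ?thesis"
  define N where "N t = (1 - t) *\<^sub>R mat 1 + t *\<^sub>R (transpose B ** B)" for t :: real
  have Nv: "N t *v x = (1 - t) *\<^sub>R x + t *\<^sub>R (transpose B *v (B *v x))" for t x
    by (simp add: N_def matrix_vector_mult_add_rdistrib scaleR_matrix_vector_assoc[symmetric]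
        matrix_vector_mul_assoc)
  have "continuous_on {0..1} (\<lambda>t. det (N t))"
    unfolding N_def by (intro continuous_on_det) (auto intro!: continuous_intros)
  moreover have "det (N 0) = 1" "det (N 1) \<le> 0" using neg by (auto simp: N_def)
  ultimately obtain t where t: "0 \<le> t" "t \<le> 1" "det (N t) = 0"
    using IVT2'[of "\<lambda>t. det (N t)" 1 0 0] by auto
  then obtain x where x: "x \<noteq> 0" "N t *v x = 0"
    using invertible_det_nz[of "N t"] matrix_left_invertible_ker[of "N t"] invertible_left_inverse by blast
  have "0 = x \<bullet> (N t *v x)" using x by simp
  also have "\<dots> = (1 - t) * (x \<bullet> x) + t * ((B *v x) \<bullet> (B *v x))"
    unfolding Nv by (simp add: inner_right_distrib dot_lmul_matrix[symmetric] inner_commute)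
  finally have eq: "(1 - t) * (x \<bullet> x) + t * ((B *v x) \<bullet> (B *v x)) = 0" by simp
  have "B *v x \<noteq> 0" using inj x(1) injD[of "(*v) B" x 0] by auto
  then have "0 < (B *v x) \<bullet> (B *v x)" "0 < x \<bullet> x" using x(1) by auto
  then have "0 < (1 - t) * (x \<bullet> x) + t * ((B *v x) \<bullet> (B *v x))"
    using t(1,2) by (cases "t = 0") (auto intro!: add_nonneg_pos mult_pos_pos)
  with eq show False by simp
qed

abbreviation gram_density :: "(real^'m \<Rightarrow> real^'d) \<Rightarrow> real^'m \<Rightarrow> real" where
  "gram_density \<phi> x \<equiv> sqrt (det (transpose (matrix (frechet_derivative \<phi> (at x)))
      ** matrix (frechet_derivative \<phi> (at x))))"

lemma local_param_derivative:
  assumes "local_param M V \<phi>" "x \<in> V"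
  shows "(\<phi> has_derivative frechet_derivative \<phi> (at x)) (at x)"
proof -
  have "Ck_on (Suc 0) V \<phi>" using assms(1) by (simp add: local_param_def smooth_on_def del: Ck_on.simps)
  then show ?thesis using assms(2) by (rule Ck_on_Suc_derivative)
qed

lemma gram_density_pos:
  assumes "local_param M V \<phi>" "x \<in> V"
  shows "0 < gram_density \<phi> x"
proof -
  have "linear (frechet_derivative \<phi> (at x))"
    using local_param_derivative[OF assms] has_derivative_linear by blast
  then have "(*v) (matrix (frechet_derivative \<phi> (at x))) = frechet_derivative \<phi> (at x)"
    by (intro ext) (simp add: matrix_works)
  then have "inj ((*v) (matrix (frechet_derivative \<phi> (at x))))"
    using assms by (simp add: local_param_def)
  then show ?thesis by (simp add: det_gram_pos)
qed

lemma gram_density_continuous: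
  assumes "local_param M V (\<phi> :: real^'m \<Rightarrow> real^'d)"
  shows "continuous_on V (gram_density \<phi>)"
proof -
  have "Ck_on (Suc 0) V \<phi>" using assms by (simp add: local_param_def smooth_on_def del: Ck_on.simps)
  then have "continuous_on V (\<lambda>x. frechet_derivative \<phi> (at x) v)" for v by simp
  then have ent: "continuous_on V (\<lambda>x. matrix (frechet_derivative \<phi> (at x)) $ i $ j)" for i j
    unfolding matrix_def by (auto intro!: continuous_intros)
  have entry: "(transpose B ** B) $ i $ j = (\<Sum>k\<in>UNIV. B $ k $ i * B $ k $ j)" for B :: "real^'m^'d" and i j
    by (simp add: matrix_matrix_mult_def transpose_def)
  show ?thesis
    by (intro continuous_on_real_sqrt continuous_on_det) (unfold entry, intro continuous_on_sum continuous_on_mult ent)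
qed

lemma local_param_open_image:
  assumes "local_param M V \<phi>" "open U" "U \<subseteq> V"
  shows "openin (top_of_set M) (\<phi> ` U)"
proof -
  obtain \<psi> where h: "homeomorphism V (\<phi> ` V) \<phi> \<psi>" using assms by (auto simp: local_param_def)
  have "openin (top_of_set V) U" using assms(2,3) open_subset by blast
  then have "openin (top_of_set (\<phi> ` V)) (\<phi> ` U)"
    using homeomorphism_imp_open_map[OF h] by blast
  then show ?thesis using assms(1) openin_trans by (auto simp: local_param_def)
qed

lemma openin_borel_of: "openin (top_of_set M) U \<Longrightarrow> U \<in> sets (borel_of M)"
  by (auto simp: openin_open sets_restrict_space)

lemma borel_of_closed: "closed C \<Longrightarrow> M \<inter> C \<in> sets (borel_of M)"
  by (auto simp: sets_restrict_space)

lemma orthogonal_cancel: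
  fixes Q :: "real^'n^'n"
  assumes "orthogonal_matrix Q"
  shows "transpose Q *v (Q *v z) = z" "Q *v (transpose Q *v z) = z" "(Q *v z) v* Q = z" "Q *v (z v* Q) = z"
proof -
  show *: "transpose Q *v (Q *v z) = z" "Q *v (transpose Q *v z) = z"
    using assms unfolding orthogonal_matrix_def matrix_vector_mul_assoc by simp_all
  show "(Q *v z) v* Q = z" "Q *v (z v* Q) = z" using *(1) *(2) by simp_all
qed

section \<open>Null sets, support and symmetries of the volume of a submanifold\<close>

locale submanifold_density =
  fixes dim :: "'m::finite itself" and M :: "(real^'d) set" and vol :: "(real^'d) measure"
    and p :: "real^'d \<Rightarrow> real"
  assumes submanifold: "properly_embedded_submanifold dim M"
    and volume: "riemannian_volume dim M vol"
    and p_continuous: "continuous_on M p"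
    and p_pos: "z \<in> M \<Longrightarrow> 0 < p z"
begin

lemma closed_M: "closed M"
  using submanifold by (simp add: properly_embedded_submanifold_def)

lemma chart:
  assumes "x \<in> M"
  obtains V and \<phi> :: "real^'m \<Rightarrow> real^'d" where "local_param M V \<phi>" "x \<in> \<phi> ` V"
  using submanifold assms by (auto simp: properly_embedded_submanifold_def)

lemma sets_vol: "sets vol = sets (borel_of M)" and space_vol: "space vol = M"
  using volume by (auto simp: riemannian_volume_def)

lemma vol_chart:
  assumes "local_param M V (\<phi> :: real^'m \<Rightarrow> real^'d)" "B \<in> sets borel" "B \<subseteq> V"
  shows "emeasure vol (\<phi> ` B) = (\<integral>\<^sup>+x\<in>B. ennreal (gram_density \<phi> x) \<partial>lborel)"
  using volume assms by (auto simp: riemannian_volume_def)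

lemma p_measurable: "p \<in> borel_measurable vol"
  using borel_measurable_continuous_on_restrict[OF p_continuous] measurable_cong_sets[OF sets_vol refl] by blast

text \<open>A strictly positive density keeps the null sets.\<close>

lemma AE_law_iff: "(AE z in law_of vol p. Q z) \<longleftrightarrow> (AE z in vol. Q z)"
proof -
  have "(AE z in vol. 0 < ennreal (p z) \<longrightarrow> Q z) \<longleftrightarrow> (AE z in vol. Q z)"
    by (rule AE_cong) (simp add: space_vol p_pos)
  then show ?thesis unfolding law_of_def using p_measurable by (subst AE_density) auto
qed

text \<open>A point is a Lebesgue null set in a chart, because an index type is nonempty and the
  dimension is therefore at least 1. It serves at the origin, the one point that a linear map can
  both fix and kill.\<close>

lemma AE_singleton: "AE z in vol. z \<noteq> a"
proof (cases "a \<in> M")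
  case True
  then obtain V and \<phi> :: "real^'m \<Rightarrow> real^'d" where \<phi>: "local_param M V \<phi>" "a \<in> \<phi> ` V" by (rule chart)
  then obtain u where u: "u \<in> V" "a = \<phi> u" by auto
  have "emeasure vol (\<phi> ` {u}) = (\<integral>\<^sup>+x\<in>{u}. ennreal (gram_density \<phi> x) \<partial>lborel)"
    using u by (intro vol_chart[OF \<phi>(1)]) auto
  also have "\<dots> = 0" by (intro nn_integral_null_set) (simp add: null_sets_def)
  finally have "{a} \<in> null_sets vol"
    using True by (auto simp: null_sets_def u sets_vol sets_restrict_space intro!: image_eqI[of _ _ "{\<phi> u}"])
  then show ?thesis by (rule AE_I') auto
next
  case False
  then show ?thesis by (intro AE_I2) (auto simp: space_vol)
qed

text \<open>A point of \<open>M\<close> off \<open>C\<close> would have a chart neighbourhood off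
  \<open>C\<close>; this would be null, although the Gram density is positive on a nonempty open set
  of parameters. Closed conditions that hold almost everywhere are upgraded to all of
  \<open>M\<close> in this way.\<close>

lemma full_support:
  assumes AE: "AE z in vol. z \<in> C" and C: "closed C"
  shows "M \<subseteq> C"
proof
  fix x assume x: "x \<in> M"
  show "x \<in> C"
  proof (rule ccontr)
    assume notC: "x \<notin> C"
    obtain V and \<phi> :: "real^'m \<Rightarrow> real^'d" where \<phi>: "local_param M V \<phi>" "x \<in> \<phi> ` V" using x by (rule chart)
    then obtain u where u: "u \<in> V" "x = \<phi> u" by auto
    have V: "open V" and sub: "\<phi> ` V \<subseteq> M" and cont: "continuous_on V \<phi>"
      using \<phi>(1) by (auto simp: local_param_def homeomorphism_def dest: openin_imp_subset)
    define U where "U = V \<inter> \<phi> -` (- C)"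
    have U: "open U" "U \<subseteq> V" "u \<in> U"
      using V C cont u notC by (auto simp: U_def intro: continuous_open_preimage)
    have \<phi>U: "\<phi> ` U \<in> sets (borel_of M)" by (intro openin_borel_of local_param_open_image[OF \<phi>(1)] U)
    have "AE z in vol. z \<notin> \<phi> ` U" using AE by eventually_elim (auto simp: U_def)
    then have "emeasure vol (\<phi> ` U) = 0"
      using \<phi>U AE_iff_measurable[of "\<phi> ` U" vol "\<lambda>z. z \<notin> \<phi> ` U"] sub U(2)
      by (auto simp: sets_vol space_vol)
    then have 0: "(\<integral>\<^sup>+x\<in>U. ennreal (gram_density \<phi> x) \<partial>lborel) = 0"
      using vol_chart[OF \<phi>(1) _ U(2)] U(1) by simp
    have "(\<lambda>x. indicator U x *\<^sub>R gram_density \<phi> x) \<in> borel_measurable borel"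
      using U gram_density_continuous[OF \<phi>(1)]
      by (intro borel_measurable_continuous_on_indicator) (auto elim: continuous_on_subset)
    then have "(\<lambda>x. ennreal (gram_density \<phi> x) * indicator U x) \<in> borel_measurable lborel"
      by (subst measurable_cong[of _ _ "\<lambda>x. ennreal (indicator U x *\<^sub>R gram_density \<phi> x)"])
        (auto simp: indicator_def)
    then have "AE x in lborel. ennreal (gram_density \<phi> x) * indicator U x = 0"
      using 0 by (simp add: nn_integral_0_iff_AE)
    then have "AE x in lborel. x \<notin> U"
    proof eventually_elim
      case (elim x)
      then show ?case using gram_density_pos[OF \<phi>(1), of x] U(2) by (auto simp: indicator_def split: if_splits)
    qed
    then have "emeasure lborel U = 0"
      using U(1) AE_iff_measurable[of U lborel "\<lambda>x. x \<notin> U"] by auto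
    moreover have "0 < emeasure lborel U"
    proof -
      obtain e where e: "0 < e" "ball u e \<subseteq> U" using U openE by blast
      have "0 < emeasure lborel (ball u e)" using e(1) by (simp add: emeasure_ball ennreal_zero_less_mult_iff)
      also have "\<dots> \<le> emeasure lborel U" using e(2) U(1) by (intro emeasure_mono) auto
      finally show ?thesis .
    qed
    ultimately show False by simp
  qed
qed

text \<open>A symmetry of \<open>M\<close> carries charts to charts, and
  \<open>transpose Q ** Q = mat 1\<close> cancels inside the Gram matrix.\<close>

lemma local_param_orthogonal:
  fixes \<phi> :: "real^'m \<Rightarrow> real^'d"
  assumes \<phi>: "local_param M V \<phi>" and Q: "orthogonal_matrix Q" "(\<lambda>z. Q *v z) ` M = M"
  shows "local_param M V (\<lambda>x. Q *v \<phi> x)"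
    and "x \<in> V \<Longrightarrow> gram_density (\<lambda>x. Q *v \<phi> x) x = gram_density \<phi> x"
proof -
  have QQ: "transpose Q ** Q = mat 1" "Q ** transpose Q = mat 1"
    using Q(1) by (auto simp: orthogonal_matrix_def)
  have lin: "bounded_linear (\<lambda>z. Q *v z)" by (rule matrix_vector_mul_bounded_linear)
  have homeoQ: "homeomorphism M M (\<lambda>z. Q *v z) (\<lambda>z. transpose Q *v z)"
  proof (rule homeomorphismI)
    show "continuous_on M ((*v) Q)" "continuous_on M ((*v) (transpose Q))"
      by (intro linear_continuous_on matrix_vector_mul_bounded_linear)+
    show "(*v) (transpose Q) ` M \<subseteq> M"
    proof safe
      fix z assume "z \<in> M"
      then obtain y where "y \<in> M" "z = Q *v y" using Q(2) by blast
      then show "transpose Q *v z \<in> M" by (simp add: orthogonal_cancel[OF Q(1)])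
    qed
  qed (use Q(2) in \<open>auto simp: orthogonal_cancel[OF Q(1)]\<close>)
  have D: "((\<lambda>x. Q *v \<phi> x) has_derivative (\<lambda>v. Q *v frechet_derivative \<phi> (at x) v)) (at x)" if "x \<in> V" for x
    by (rule bounded_linear.has_derivative[OF lin local_param_derivative[OF \<phi> that]])
  have FD: "frechet_derivative (\<lambda>x. Q *v \<phi> x) (at x) = (\<lambda>v. Q *v frechet_derivative \<phi> (at x) v)" if "x \<in> V" for x
    using frechet_derivative_at[OF D[OF that]] by simp
  obtain \<psi> where h: "homeomorphism V (\<phi> ` V) \<phi> \<psi>" using \<phi> by (auto simp: local_param_def)
  have sub: "\<phi> ` V \<subseteq> M" using \<phi> by (auto simp: local_param_def dest: openin_imp_subset)
  show "local_param M V (\<lambda>x. Q *v \<phi> x)"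
    unfolding local_param_def
  proof (intro conjI ballI)
    show "open V" using \<phi> by (simp add: local_param_def)
    then show "smooth_on V (\<lambda>x. Q *v \<phi> x)"
      using \<phi> Ck_on_bounded_linear[OF _ lin] by (auto simp: smooth_on_def local_param_def)
    have injQ: "inj (\<lambda>z. Q *v z)"
      by (rule inj_on_inverseI[of _ "\<lambda>z. transpose Q *v z"]) (simp add: orthogonal_cancel[OF Q(1)])
    show "inj (frechet_derivative (\<lambda>x. Q *v \<phi> x) (at x))" if "x \<in> V" for x
      unfolding FD[OF that] using \<phi> that inj_compose[OF injQ, of "frechet_derivative \<phi> (at x)"]
      by (simp add: local_param_def comp_def)
    have "openin (top_of_set M) ((\<lambda>z. Q *v z) ` (\<phi> ` V))"
      using homeomorphism_imp_open_map[OF homeoQ] \<phi> by (simp add: local_param_def)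
    then show "openin (top_of_set M) ((\<lambda>x. Q *v \<phi> x) ` V)" by (simp add: image_image)
    have "homeomorphism (\<phi> ` V) ((\<lambda>z. Q *v z) ` (\<phi> ` V)) (\<lambda>z. Q *v z) (\<lambda>z. transpose Q *v z)"
      by (rule homeomorphism_of_subsets[OF homeoQ sub _ refl]) (use sub Q(2) in blast)
    from homeomorphism_compose[OF h this]
    show "\<exists>\<psi>. homeomorphism V ((\<lambda>x. Q *v \<phi> x) ` V) (\<lambda>x. Q *v \<phi> x) \<psi>"
      by (auto simp: comp_def image_image)
  qed
  assume x: "x \<in> V"
  have m: "matrix (\<lambda>v. Q *v frechet_derivative \<phi> (at x) v) = Q ** matrix (frechet_derivative \<phi> (at x))"
  proof -
    have "linear (frechet_derivative \<phi> (at x))"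
      using local_param_derivative[OF \<phi> x] has_derivative_linear by blast
    then have "matrix ((*v) Q \<circ> frechet_derivative \<phi> (at x)) = matrix ((*v) Q) ** matrix (frechet_derivative \<phi> (at x))"
      by (intro matrix_compose) auto
    then show ?thesis by (simp add: comp_def)
  qed
  show "gram_density (\<lambda>x. Q *v \<phi> x) x = gram_density \<phi> x"
    unfolding FD[OF x] m
    by (simp add: matrix_transpose_mul matrix_mul_assoc) (simp add: matrix_mul_assoc[symmetric] QQ)
qed

text \<open>The chart formula describes the volume only within one chart, where a chart and its
  composition with \<open>Q\<close> give the same integral. By Lindelof countably many charts cover
  \<open>M\<close>, and a measurable set is cut into disjoint pieces that lie in one chart
  each.\<close>

lemma vol_orthogonal_image:
  assumes Q: "orthogonal_matrix Q" "(\<lambda>z. Q *v z) ` M = M" and B: "B \<in> sets vol"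
  shows "emeasure vol ((\<lambda>z. Q *v z) ` B) = emeasure vol B"
    and "(\<lambda>z. Q *v z) ` B \<in> sets vol"
proof -
  let ?Q = "\<lambda>z. Q *v z"
  have QQ: "transpose Q ** Q = mat 1" "Q ** transpose Q = mat 1"
    using Q(1) by (auto simp: orthogonal_matrix_def)
  have injQ: "inj ?Q"
    by (rule inj_on_inverseI[of _ "\<lambda>z. transpose Q *v z"]) (simp add: orthogonal_cancel[OF Q(1)])
  have img: "?Q ` B \<in> sets vol" if "B \<in> sets vol" for B
  proof -
    have BM: "B \<subseteq> M" "B \<in> sets borel"
      using that closed_M by (auto simp: sets_vol sets_restrict_space)
    have "?Q ` B = (\<lambda>z. transpose Q *v z) -` B \<inter> space borel"
    proof safe
      fix z assume "transpose Q *v z \<in> B"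
      then show "z \<in> ?Q ` B" by (intro image_eqI[of _ _ "transpose Q *v z"]) (auto simp: orthogonal_cancel[OF Q(1)])
    qed (auto simp: orthogonal_cancel[OF Q(1)])
    moreover have "(\<lambda>z. transpose Q *v z) \<in> borel_measurable borel"
      by (intro borel_measurable_continuous_onI linear_continuous_on matrix_vector_mul_bounded_linear)
    ultimately have "?Q ` B \<in> sets borel" using BM(2) measurable_sets by metis
    moreover have "?Q ` B \<subseteq> M" using BM(1) Q(2) by blast
    ultimately show ?thesis by (auto simp: sets_vol sets_restrict_space intro!: image_eqI[of _ _ "?Q ` B"])
  qed
  show "?Q ` B \<in> sets vol" by (rule img[OF B])
  have in_chart: "emeasure vol (?Q ` B) = emeasure vol B"
    if \<phi>: "local_param M V (\<phi> :: real^'m \<Rightarrow> real^'d)" and B: "B \<in> sets vol" "B \<subseteq> \<phi> ` V" for V \<phi> B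
  proof -
    define U where "U = V \<inter> \<phi> -` B"
    have V: "open V" and cont: "continuous_on V \<phi>" using \<phi> by (auto simp: local_param_def homeomorphism_def)
    have "B \<in> sets borel" using B(1) closed_M by (auto simp: sets_vol sets_restrict_space)
    then have UB: "U \<in> sets borel"
      unfolding U_def using measurable_sets[OF borel_measurable_continuous_on_restrict[OF cont], of B] V
      by (simp add: sets_restrict_space_iff space_restrict_space Int_commute)
    have BU: "B = \<phi> ` U" using B(2) by (auto simp: U_def)
    have "emeasure vol (?Q ` B) = emeasure vol ((\<lambda>x. Q *v \<phi> x) ` U)" by (simp add: BU image_image)
    also have "\<dots> = (\<integral>\<^sup>+x\<in>U. ennreal (gram_density (\<lambda>x. Q *v \<phi> x) x) \<partial>lborel)"
      by (rule vol_chart[OF local_param_orthogonal(1)[OF \<phi> Q] UB]) (auto simp: U_def)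
    also have "\<dots> = (\<integral>\<^sup>+x\<in>U. ennreal (gram_density \<phi> x) \<partial>lborel)"
      using local_param_orthogonal(2)[OF \<phi> Q] by (intro nn_integral_cong) (auto simp: U_def indicator_def)
    also have "\<dots> = emeasure vol B" unfolding BU by (rule vol_chart[OF \<phi> UB, symmetric]) (auto simp: U_def)
    finally show ?thesis .
  qed
  define \<C> where "\<C> = {\<phi> ` V | V (\<phi> :: real^'m \<Rightarrow> real^'d). local_param M V \<phi>}"
  have open_C: "openin (top_of_set M) C" if "C \<in> \<C>" for C
    using that by (auto simp: \<C>_def local_param_def)
  then obtain \<D> where \<D>: "\<D> \<subseteq> \<C>" "countable \<D>" "\<Union>\<D> = \<Union>\<C>" by (rule Lindelof_openin)
  have cover: "M \<subseteq> \<Union>\<D>"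
  proof
    fix x assume "x \<in> M"
    then obtain V and \<phi> :: "real^'m \<Rightarrow> real^'d" where \<phi>: "local_param M V \<phi>" "x \<in> \<phi> ` V" by (rule chart)
    then have "\<phi> ` V \<in> \<C>" unfolding \<C>_def by blast
    then show "x \<in> \<Union>\<D>" unfolding \<D>(3) using \<phi>(2) by blast
  qed
  show "emeasure vol (?Q ` B) = emeasure vol B"
  proof (cases "\<D> = {}")
    case True
    then have "B = {}" using cover sets.sets_into_space[OF B] by (auto simp: space_vol)
    then show ?thesis by simp
  next
    case False
    define E where "E = from_nat_into \<D>"
    have ran: "range E = \<D>" unfolding E_def using False \<D>(2) by (rule range_from_nat_into)
    have Es: "E n \<in> sets vol" for n
      unfolding sets_vol
      by (intro openin_borel_of open_C) (use ran \<D>(1) in blast)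
    define F where "F n = B \<inter> disjointed E n" for n
    have Fs: "F n \<in> sets vol" for n
      unfolding F_def using sets.range_disjointed_sets[of E vol] Es B by auto
    have disj: "disjoint_family F"
      using disjoint_family_disjointed[of E] by (auto simp: disjoint_family_on_def F_def)
    have UF: "B = (\<Union>n. F n)"
      using cover ran sets.sets_into_space[OF B] by (auto simp: F_def UN_disjointed_eq space_vol simp flip: UN_extend_simps)
    have eq: "emeasure vol (?Q ` F n) = emeasure vol (F n)" for n
    proof -
      have "E n \<in> \<C>" using ran \<D>(1) by auto
      then obtain V and \<phi> :: "real^'m \<Rightarrow> real^'d" where \<phi>: "local_param M V \<phi>" "E n = \<phi> ` V" by (auto simp: \<C>_def)
      show ?thesis using disjointed_subset[of E n] \<phi> by (intro in_chart[OF \<phi>(1) Fs]) (auto simp: F_def)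
    qed
    have "emeasure vol (?Q ` B) = emeasure vol (\<Union>n. ?Q ` F n)" by (simp add: UF image_UN)
    also have "\<dots> = (\<Sum>n. emeasure vol (?Q ` F n))"
      using disj img[OF Fs]
      by (intro suminf_emeasure[symmetric]) (auto simp: disjoint_family_on_def image_Int[OF injQ, symmetric])
    also have "\<dots> = (\<Sum>n. emeasure vol (F n))" by (simp add: eq)
    also have "\<dots> = emeasure vol B"
      unfolding UF using Fs disj by (intro suminf_emeasure) auto
    finally show ?thesis .
  qed
qed

text \<open>The volume is invariant by \<open>vol_orthogonal_image\<close> and the density by
  \<open>radial\<close>.\<close>

lemma law_orthogonal:
  assumes Q: "orthogonal_matrix Q" "(\<lambda>z. Q *v z) ` M = M"
    and radial: "\<And>z. z \<in> M \<Longrightarrow> p (Q *v z) = p z"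
  shows "(\<lambda>z. Q *v z) \<in> borel_of M \<rightarrow>\<^sub>M borel_of M"
    and "distr (law_of vol p) (borel_of M) (\<lambda>z. Q *v z) = law_of vol p"
proof -
  let ?Q = "\<lambda>z. Q *v z"
  have QQ: "transpose Q ** Q = mat 1" "Q ** transpose Q = mat 1"
    using Q(1) by (auto simp: orthogonal_matrix_def)
  have "?Q \<in> borel_measurable borel"
    by (intro borel_measurable_continuous_onI linear_continuous_on matrix_vector_mul_bounded_linear)
  then show Qm: "?Q \<in> borel_of M \<rightarrow>\<^sub>M borel_of M"
    using Q(2) by (intro measurable_restrict_space3) auto
  then have Qv: "?Q \<in> vol \<rightarrow>\<^sub>M vol" using measurable_cong_sets[OF sets_vol sets_vol] by blast
  have Q': "orthogonal_matrix (transpose Q)" "(\<lambda>z. transpose Q *v z) ` M = M"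
  proof -
    show "orthogonal_matrix (transpose Q)" using Q(1) by (simp add: orthogonal_matrix_transpose)
    have "(\<lambda>z. transpose Q *v z) ` ?Q ` M = M" by (simp add: image_image orthogonal_cancel[OF Q(1)])
    then show "(\<lambda>z. transpose Q *v z) ` M = M" using Q(2) by simp
  qed
  have inv: "distr vol vol ?Q = vol"
  proof (rule measure_eqI)
    fix B assume "B \<in> sets (distr vol vol ?Q)"
    then have B: "B \<in> sets vol" by simp
    have BM: "B \<subseteq> M" using sets.sets_into_space[OF B] by (simp add: space_vol)
    have "?Q -` B \<inter> space vol = (\<lambda>z. transpose Q *v z) ` B"
    proof safe
      fix z assume "?Q z \<in> B"
      then show "z \<in> (\<lambda>z. transpose Q *v z) ` B" by (intro image_eqI[of _ _ "?Q z"]) (auto simp: orthogonal_cancel[OF Q(1)])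
    next
      fix z assume "z \<in> B"
      then show "transpose Q *v z \<in> space vol" using Q'(2) BM by (auto simp: space_vol)
    qed (simp add: orthogonal_cancel[OF Q(1)])
    then show "emeasure (distr vol vol ?Q) B = emeasure vol B"
      using vol_orthogonal_image(1)[OF Q' B] Qv B by (simp add: emeasure_distr)
  qed simp
  show "distr (law_of vol p) (borel_of M) ?Q = law_of vol p"
  proof -
    have "distr (law_of vol p) (borel_of M) ?Q = distr (density vol (\<lambda>z. ennreal (p (?Q z)))) vol ?Q"
      unfolding law_of_def
      by (intro distr_cong density_cong) (use p_measurable Qv measurable_compose[OF Qv p_measurable] in \<open>auto simp: sets_vol radial space_vol\<close>)
    also have "\<dots> = density (distr vol vol ?Q) (\<lambda>z. ennreal (p z))"
      using p_measurable Qv by (subst density_distr) auto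
    also have "\<dots> = law_of vol p" by (simp add: inv law_of_def)
    finally show ?thesis .
  qed
qed

(* At a common point 0 of the two subspaces, every tangent direction lies in exactly one of them. *)
lemma locally_one_subspace:
  fixes S :: "real^'d^'d"
  assumes cover: "\<And>z. z \<in> M \<Longrightarrow> S *v z = z \<or> S *v z = 0" and 0: "0 \<in> M"
  obtains U where "openin (top_of_set M) U" "0 \<in> U"
    "(\<forall>z\<in>U. S *v z = z) \<or> (\<forall>z\<in>U. S *v z = 0)"
proof -
  obtain V and \<phi> :: "real^'m \<Rightarrow> real^'d" where \<phi>: "local_param M V \<phi>" "0 \<in> \<phi> ` V" using 0 by (rule chart)
  then obtain u where u: "u \<in> V" "\<phi> u = 0" by auto
  obtain \<psi> where h: "homeomorphism V (\<phi> ` V) \<phi> \<psi>" using \<phi>(1) by (auto simp: local_param_def)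
  have V: "open V" and sub: "\<phi> ` V \<subseteq> M" using \<phi>(1) by (auto simp: local_param_def dest: openin_imp_subset)
  have cont: "continuous_on V \<phi>" using h by (rule homeomorphism_cont1)
  have inj: "inj_on \<phi> V" using h by (intro inj_on_inverseI[of _ \<psi>]) (rule homeomorphism_apply1)
  obtain r where r: "0 < r" "ball u r \<subseteq> V" using V u openE by blast
  define L where "L = frechet_derivative \<phi> (at u)"
  have D: "(\<phi> has_derivative L) (at u)" unfolding L_def by (rule local_param_derivative[OF \<phi>(1) u(1)])
  have L: "linear L" "inj L" using D \<phi>(1) u(1) has_derivative_linear by (auto simp: local_param_def L_def)
  have Sb: "bounded_linear ((*v) S)" by (rule matrix_vector_mul_bounded_linear)
  \<comment> \<open>On the ray without its origin \<open>\<gamma>\<close> never vanishes, since the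
    chart is injective. The two alternatives are then disjoint and relatively closed, connectedness
    selects one of them, and the limit of \<open>\<gamma> s / s\<close> carries it over to
    \<open>L e\<close>.\<close>
  have ray: "(\<forall>s\<in>{0<..<r}. S *v \<phi> (u + s *\<^sub>R e) = \<phi> (u + s *\<^sub>R e)) \<and> S *v L e = L e \<or>
             (\<forall>s\<in>{0<..<r}. S *v \<phi> (u + s *\<^sub>R e) = 0) \<and> S *v L e = 0" if e: "norm e = 1" for e
  proof -
    define \<gamma> where "\<gamma> s = \<phi> (u + s *\<^sub>R e)" for s
    have inV: "u + s *\<^sub>R e \<in> V" if "s \<in> {0<..<r}" for s
      using that e r(2) by (intro subsetD[OF r(2)]) (auto simp: dist_norm)
    have \<gamma>c: "continuous_on {0<..<r} \<gamma>" unfolding \<gamma>_def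
      using inV by (intro continuous_on_compose2[OF cont] continuous_intros) auto
    have nz: "\<gamma> s \<noteq> 0" if "s \<in> {0<..<r}" for s
    proof
      assume "\<gamma> s = 0"
      then have "u + s *\<^sub>R e = u" using inj_onD[OF inj _ inV[OF that] u(1)] u(2) by (simp add: \<gamma>_def)
      then show False using that e by auto
    qed
    have alt: "S *v \<gamma> s = \<gamma> s \<or> S *v \<gamma> s = 0" if "s \<in> {0<..<r}" for s
      using cover[of "\<gamma> s"] sub inV[OF that] by (auto simp: \<gamma>_def)
    have "continuous_on {0<..<r} (\<lambda>s. S *v \<gamma> s - \<gamma> s)"
      by (intro continuous_on_diff bounded_linear.continuous_on[OF Sb] \<gamma>c)
    from continuous_closedin_preimage_constant[OF this, of 0]
      continuous_closedin_preimage_constant[OF bounded_linear.continuous_on[OF Sb \<gamma>c], of 0]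
    have clos: "closedin (top_of_set {0<..<r}) {s \<in> {0<..<r}. S *v \<gamma> s = \<gamma> s}"
      "closedin (top_of_set {0<..<r}) {s \<in> {0<..<r}. S *v \<gamma> s = 0}"
      by simp_all
    have lim: "((\<lambda>s. (1 / s) *\<^sub>R \<gamma> s) \<longlongrightarrow> L e) (at_right 0)"
    proof -
      have "((\<lambda>s. u + s *\<^sub>R e) has_derivative (\<lambda>s. s *\<^sub>R e)) (at 0)"
        by (auto intro!: derivative_eq_intros)
      then have "(\<gamma> has_derivative (\<lambda>s. L (s *\<^sub>R e))) (at 0)"
        unfolding \<gamma>_def using has_derivative_compose[of "\<lambda>s. u + s *\<^sub>R e" _ 0 UNIV \<phi> L] D by simp
      then have lim0: "((\<lambda>h. norm (\<gamma> h - h *\<^sub>R L e) / norm h) \<longlongrightarrow> 0) (at 0)"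
        using u(2) by (simp add: has_derivative_at \<gamma>_def linear_cmul[OF L(1)])
      have "norm (\<gamma> h - h *\<^sub>R L e) / norm h = norm ((1 / h) *\<^sub>R \<gamma> h - L e)" if "h \<noteq> 0" for h
      proof -
        have "\<gamma> h - h *\<^sub>R L e = h *\<^sub>R ((1 / h) *\<^sub>R \<gamma> h - L e)" using that by (simp add: algebra_simps)
        then show ?thesis using that by simp
      qed
      then have "\<forall>\<^sub>F h in at 0. norm (\<gamma> h - h *\<^sub>R L e) / norm h = norm ((1 / h) *\<^sub>R \<gamma> h - L e)"
        by (simp add: eventually_at_filter)
      from Lim_transform_eventually[OF lim0 this] have "((\<lambda>h. (1 / h) *\<^sub>R \<gamma> h) \<longlongrightarrow> L e) (at 0)"
        by (rule LIM_zero_cancel[OF tendsto_norm_zero_cancel])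
      then show ?thesis by (rule tendsto_within_subset) simp
    qed
    have Slim: "((\<lambda>s. S *v ((1 / s) *\<^sub>R \<gamma> s)) \<longlongrightarrow> S *v L e) (at_right 0)"
      by (rule bounded_linear.tendsto[OF Sb lim])
    have ev: "\<forall>\<^sub>F s in at_right 0. s \<in> {0<..<r}" using r(1) eventually_at_right_field by (auto simp: eventually_at_right_field)
    have "connected {0<..<r}" by simp
    then have "{s \<in> {0<..<r}. S *v \<gamma> s = \<gamma> s} = {} \<or> {s \<in> {0<..<r}. S *v \<gamma> s = 0} = {}"
    proof -
      let ?E1 = "{s \<in> {0<..<r}. S *v \<gamma> s = \<gamma> s}" and ?E2 = "{s \<in> {0<..<r}. S *v \<gamma> s = 0}"
      have "{0<..<r} \<subseteq> ?E1 \<union> ?E2" using alt by blast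
      moreover have "?E1 \<inter> ?E2 = {}" using nz by auto
      ultimately show ?thesis
        using \<open>connected {0<..<r}\<close> clos unfolding connected_closedin by blast
    qed
    then consider "\<forall>s\<in>{0<..<r}. S *v \<gamma> s = 0" | "\<forall>s\<in>{0<..<r}. S *v \<gamma> s = \<gamma> s" using alt by blast
    then show ?thesis
    proof cases
      case 1
      have "((\<lambda>s. 0) \<longlongrightarrow> S *v L e) (at_right (0::real))"
        by (rule Lim_transform_eventually[OF Slim])
          (use ev in eventually_elim, use 1 in \<open>simp add: matrix_vector_mult_scaleR\<close>)
      then have "S *v L e = 0" by (simp add: tendsto_const_iff)
      then show ?thesis using 1 by (simp add: \<gamma>_def)
    next
      case 2
      have "((\<lambda>s. (1 / s) *\<^sub>R \<gamma> s) \<longlongrightarrow> S *v L e) (at_right 0)"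
        by (rule Lim_transform_eventually[OF Slim])
          (use ev in eventually_elim, use 2 in \<open>simp add: matrix_vector_mult_scaleR\<close>)
      then have "S *v L e = L e" by (rule tendsto_unique[OF _ _ lim, rotated]) simp
      then show ?thesis using 2 by (simp add: \<gamma>_def)
    qed
  qed
  have Lnz: "L e \<noteq> 0" if "e \<noteq> 0" for e using linear_injective_0[OF L(1)] L(2) that by blast
  have alt: "S *v L e = L e \<or> S *v L e = 0" for e
  proof (cases "e = 0")
    case False
    then have "norm ((1 / norm e) *\<^sub>R e) = 1" by simp
    from ray[OF this] show ?thesis using False
      by (auto simp: linear_cmul[OF L(1)] matrix_vector_mult_scaleR)
  qed (simp add: linear_0[OF L(1)])
  \<comment> \<open>A vector space is not the union of two proper subspaces: for \<open>L a\<close>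
    outside the first and \<open>L b\<close> outside the second, the sum would lie in
    neither.\<close>
  have one: "(\<forall>e. S *v L e = L e) \<or> (\<forall>e. S *v L e = 0)"
  proof (rule ccontr)
    assume "\<not> ?thesis"
    then obtain a b where a: "S *v L a \<noteq> L a" and b: "S *v L b \<noteq> 0" by auto
    then have "S *v L a = 0" "S *v L b = L b" using alt by blast+
    then show False using alt[of "a + b"] a b
      by (auto simp: linear_add[OF L(1)] matrix_vector_right_distrib)
  qed
  have polar: "\<exists>e s. norm e = 1 \<and> s \<in> {0<..<r} \<and> x = u + s *\<^sub>R e" if "x \<in> ball u r" "x \<noteq> u" for x
    using that by (intro exI[of _ "(1 / norm (x - u)) *\<^sub>R (x - u)"] exI[of _ "norm (x - u)"])
      (auto simp: dist_norm norm_minus_commute)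
  show ?thesis
  proof (rule that)
    show "openin (top_of_set M) (\<phi> ` ball u r)" by (rule local_param_open_image[OF \<phi>(1) _ r(2)]) simp
    show "0 \<in> \<phi> ` ball u r" using u(2) r(1) by (intro image_eqI[of _ _ u]) auto
    from one show "(\<forall>z\<in>\<phi> ` ball u r. S *v z = z) \<or> (\<forall>z\<in>\<phi> ` ball u r. S *v z = 0)"
    proof
      assume *: "\<forall>e. S *v L e = L e"
      have "S *v \<phi> x = \<phi> x" if x: "x \<in> ball u r" for x
      proof (cases "x = u")
        case False
        then obtain e s where es: "norm e = 1" "s \<in> {0<..<r}" "x = u + s *\<^sub>R e" using polar[OF x] by blast
        \<comment> \<open>\<open>L e\<close> is nonzero, so fixing it rules out the alternative of
          \<open>ray\<close> in which it is killed.\<close>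
        then show ?thesis using ray[OF es(1)] * Lnz[of e] by (metis norm_zero zero_neq_one)
      qed (simp add: u(2))
      then show ?thesis by blast
    next
      assume *: "\<forall>e. S *v L e = 0"
      have "S *v \<phi> x = 0" if x: "x \<in> ball u r" for x
      proof (cases "x = u")
        case False
        then obtain e s where es: "norm e = 1" "s \<in> {0<..<r}" "x = u + s *\<^sub>R e" using polar[OF x] by blast
        then show ?thesis using ray[OF es(1)] * Lnz[of e] by (metis norm_zero zero_neq_one)
      qed (simp add: u(2))
      then show ?thesis by blast
    qed
  qed
qed

text \<open>The fixed space and the null space of \<open>S\<close> are closed and meet only in 0. If
  0 is not in \<open>M\<close>, connectedness suffices. Otherwise a neighbourhood of 0 in
  \<open>M\<close> lies in one of them by \<open>locally_one_subspace\<close> and can be removed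
  from the other, which makes the two closed sets disjoint on \<open>M\<close>.\<close>

lemma one_subspace:
  fixes S :: "real^'d^'d"
  assumes conn: "connected M" and cover: "\<And>z. z \<in> M \<Longrightarrow> S *v z = z \<or> S *v z = 0"
  shows "(\<forall>z\<in>M. S *v z = z) \<or> (\<forall>z\<in>M. S *v z = 0)"
proof -
  let ?C1 = "{z. S *v z = z}" and ?C2 = "{z. S *v z = 0}"
  have Sc: "continuous_on UNIV ((*v) S)" by (intro linear_continuous_on matrix_vector_mul_bounded_linear)
  have C: "closed ?C1" "closed ?C2"
    using Sc by (auto intro!: closed_Collect_eq continuous_intros)
  have split: "C \<inter> M = {} \<or> D \<inter> M = {}" if "closed C" "closed D" "M \<subseteq> C \<union> D" "C \<inter> D \<inter> M = {}" for C D
    using conn that unfolding connected_closed by blast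
  show ?thesis
  proof (cases "0 \<in> M")
    case False
    then have "?C1 \<inter> ?C2 \<inter> M = {}" by auto
    then have "?C1 \<inter> M = {} \<or> ?C2 \<inter> M = {}" using cover by (intro split C) auto
    then show ?thesis using cover by blast
  next
    case True
    obtain U where U: "openin (top_of_set M) U" "0 \<in> U" "(\<forall>z\<in>U. S *v z = z) \<or> (\<forall>z\<in>U. S *v z = 0)"
      using locally_one_subspace[OF cover True] by blast
    obtain O' where O': "open O'" "U = M \<inter> O'" using U(1) by (auto simp: openin_open)
    from U(3) show ?thesis
    proof
      assume *: "\<forall>z\<in>U. S *v z = z"
      have "?C1 \<inter> M = {} \<or> (?C2 - O') \<inter> M = {}"
      proof (rule split)
        show "closed (?C2 - O')" using C O' by (intro closed_Diff) auto
        show "M \<subseteq> ?C1 \<union> (?C2 - O')" using cover * O'(2) by blast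
        show "?C1 \<inter> (?C2 - O') \<inter> M = {}" using U(2) O'(2) by auto
      qed (rule C)
      then show ?thesis using True cover * O'(2) by auto
    next
      assume *: "\<forall>z\<in>U. S *v z = 0"
      have "?C2 \<inter> M = {} \<or> (?C1 - O') \<inter> M = {}"
      proof (rule split)
        show "closed (?C1 - O')" using C O' by (intro closed_Diff) auto
        show "M \<subseteq> ?C2 \<union> (?C1 - O')" using cover * O'(2) by blast
        show "?C2 \<inter> (?C1 - O') \<inter> M = {}" using U(2) O'(2) by auto
      qed (rule C)
      then show ?thesis using True cover * O'(2) by auto
    qed
  qed
qed

text \<open>Almost everywhere \<open>S *v z\<close> is \<open>z\<close> or 0. This condition is
  closed, so by full support it holds on all of \<open>M\<close> and \<open>one_subspace\<close>
  applies. Away from the origin the selected alternative decides membership in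
  \<open>B\<close>.\<close>

lemma AE_trivial_set:
  assumes conn: "connected M" and AE: "AE z in vol. indicator B z *\<^sub>R z = S *v z"
  shows "(AE z in vol. z \<in> B) \<or> (AE z in vol. z \<notin> B)"
proof -
  have Sc: "continuous_on UNIV ((*v) S)" by (intro linear_continuous_on matrix_vector_mul_bounded_linear)
  have "M \<subseteq> {z. S *v z = z} \<union> {z. S *v z = 0}"
  proof (rule full_support)
    show "AE z in vol. z \<in> {z. S *v z = z} \<union> {z. S *v z = 0}"
      using AE
    proof eventually_elim
      case (elim z)
      then show ?case by (cases "z \<in> B") auto
    qed
    show "closed ({z. S *v z = z} \<union> {z. S *v z = 0})"
      using Sc by (intro closed_Un closed_Collect_eq continuous_intros)
  qed
  then have "(\<forall>z\<in>M. S *v z = z) \<or> (\<forall>z\<in>M. S *v z = 0)" by (intro one_subspace[OF conn]) auto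
  then show ?thesis
  proof
    assume *: "\<forall>z\<in>M. S *v z = z"
    have "AE z in vol. z \<in> B"
      using AE AE_singleton[of 0] AE_space
    proof eventually_elim
      case (elim z)
      then show ?case using * by (cases "z \<in> B") (auto simp: space_vol)
    qed
    then show ?thesis ..
  next
    assume *: "\<forall>z\<in>M. S *v z = 0"
    have "AE z in vol. z \<notin> B"
      using AE AE_singleton[of 0] AE_space
    proof eventually_elim
      case (elim z)
      then show ?case using * by (cases "z \<in> B") (auto simp: space_vol)
    qed
    then show ?thesis ..
  qed
qed

end

section \<open>The spectral gap\<close>

context langevin
begin

lemma integral_T_square:
  assumes f: "f \<in> L2 P" and s: "0 \<le> s"
  shows "integrable P (T s (\<lambda>x. (f x)\<^sup>2))" "(\<integral>z. T s (\<lambda>x. (f x)\<^sup>2) z \<partial>P) = (\<integral>z. (f z)\<^sup>2 \<partial>P)"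
  using transition_nonneg(1,2)[OF L2_square_integrable[OF f] _ s] by simp_all

text \<open>When the square is expanded, stationarity gives its two pure terms the same mean. For
  the components of a map the left-hand side is their share of the loss; for an invariant function
  it vanishes. Its nonnegativity is the second claim.\<close>

lemma energy:
  assumes f: "f \<in> L2 P" and s: "0 \<le> s"
  shows "(\<integral>\<^sup>+z. (\<integral>\<^sup>+z'. ennreal ((f z' - f z)\<^sup>2) \<partial>K s z) \<partial>P) =
    ennreal (2 * (L2_inner P f f - L2_inner P f (T s f)))"
    and "L2_inner P f (T s f) \<le> L2_inner P f f"
proof -
  let ?e = "\<lambda>z. T s (\<lambda>x. (f x)\<^sup>2) z - 2 * (f z * T s f z) + (f z)\<^sup>2"
  have pt: "AE z in P. (\<integral>\<^sup>+z'. ennreal ((f z' - f z)\<^sup>2) \<partial>K s z) = ennreal (?e z) \<and> 0 \<le> ?e z"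
    using AE_K_L2[OF f s]
  proof (rule AE_mp, intro AE_I2 impI)
    fix z assume "z \<in> space P" and L: "f \<in> L2 (K s z)"
    then interpret K: prob_space "K s z" using K_space(1)[OF s] by (simp add: space_P)
    have d: "(\<lambda>z'. f z' - f z) \<in> L2 (K s z)" using L by (intro L2_diff L2_const K.finite_measure_axioms)
    have "(\<integral>z'. (f z' - f z)\<^sup>2 \<partial>K s z) = (\<integral>z'. (f z')\<^sup>2 - 2 * f z * f z' + (f z)\<^sup>2 \<partial>K s z)"
      by (intro Bochner_Integration.integral_cong) (auto simp: power2_diff)
    also have "\<dots> = ?e z"
      using L2_square_integrable[OF L] L2_integrable[OF K.finite_measure_axioms L]
      by (simp add: transition_op_def K.prob_space)
    finally have eq: "(\<integral>z'. (f z' - f z)\<^sup>2 \<partial>K s z) = ?e z" .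
    have "0 \<le> ?e z" unfolding eq[symmetric] by simp
    moreover have "(\<integral>\<^sup>+z'. ennreal ((f z' - f z)\<^sup>2) \<partial>K s z) = ennreal (?e z)"
      using nn_integral_eq_integral[OF L2_square_integrable[OF d]] eq by simp
    ultimately show "(\<integral>\<^sup>+z'. ennreal ((f z' - f z)\<^sup>2) \<partial>K s z) = ennreal (?e z) \<and> 0 \<le> ?e z" by simp
  qed
  have i1: "integrable P (\<lambda>z. f z * T s f z)" by (rule L2_mult_integrable[OF f T_L2[OF f s]])
  have ei: "integrable P ?e"
    using integral_T_square(1)[OF f s] i1 L2_square_integrable[OF f] by simp
  have eint: "(\<integral>z. ?e z \<partial>P) = 2 * (L2_inner P f f - L2_inner P f (T s f))"
    using integral_T_square[OF f s] i1 L2_square_integrable[OF f]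
    by (simp add: L2_inner_def power2_eq_square)
  have e0: "AE z in P. 0 \<le> ?e z" using pt by eventually_elim simp
  have "(\<integral>\<^sup>+z. (\<integral>\<^sup>+z'. ennreal ((f z' - f z)\<^sup>2) \<partial>K s z) \<partial>P) = (\<integral>\<^sup>+z. ennreal (?e z) \<partial>P)"
    by (intro nn_integral_cong_AE) (use pt in eventually_elim, simp)
  also have "\<dots> = ennreal (\<integral>z. ?e z \<partial>P)" by (rule nn_integral_eq_integral[OF ei e0])
  finally show "(\<integral>\<^sup>+z. (\<integral>\<^sup>+z'. ennreal ((f z' - f z)\<^sup>2) \<partial>K s z) \<partial>P) =
    ennreal (2 * (L2_inner P f f - L2_inner P f (T s f)))" by (simp add: eint)
  have "0 \<le> (\<integral>z. ?e z \<partial>P)" by (rule integral_nonneg_AE[OF e0])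
  then show "L2_inner P f (T s f) \<le> L2_inner P f f" by (simp add: eint)
qed

lemma increment_measurable:
  assumes f: "f \<in> borel_measurable (borel_of M)" and s: "0 \<le> s"
  shows "(\<lambda>z. \<integral>\<^sup>+z'. ennreal ((f z' - f z)\<^sup>2) \<partial>K s z) \<in> borel_measurable P"
proof (rule nn_integral_measurable_subprob_algebra2[OF _ K_measurable[OF s]])
  have "(\<lambda>x. f (fst x)) \<in> borel_measurable (P \<Otimes>\<^sub>M borel_of M)"
    by (rule measurable_compose[OF measurable_fst]) (simp add: f measurable_P)
  moreover have "(\<lambda>x. f (snd x)) \<in> borel_measurable (P \<Otimes>\<^sub>M borel_of M)"
    by (rule measurable_compose[OF measurable_snd f])
  ultimately show "(\<lambda>(z, z'). ennreal ((f z' - f z)\<^sup>2)) \<in> borel_measurable (P \<Otimes>\<^sub>M borel_of M)"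
    by (simp add: case_prod_beta)
qed

text \<open>An invariant function has zero energy. Indicators of its level sets can consequently be
  pulled out of kernel integrals.\<close>

lemma AE_constant_along_kernel:
  assumes f: "f \<in> L2 P" and s: "0 \<le> s" and inv: "AE z in P. T s f z = f z"
  shows "AE z in P. AE z' in K s z. f z' = f z"
proof -
  have fm: "f \<in> borel_measurable (borel_of M)" by (rule L2_measurable_M[OF f])
  have "L2_inner P f (T s f) = L2_inner P f f" using f T_L2[OF f s] inv by (intro L2_inner_cong_AE)
  then have 0: "(\<integral>\<^sup>+z. (\<integral>\<^sup>+z'. ennreal ((f z' - f z)\<^sup>2) \<partial>K s z) \<partial>P) = 0"
    using energy(1)[OF f s] by simp
  have "AE z in P. (\<integral>\<^sup>+z'. ennreal ((f z' - f z)\<^sup>2) \<partial>K s z) = 0"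
    using 0 nn_integral_0_iff_AE[OF increment_measurable[OF fm s]] by simp
  then show ?thesis
    using AE_space
  proof eventually_elim
    case (elim z)
    have "f \<in> borel_measurable (K s z)" using fm elim(2) by (simp add: measurable_K[OF s] space_P)
    then have "AE z' in K s z. ennreal ((f z' - f z)\<^sup>2) = 0"
      using elim(1) by (subst (asm) nn_integral_0_iff_AE) auto
    then show ?case by eventually_elim simp
  qed
qed

end

text \<open>Connectedness of \<open>M\<close> enters through \<open>trivial_sets\<close>: a linear
  map cannot cut a proper piece out of the space. \<open>gap\<close> is silent about the eigenvalue
  0, whose eigenspace is determined from \<open>trivial_sets\<close> and
  \<open>eigenspace_lam\<close>.\<close>

locale discrete_langevin = langevin M vol p K for M :: "(real^'d) set" and vol p K +
  fixes lam c :: real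
  assumes discrete: "discrete_spectrum P A"
    and lam_pos: "0 < lam"
    and gap: "eigenvalue_of P A \<mu> \<Longrightarrow> \<mu> \<noteq> 0 \<Longrightarrow> lam \<le> \<mu>"
    and eigenspace_lam: "eigenspace P A lam = {f \<in> L2 P. \<exists>a. AE z in P. f z = (\<Sum>j\<in>UNIV. a j * z $ j)}"
    and c_pos: "0 < c" and isotropic: "centered_isotropic P c"
    and trivial_sets: "AE z in P. indicator B z *\<^sub>R z = S *v z \<Longrightarrow> (AE z in P. z \<in> B) \<or> (AE z in P. z \<notin> B)"
begin

sublocale spectral: discrete_selfadjoint "L2 P" "L2_inner P" A
proof -
  interpret H: semi_hilbert "L2 P" "L2_inner P" by (rule P.semi_hilbert_L2)
  have eig: "(f, \<mu> *\<^sub>R f) \<in> A \<longleftrightarrow> f \<in> eigenspace P A \<mu>" for f \<mu>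
    by (simp add: eigenspace_def scaleR_fun_def)
  have ev: "(\<exists>f. (f, \<mu> *\<^sub>R f) \<in> A \<and> L2.seminorm P f \<noteq> 0) \<longleftrightarrow> eigenvalue_of P A \<mu>" for \<mu>
  proof -
    have "f \<in> L2 P" if "f \<in> eigenspace P A \<mu>" for f using that A_iff by (auto simp: eigenspace_def)
    then show ?thesis unfolding eigenvalue_of_def eig seminorm_L2 using L2_norm_eq_0 by blast
  qed
  show "discrete_selfadjoint (L2 P) (L2_inner P) A"
  proof
    show "\<exists>(u, v)\<in>A. L2.seminorm P (f - u) < e" if "f \<in> L2 P" "0 < e" for f e
      using A_dense[OF that] by (simp add: seminorm_L2 fun_diff_def)
    show "(f, g) \<in> A \<longleftrightarrow> f \<in> L2 P \<and> g \<in> L2 P \<and> (\<forall>(u, v)\<in>A. L2_inner P f v = L2_inner P g u)" for f g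
      by (rule A_iff)
    show "0 \<le> \<mu>" if "(f, \<mu> *\<^sub>R f) \<in> A" "L2.seminorm P f \<noteq> 0" for f \<mu>
      using gap[of \<mu>] ev[of \<mu>] that lam_pos by (cases "\<mu> = 0") fastforce+
    fix \<mu>
    have reg: "\<exists>C. \<forall>(f, g)\<in>A. L2.seminorm P f \<le> C * L2.seminorm P (g - \<nu> *\<^sub>R f)" if "\<nu> \<in> resolvent_set P A" for \<nu>
      using that by (simp add: resolvent_set_def seminorm_L2 fun_diff_def scaleR_fun_def)
    show "((\<forall>w\<in>L2 P. \<exists>(f, g)\<in>A. L2.seminorm P (g - \<mu> *\<^sub>R f - w) = 0) \<and>
        (\<exists>C. \<forall>(f, g)\<in>A. L2.seminorm P f \<le> C * L2.seminorm P (g - \<mu> *\<^sub>R f)))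
      \<or> (\<exists>f. (f, \<mu> *\<^sub>R f) \<in> A \<and> L2.seminorm P f \<noteq> 0) \<and>
        (\<exists>\<epsilon>>0. \<forall>\<mu>'. \<mu>' \<noteq> \<mu> \<and> \<bar>\<mu>' - \<mu>\<bar> < \<epsilon> \<longrightarrow>
          (\<exists>C. \<forall>(f, g)\<in>A. L2.seminorm P f \<le> C * L2.seminorm P (g - \<mu>' *\<^sub>R f)))"
    proof (cases "\<mu> \<in> resolvent_set P A")
      case True
      have "\<exists>(f, g)\<in>A. L2.seminorm P (g - \<mu> *\<^sub>R f - w) = 0" if w: "w \<in> L2 P" for w
      proof -
        obtain f g where fg: "(f, g) \<in> A" "AE x in P. g x - \<mu> * f x = w x"
          using True w by (auto simp: resolvent_set_def)
        have L: "(\<lambda>x. g x - \<mu> * f x - w x) \<in> L2 P"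
          using fg(1) w A_iff by (intro L2_diff L2_cmult) auto
        have "L2_norm P (\<lambda>x. g x - \<mu> * f x - w x) = 0"
          unfolding L2_norm_eq_0[OF L] using fg(2) by eventually_elim simp
        then have "L2.seminorm P (g - \<mu> *\<^sub>R f - w) = 0" by (simp add: seminorm_L2 fun_diff_def scaleR_fun_def)
        with fg(1) show ?thesis by blast
      qed
      with reg[OF True] show ?thesis by blast
    next
      case False
      then have sp: "\<mu> \<in> spectrum_of P A" by (simp add: spectrum_of_def)
      then have "eigenvalue_of P A \<mu>" "\<not> \<mu> islimpt spectrum_of P A"
        using discrete by (auto simp: discrete_spectrum_def)
      then obtain \<epsilon> where \<epsilon>: "0 < \<epsilon>" "\<And>x. x \<in> spectrum_of P A \<Longrightarrow> x \<noteq> \<mu> \<Longrightarrow> \<not> dist x \<mu> < \<epsilon>"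
        by (auto simp: islimpt_approachable)
      have "\<nu> \<in> resolvent_set P A" if "\<nu> \<noteq> \<mu> \<and> \<bar>\<nu> - \<mu>\<bar> < \<epsilon>" for \<nu>
        using \<epsilon>(2)[of \<nu>] that by (auto simp: spectrum_of_def dist_real_def)
      with reg \<epsilon>(1) \<open>eigenvalue_of P A \<mu>\<close> ev[of \<mu>] show ?thesis by blast
    qed
  qed
qed

lemma eigen_iff: "(f, \<mu> *\<^sub>R f) \<in> A \<longleftrightarrow> (f, \<lambda>x. \<mu> * f x) \<in> A"
  by (simp add: scaleR_fun_def)

lemma spectral_contraction_T:
  assumes s: "0 \<le> s"
  shows "spectral_contraction (L2 P) (L2_inner P) A (T s) (\<lambda>\<mu>. exp (- \<mu> * s))"
proof
  show "T s f \<in> L2 P" if "f \<in> L2 P" for f using T_L2[OF that s] .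
  show "L2_inner P (T s (f + g)) w = L2_inner P (T s f) w + L2_inner P (T s g) w"
    if "f \<in> L2 P" "g \<in> L2 P" "w \<in> L2 P" for f g w
    using inner_T_add[OF that(3,1,2) s] by (simp add: plus_fun_def L2_inner_def mult.commute)
  show "L2_inner P (T s (a *\<^sub>R f)) w = a * L2_inner P (T s f) w" for a f w
    by (simp add: L2_inner_def scaleR_fun_def T_cmult mult.assoc)
  show "L2.seminorm P (T s f) \<le> L2.seminorm P f" if "f \<in> L2 P" for f
    using T_contraction[OF that s] by (simp add: seminorm_L2)
  show "L2.seminorm P (T s f - exp (- \<mu> * s) *\<^sub>R f) = 0" if f: "(f, \<mu> *\<^sub>R f) \<in> A" for f \<mu>
  proof -
    have fL: "f \<in> L2 P" using f A_iff by blast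
    have L: "(\<lambda>x. T s f x - exp (- \<mu> * s) * f x) \<in> L2 P" by (intro L2_diff L2_cmult T_L2 fL s)
    have "L2_norm P (\<lambda>x. T s f x - exp (- \<mu> * s) * f x) = 0"
      unfolding L2_norm_eq_0[OF L]
      using eigenfunction_decay[OF _ s, of f \<mu>] f by (simp add: eigen_iff)
    then show ?thesis by (simp add: seminorm_L2 fun_diff_def scaleR_fun_def)
  qed
qed

lemma T_symmetric:
  assumes "f \<in> L2 P" "g \<in> L2 P" "0 \<le> s"
  shows "L2_inner P (T s f) g = L2_inner P f (T s g)"
  using spectral_contraction.T_sym[OF spectral_contraction_T[OF assms(3)] assms(1,2)] .

text \<open>Converse of \<open>eigenfunction_decay\<close>, for functions without known
  approximation by test functions. In Dynkin's formula at time 1 for \<open>(u, v)\<close>, paired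
  with \<open>g\<close>, symmetry of \<open>T\<close> moves the decay onto the scalar factor;
  integrating the exponential leaves \<open>L2_inner P g v = \<mu> * L2_inner P g u\<close>, which
  is membership in the adjoint.\<close>

lemma exponential_decay_eigenfunction:
  assumes g: "g \<in> L2 P" and \<mu>: "\<mu> \<noteq> 0"
    and decay: "\<And>s. 0 \<le> s \<Longrightarrow> AE z in P. T s g z = exp (- \<mu> * s) * g z"
  shows "(g, \<lambda>x. \<mu> * g x) \<in> A"
proof -
  have inner: "L2_inner P g (T s v) = exp (- \<mu> * s) * L2_inner P g v" if v: "v \<in> L2 P" and s: "0 \<le> s" for v s
  proof -
    have "L2_inner P g (T s v) = L2_inner P (T s g) v" by (rule T_symmetric[OF g v s, symmetric])
    also have "\<dots> = L2_inner P v (T s g)" by (simp add: L2_inner_def mult.commute)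
    also have "\<dots> = L2_inner P v (\<lambda>z. exp (- \<mu> * s) * g z)"
      by (intro L2_inner_cong_AE v T_L2 g s L2_cmult decay)
    also have "\<dots> = exp (- \<mu> * s) * L2_inner P v g" by (rule L2_inner_cmult_right)
    also have "L2_inner P v g = L2_inner P g v" by (simp add: L2_inner_def mult.commute)
    finally show ?thesis .
  qed
  have "L2_inner P g v = L2_inner P (\<lambda>x. \<mu> * g x) u" if uv: "(u, v) \<in> A" for u v
  proof -
    have uL: "u \<in> L2 P" and vL: "v \<in> L2 P" using uv A_iff by blast+
    let ?k = "L2_inner P g v"
    have i1: "((\<lambda>r. exp (- \<mu> * r) * ?k) has_integral (- exp (- \<mu> * 1) / \<mu> * ?k - (- exp (- \<mu> * 0) / \<mu> * ?k))) {0..1}"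
      using \<mu> by (intro fundamental_theorem_of_calculus)
        (auto intro!: derivative_eq_intros simp flip: has_real_derivative_iff_has_vector_derivative)
    have "((\<lambda>r. L2_inner P g (T r v)) has_integral (\<integral>r. L2_inner P g (T r v) \<partial>timeline 1)) {0..1}"
      by (rule timeline_has_integral[OF inner_T_integrable[OF g vL]])
    then have i2: "((\<lambda>r. exp (- \<mu> * r) * ?k) has_integral (\<integral>r. L2_inner P g (T r v) \<partial>timeline 1)) {0..1}"
      by (rule has_integral_eq[rotated]) (simp add: inner[OF vL])
    have "(\<integral>r. L2_inner P g (T r v) \<partial>timeline 1) = (1 - exp (- \<mu>)) / \<mu> * ?k"
      unfolding has_integral_unique[OF i2 i1] using \<mu> by (simp add: field_simps)
    then have "(exp (- \<mu>) - 1) * L2_inner P g u = - ((1 - exp (- \<mu>)) / \<mu> * ?k)"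
      using dynkin[OF uv g, of 1] inner[OF uL, of 1] by (simp add: algebra_simps)
    then have "(1 - exp (- \<mu>)) * (\<mu> * L2_inner P g u) = (1 - exp (- \<mu>)) * ?k"
      using \<mu> by (simp add: field_simps)
    moreover have "1 - exp (- \<mu>) \<noteq> 0" using \<mu> by simp
    ultimately have "\<mu> * L2_inner P g u = ?k" by simp
    then show ?thesis by (simp add: L2_inner_def mult.assoc)
  qed
  then show ?thesis using g L2_cmult by (subst A_iff) auto
qed

lemma coordinate_L2: "(\<lambda>z. z $ j) \<in> L2 P"
proof -
  have m: "(\<lambda>z. z $ j) \<in> borel_measurable P" for j
    unfolding measurable_P by (intro measurable_restrict_space1) simp
  have "integrable P (\<lambda>z. (z $ j)\<^sup>2)"
  proof (rule Bochner_Integration.integrable_bound)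
    show "integrable P (\<lambda>z. (norm z)\<^sup>2)" using isotropic by (simp add: centered_isotropic_def)
    have "(z $ j)\<^sup>2 \<le> (norm z)\<^sup>2" for z :: "real^'d"
      using power_mono[OF component_le_norm_cart[of z j], of 2] by simp
    then show "AE z in P. norm ((z $ j)\<^sup>2) \<le> norm ((norm z)\<^sup>2)" by simp
  qed (use m in measurable)
  with m show ?thesis by (simp add: L2_def)
qed

lemma coordinate_mean: "(\<integral>z. z $ j \<partial>P) = 0"
proof -
  have "integrable P (\<lambda>z. z)"
  proof (rule Bochner_Integration.integrable_bound)
    show "integrable P (\<lambda>z. 1 + (norm z)\<^sup>2)" using isotropic by (simp add: centered_isotropic_def)
    show "(\<lambda>z. z) \<in> borel_measurable P"
      unfolding measurable_P by (intro measurable_restrict_space1) simp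
    have "norm z \<le> 1 + (norm z)\<^sup>2" for z :: "real^'d"
      using sum_squares_bound[of 1 "norm z"] by (simp add: power2_eq_square) (smt (verit) mult_nonneg_nonneg norm_ge_zero)
    then show "AE z in P. norm z \<le> norm (1 + (norm z)\<^sup>2)" by simp
  qed
  then have "(\<integral>z. z $ j \<partial>P) = (\<integral>z. z \<partial>P) $ j"
    by (rule integral_bounded_linear[OF bounded_linear_vec_nth])
  then show ?thesis using isotropic by (simp add: centered_isotropic_def)
qed

lemma coordinate_inner: "L2_inner P (\<lambda>z. z $ i) (\<lambda>z. z $ j) = (if i = j then c else 0)"
proof -
  have "L2_inner P (\<lambda>z. z $ i) (\<lambda>z. z $ j) = covariance_matrix P $ i $ j"
    by (simp add: covariance_matrix_def L2_inner_def coordinate_mean)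
  then show ?thesis using isotropic by (simp add: centered_isotropic_def mat_def)
qed

lemma linear_L2_inner:
  assumes "w \<in> L2 P"
  shows "L2_inner P w (\<lambda>z. \<Sum>j\<in>S. a j * z $ j) = (\<Sum>j\<in>S. a j * L2_inner P w (\<lambda>z. z $ j))"
    and "(\<lambda>z. \<Sum>j\<in>S. a j * z $ j) \<in> L2 P"
proof -
  have "L2_inner P w (\<lambda>z. \<Sum>j\<in>S. a j * z $ j) = (\<Sum>j\<in>S. a j * L2_inner P w (\<lambda>z. z $ j)) \<and>
      (\<lambda>z. \<Sum>j\<in>S. a j * z $ j) \<in> L2 P" if "finite S"
    using that
  proof (induction S)
    case empty
    then show ?case by (simp add: L2_inner_def L2_const[OF P.finite_measure_axioms])
  next
    case (insert i S)
    then show ?case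
      using L2_inner_add_right[OF assms L2_cmult[OF coordinate_L2[of i], of "a i"], of "\<lambda>z. \<Sum>j\<in>S. a j * z $ j"]
        L2_add[OF L2_cmult[OF coordinate_L2[of i], of "a i"], of "\<lambda>z. \<Sum>j\<in>S. a j * z $ j"]
      by (simp add: L2_inner_cmult_right)
  qed
  then show "L2_inner P w (\<lambda>z. \<Sum>j\<in>S. a j * z $ j) = (\<Sum>j\<in>S. a j * L2_inner P w (\<lambda>z. z $ j))"
    "(\<lambda>z. \<Sum>j\<in>S. a j * z $ j) \<in> L2 P" by simp_all
qed

lemma linear_eigenfunction: "(\<lambda>z. \<Sum>j\<in>UNIV. a j * z $ j) \<in> eigenspace P A lam"
  unfolding eigenspace_lam using linear_L2_inner(2)[OF coordinate_L2] by auto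

lemma coordinate_eigenfunction: "(\<lambda>z. z $ j, \<lambda>z. lam * z $ j) \<in> A"
proof -
  have "(\<lambda>z. \<Sum>i\<in>UNIV. (if i = j then 1 else 0) * z $ i) = (\<lambda>z::real^'d. z $ j)"
    by (rule ext) (simp add: if_distrib[of "\<lambda>x. x * _"] sum.delta cong: if_cong)
  then show ?thesis
    using linear_eigenfunction[of "\<lambda>i. if i = j then 1 else 0"] by (simp add: eigenspace_def)
qed

(* An invariant set B cuts the eigenfunctions z_j into eigenfunctions for the same eigenvalue, which
   are linear by hypothesis. *)
lemma kernel_constant:
  assumes f: "(f, \<lambda>x. 0) \<in> A"
  shows "AE z in P. f z = (\<integral>z. f z \<partial>P)"
proof -
  define m where "m = (\<integral>z. f z \<partial>P)"
  have fL: "f \<in> L2 P" using f A_iff by blast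
  have fi: "integrable P f" by (rule L2_integrable[OF P.finite_measure_axioms fL])
  \<comment> \<open>Cutting at the mean makes one level set enough: if \<open>B\<close> is conull,
    \<open>f\<close> exceeds its mean almost everywhere, which is absurd; if \<open>B\<close> is
    null, \<open>f\<close> is at most its mean and therefore equal to it.\<close>
  define B where "B = {z \<in> M. m < f z}"
  have BS: "B \<in> sets (borel_of M)"
    using L2_measurable_M[OF fL] unfolding B_def by (simp add: borel_measurable_iff_greater space_restrict_space)
  define b :: "real^'d \<Rightarrow> real" where "b = indicator B"
  have bm: "b \<in> borel_measurable (borel_of M)" unfolding b_def using BS by simp
  have bzL: "(\<lambda>z. b z * z $ j) \<in> L2 P" for j
  proof -
    have m: "(\<lambda>z. b z * z $ j) \<in> borel_measurable P"
      using bm L2_measurable[OF coordinate_L2[of j]] by (simp add: measurable_P)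
    have "integrable P (\<lambda>z. (b z * z $ j)\<^sup>2)"
      by (rule Bochner_Integration.integrable_bound[OF L2_square_integrable[OF coordinate_L2[of j]]])
        (use m in \<open>auto simp: b_def indicator_def\<close>)
    with m show ?thesis by (simp add: L2_def)
  qed
  have bz_eig: "(\<lambda>z. b z * z $ j, \<lambda>z. lam * (b z * z $ j)) \<in> A" for j
  proof (rule exponential_decay_eigenfunction[OF bzL])
    show "lam \<noteq> 0" using lam_pos by simp
    fix s :: real assume s: "0 \<le> s"
    have inv: "AE z in P. T s f z = f z"
      using eigenfunction_decay[of f 0 s] f s by simp
    show "AE z in P. T s (\<lambda>z. b z * z $ j) z = exp (- lam * s) * (b z * z $ j)"
      using AE_constant_along_kernel[OF fL s inv] eigenfunction_decay[OF coordinate_eigenfunction s, of j] AE_space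
    proof eventually_elim
      case (elim z)
      then have z: "z \<in> M" by (simp add: space_P)
      \<comment> \<open>\<open>f\<close>, hence \<open>b\<close>, does not change along the kernel,
        so \<open>b z\<close> leaves the integral and the decay of the coordinate remains.\<close>
      have "T s (\<lambda>z. b z * z $ j) z = (\<integral>z'. b z * z' $ j \<partial>K s z)"
        unfolding transition_op_def
      proof (rule integral_cong_AE)
        have zm: "(\<lambda>z. z $ j) \<in> borel_measurable (borel_of M)" by (rule L2_measurable_M[OF coordinate_L2])
        show "(\<lambda>z'. b z' * z' $ j) \<in> borel_measurable (K s z)" "(\<lambda>z'. b z * z' $ j) \<in> borel_measurable (K s z)"
          unfolding measurable_K[OF s z] using bm zm by simp_all
        show "AE z' in K s z. b z' * z' $ j = b z * z' $ j"
          using elim(1) AE_space[of "K s z"]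
          by eventually_elim (simp add: K_space(3)[OF s z] b_def B_def indicator_def z)
      qed
      also have "\<dots> = b z * T s (\<lambda>z. z $ j) z" by (simp add: transition_op_def)
      finally show ?case using elim(2) by simp
    qed
  qed
  have "\<exists>a. AE z in P. b z * z $ j = (\<Sum>k\<in>UNIV. a k * z $ k)" for j
  proof -
    have "(\<lambda>z. b z * z $ j) \<in> eigenspace P A lam" using bz_eig[of j] by (simp add: eigenspace_def)
    then show ?thesis unfolding eigenspace_lam by simp
  qed
  then obtain a where a: "\<And>j. AE z in P. b z * z $ j = (\<Sum>k\<in>UNIV. a j k * z $ k)" by metis
  define S :: "real^'d^'d" where "S = (\<chi> j k. a j k)"
  have "AE z in P. \<forall>j. b z * z $ j = (\<Sum>k\<in>UNIV. a j k * z $ k)"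
    using a by (simp add: AE_all_countable)
  then have "AE z in P. indicator B z *\<^sub>R z = S *v z"
    by eventually_elim (simp add: vec_eq_iff S_def matrix_vector_mult_def b_def)
  then consider "AE z in P. z \<in> B" | "AE z in P. z \<notin> B" using trivial_sets by blast
  then show ?thesis
  proof cases
    case 1
    then have "AE z in P. m < f z" by eventually_elim (simp add: B_def)
    then have "m < (\<integral>z. f z \<partial>P)" by (rule P.expectation_greater[OF fi])
    then show ?thesis by (simp add: m_def)
  next
    case 2
    then have le: "AE z in P. 0 \<le> m - f z" using AE_space by eventually_elim (auto simp: B_def space_P)
    have "(\<integral>z. m - f z \<partial>P) = 0" using fi by (simp add: m_def P.prob_space)
    then have "AE z in P. m - f z = 0"
      using integral_nonneg_eq_0_iff_AE[OF _ le] fi by simp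
    then show ?thesis unfolding m_def[symmetric] by eventually_elim simp
  qed
qed

lemma kernel_seminorm:
  assumes "(f, 0) \<in> A"
  shows "L2.seminorm P (f - L2_inner P f (\<lambda>x. 1) *\<^sub>R (\<lambda>x. 1)) = 0"
proof -
  have f: "(f, \<lambda>x. 0) \<in> A" using assms by (simp add: zero_fun_def)
  have L: "(\<lambda>x. f x - (\<integral>z. f z \<partial>P)) \<in> L2 P"
    using f A_iff by (intro L2_diff L2_const P.finite_measure_axioms) blast
  have "L2_norm P (\<lambda>x. f x - (\<integral>z. f z \<partial>P)) = 0"
    unfolding L2_norm_eq_0[OF L] using kernel_constant[OF f] by eventually_elim simp
  then show ?thesis by (simp add: seminorm_L2 fun_diff_def scaleR_fun_def L2_inner_def)
qed

lemma spectral_assms: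
  assumes s: "0 \<le> s"
  shows "(\<lambda>x. 1, 0) \<in> A" "L2_inner P (\<lambda>x. 1) (\<lambda>x. 1) = 1" "exp (- 0 * s) = (1 :: real)"
    "(f, \<mu> *\<^sub>R f) \<in> A \<Longrightarrow> L2.seminorm P f \<noteq> 0 \<Longrightarrow> \<mu> \<noteq> 0 \<Longrightarrow> lam \<le> \<mu>"
    "(f, \<mu> *\<^sub>R f) \<in> A \<Longrightarrow> L2.seminorm P f \<noteq> 0 \<Longrightarrow> \<mu> \<noteq> 0 \<Longrightarrow> exp (- \<mu> * s) \<le> exp (- lam * s)"
proof -
  show "(\<lambda>x. 1, 0) \<in> A" using constant_in_kernel by (simp add: zero_fun_def)
  show "L2_inner P (\<lambda>x. 1) (\<lambda>x. 1) = 1" by (simp add: L2_inner_def P.prob_space)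
  show le: "lam \<le> \<mu>" if "(f, \<mu> *\<^sub>R f) \<in> A" "L2.seminorm P f \<noteq> 0" "\<mu> \<noteq> 0" for f \<mu>
  proof -
    have "f \<in> L2 P" using that(1) A_iff by blast
    then have "eigenvalue_of P A \<mu>"
      using that(1,2) L2_norm_eq_0 unfolding eigenvalue_of_def
      by (auto simp: eigenspace_def eigen_iff seminorm_L2 intro!: bexI[of _ f])
    then show ?thesis using gap that(3) by blast
  qed
  show "exp (- \<mu> * s) \<le> exp (- lam * s)" if "(f, \<mu> *\<^sub>R f) \<in> A" "L2.seminorm P f \<noteq> 0" "\<mu> \<noteq> 0" for f \<mu>
    using mult_right_mono[OF le[OF that] s] by simp
qed simp

text \<open>\<open>contraction_bound\<close> with the constant 1 as unit vector of the kernel and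
  \<open>a = exp (- lam * s)\<close>; mean zero removes the rank-one term.\<close>

lemma spectral_gap:
  assumes f: "f \<in> L2 P" and mean: "(\<integral>z. f z \<partial>P) = 0" and s: "0 \<le> s"
  shows "L2_inner P f (T s f) \<le> exp (- lam * s) * L2_inner P f f"
proof -
  interpret sc: spectral_contraction "L2 P" "L2_inner P" A "T s" "\<lambda>\<mu>. exp (- \<mu> * s)"
    by (rule spectral_contraction_T[OF s])
  have "L2_inner P f (T s f) \<le> exp (- lam * s) * L2_inner P f f + (1 - exp (- lam * s)) * (L2_inner P f (\<lambda>x. 1))\<^sup>2"
    using f kernel_seminorm spectral_assms[OF s] by (intro sc.contraction_bound) auto
  then show ?thesis using mean by (simp add: L2_inner_def)
qed

text \<open>The projection of \<open>f\<close> onto linear functions is subtracted; its coefficients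
  divide by \<open>c\<close>, the squared norm of each coordinate. The rest is orthogonal to every
  eigenvector: to constants by mean zero, to linear functions by construction, and to the others by
  \<open>contraction_equality\<close>, where \<open>s > 0\<close> makes the exponentials strictly
  different. By totality it is null.\<close>

lemma spectral_gap_equality:
  assumes f: "f \<in> L2 P" and mean: "(\<integral>z. f z \<partial>P) = 0" and s: "0 < s"
    and eq: "exp (- lam * s) * L2_inner P f f \<le> L2_inner P f (T s f)"
  shows "AE z in P. f z = (\<Sum>j\<in>UNIV. (L2_inner P f (\<lambda>z. z $ j) / c) * z $ j)"
proof -
  have s0: "0 \<le> s" using s by simp
  interpret sc: spectral_contraction "L2 P" "L2_inner P" A "T s" "\<lambda>\<mu>. exp (- \<mu> * s)"
    by (rule spectral_contraction_T[OF s0])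
  let ?a = "\<lambda>j. L2_inner P f (\<lambda>z. z $ j) / c"
  let ?l = "\<lambda>z. \<Sum>j\<in>UNIV. ?a j * z $ j"
  define g where "g z = f z - ?l z" for z
  have l_eig: "(?l, lam *\<^sub>R ?l) \<in> A"
    using linear_eigenfunction[of ?a] by (simp add: eigenspace_def scaleR_fun_def)
  have lL: "?l \<in> L2 P" using l_eig A_iff by blast
  have gL: "g \<in> L2 P" unfolding g_def by (rule L2_diff[OF f lL])
  have g_inner: "L2_inner P w g = L2_inner P w f - L2_inner P w ?l" if "w \<in> L2 P" for w
    unfolding g_def by (rule L2_inner_diff_right[OF that f lL])
  have comm: "L2_inner P u v = L2_inner P v u" for u v by (simp add: L2_inner_def mult.commute)
  note l_inner = linear_L2_inner(1)[where a = ?a and S = UNIV]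
  have eq': "L2_inner P f (T s f) = exp (- lam * s) * L2_inner P f f +
      (1 - exp (- lam * s)) * (L2_inner P f (\<lambda>x. 1))\<^sup>2"
    using eq spectral_gap[OF f mean s0] mean by (simp add: L2_inner_def)
  have "L2_inner P g w = 0" if w: "(w, \<mu> *\<^sub>R w) \<in> A" for w \<mu>
  proof -
    have wL: "w \<in> L2 P" using w A_iff by blast
    consider "L2.seminorm P w = 0" | "\<mu> = 0" | "\<mu> = lam" "\<mu> \<noteq> 0"
      | "L2.seminorm P w \<noteq> 0" "\<mu> \<noteq> 0" "\<mu> \<noteq> lam" by blast
    then show ?thesis
    proof cases
      case 1
      then show ?thesis using abs_L2_inner_le[OF gL wL] by (simp add: seminorm_L2)
    next
      case 2
      then have w0: "(w, \<lambda>x. 0) \<in> A" using w by (simp add: scaleR_fun_def)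
      have "L2_inner P g w = L2_inner P g (\<lambda>x. (\<integral>z. w z \<partial>P) * 1)"
        using kernel_constant[OF w0] by (intro L2_inner_cong_AE gL wL) (auto intro: L2_const P.finite_measure_axioms)
      also have "\<dots> = (\<integral>z. w z \<partial>P) * L2_inner P (\<lambda>x. 1) g"
        by (subst L2_inner_cmult_right) (simp add: comm[of g])
      also have "L2_inner P (\<lambda>x. 1) g = 0"
      proof -
        have "L2_inner P (\<lambda>x. 1) ?l = 0"
          using spectral.eigenvectors_orthogonal[OF _ l_eig, of "\<lambda>x. 1" 0] spectral_assms(1)[OF s0] lam_pos by simp
        then show ?thesis
          using g_inner[OF L2_const[OF P.finite_measure_axioms], of 1] mean by (simp add: L2_inner_def)
      qed
      finally show ?thesis by simp
    next
      case 3
      then have "w \<in> eigenspace P A lam" using w by (simp add: eigenspace_def scaleR_fun_def)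
      then obtain b where b: "AE z in P. w z = (\<Sum>j\<in>UNIV. b j * z $ j)" unfolding eigenspace_lam by blast
      have coord: "L2_inner P (\<lambda>z. z $ i) g = 0" for i
        using g_inner[OF coordinate_L2[of i]] l_inner[OF coordinate_L2[of i]] c_pos
        by (simp add: coordinate_inner comm[of "\<lambda>z. z $ i" f] if_distrib[of "\<lambda>x. _ * x"] sum.delta cong: if_cong)
      have "L2_inner P g (\<lambda>z. \<Sum>j\<in>UNIV. b j * z $ j) = 0"
        using linear_L2_inner(1)[OF gL] coord by (simp add: comm[of g])
      then show ?thesis using L2_inner_cong_AE[OF gL wL linear_L2_inner(2)[OF gL] b] by simp
    next
      case 4
      have "lam < \<mu>" using spectral_assms(4)[OF s0 w] 4 by simp
      then have "exp (- \<mu> * s) < exp (- lam * s)" using s by simp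
      then have "L2_inner P f w = 0"
        using f eq' w 4 kernel_seminorm spectral_assms[OF s0]
        by (intro sc.contraction_equality[of "\<lambda>x. 1" "exp (- lam * s)" f w \<mu>]) auto
      moreover have "L2_inner P w ?l = 0"
        using spectral.eigenvectors_orthogonal[OF w l_eig] 4 by simp
      ultimately show ?thesis using g_inner[OF wL] by (simp add: comm)
    qed
  qed
  then have "L2_inner P g g = 0" by (rule spectral.eigenvectors_total[OF gL])
  then have "L2_norm P g = 0" by (simp add: L2_norm_def L2_inner_def power2_eq_square)
  then have "AE z in P. g z = 0" using L2_norm_eq_0[OF gL] by simp
  then show ?thesis by eventually_elim (simp add: g_def)
qed

end

section \<open>Minimizers of the alignment loss\<close>

text \<open>\<open>radial\<close> carries the Gaussian form of the density: an orthogonal map that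
  preserves \<open>M\<close> also preserves \<open>p\<close>.\<close>

locale alignment = discrete_langevin M vol p K lam c + geo: submanifold_density dim M vol p
  for dim :: "'m::finite itself" and M :: "(real^'d) set" and vol p K lam c +
  fixes t :: real
  assumes t_pos: "0 < t"
    and radial: "z \<in> M \<Longrightarrow> w \<in> M \<Longrightarrow> norm w = norm z \<Longrightarrow> p w = p z"
begin

abbreviation "preserving \<equiv> distribution_preserving M P"

lemma preserving_measurable: "h \<in> preserving \<Longrightarrow> h \<in> borel_of M \<rightarrow>\<^sub>M borel_of M"
  by (simp add: distribution_preserving_def)

lemma component_measurable: "h \<in> borel_of M \<rightarrow>\<^sub>M borel_of M \<Longrightarrow> (\<lambda>z. h z $ j) \<in> borel_measurable (borel_of M)"
  by (rule measurable_compose[OF _ L2_measurable_M[OF coordinate_L2]])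

lemma preserving_integral:
  fixes f :: "real^'d \<Rightarrow> real"
  assumes h: "h \<in> preserving" and f: "f \<in> borel_measurable (borel_of M)"
  shows "(\<integral>z. f (h z) \<partial>P) = (\<integral>z. f z \<partial>P)" "integrable P f \<Longrightarrow> integrable P (\<lambda>z. f (h z))"
proof -
  have hP: "h \<in> P \<rightarrow>\<^sub>M borel_of M" and d: "distr P (borel_of M) h = P"
    using h by (auto simp: distribution_preserving_def measurable_P)
  show "(\<integral>z. f (h z) \<partial>P) = (\<integral>z. f z \<partial>P)" using integral_distr[OF hP f] d by simp
  show "integrable P (\<lambda>z. f (h z))" if "integrable P f" using integrable_distr_eq[OF hP f] d that by simp
qed

lemma preserving_component:
  assumes h: "h \<in> preserving"
  shows "(\<lambda>z. h z $ j) \<in> L2 P" "(\<integral>z. h z $ j \<partial>P) = 0"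
    "L2_inner P (\<lambda>z. h z $ i) (\<lambda>z. h z $ j) = (if i = j then c else 0)"
proof -
  have m: "(\<lambda>z. z $ j) \<in> borel_measurable (borel_of M)" for j by (rule L2_measurable_M[OF coordinate_L2])
  have "integrable P (\<lambda>z. (h z $ j)\<^sup>2)"
    using preserving_integral(2)[OF h, of "\<lambda>z. (z $ j)\<^sup>2"] m L2_square_integrable[OF coordinate_L2] by simp
  then show "(\<lambda>z. h z $ j) \<in> L2 P"
    using component_measurable[OF preserving_measurable[OF h]] by (simp add: L2_def measurable_P)
  show "(\<integral>z. h z $ j \<partial>P) = 0" using preserving_integral(1)[OF h m] by (simp add: coordinate_mean)
  show "L2_inner P (\<lambda>z. h z $ i) (\<lambda>z. h z $ j) = (if i = j then c else 0)"
    using preserving_integral(1)[OF h, of "\<lambda>z. z $ i * z $ j"] m coordinate_inner[of i j]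
    by (simp add: L2_inner_def)
qed

text \<open>The squared norm splits into components, and each contributes an \<open>energy\<close>
  whose diagonal term is \<open>c\<close>, because \<open>h\<close> has the covariance of the
  coordinates.\<close>

lemma alignment_loss_eq:
  assumes h: "h \<in> preserving"
  shows "alignment_loss P (K t) h =
    ennreal (\<Sum>j\<in>UNIV. 2 * (c - L2_inner P (\<lambda>z. h z $ j) (T t (\<lambda>z. h z $ j))))"
proof -
  have t0: "0 \<le> t" using t_pos by simp
  have hm: "(\<lambda>z. h z $ j) \<in> borel_measurable (borel_of M)" for j
    by (rule component_measurable[OF preserving_measurable[OF h]])
  have norm: "ennreal ((norm (x - y))\<^sup>2) = (\<Sum>j\<in>UNIV. ennreal ((x $ j - y $ j)\<^sup>2))" for x y :: "real^'d"
    by (subst sum_ennreal) (simp_all add: norm_vec_def L2_set_def sum_nonneg)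
  have "alignment_loss P (K t) h =
      (\<integral>\<^sup>+z. (\<Sum>j\<in>UNIV. \<integral>\<^sup>+z'. ennreal ((h z' $ j - h z $ j)\<^sup>2) \<partial>K t z) \<partial>P)"
    unfolding alignment_loss_def norm
    by (intro nn_integral_cong nn_integral_sum) (use hm in \<open>simp add: measurable_K[OF t0] space_P\<close>)
  also have "\<dots> = (\<Sum>j\<in>UNIV. \<integral>\<^sup>+z. (\<integral>\<^sup>+z'. ennreal ((h z' $ j - h z $ j)\<^sup>2) \<partial>K t z) \<partial>P)"
    by (intro nn_integral_sum increment_measurable hm t0)
  also have "\<dots> = (\<Sum>j\<in>UNIV. ennreal (2 * (c - L2_inner P (\<lambda>z. h z $ j) (T t (\<lambda>z. h z $ j)))))"
    using energy(1)[OF preserving_component(1)[OF h] t0] preserving_component(3)[OF h] by simp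
  also have "\<dots> = ennreal (\<Sum>j\<in>UNIV. 2 * (c - L2_inner P (\<lambda>z. h z $ j) (T t (\<lambda>z. h z $ j))))"
    using energy(2)[OF preserving_component(1)[OF h] t0] preserving_component(3)[OF h]
    by (intro sum_ennreal) simp
  finally show ?thesis .
qed

lemma preserving_correlation_le:
  assumes h: "h \<in> preserving"
  shows "L2_inner P (\<lambda>z. h z $ j) (T t (\<lambda>z. h z $ j)) \<le> exp (- lam * t) * c"
  using spectral_gap[OF preserving_component(1,2)[OF h], of t j] preserving_component(3)[OF h, of j j] t_pos
  by simp

definition optimal_loss :: ennreal where
  "optimal_loss = ennreal (\<Sum>j\<in>(UNIV :: 'd set). 2 * (c - exp (- lam * t) * c))"

lemma optimal_loss_le:
  assumes h: "h \<in> preserving"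
  shows "optimal_loss \<le> alignment_loss P (K t) h"
  unfolding alignment_loss_eq[OF h] optimal_loss_def
  using preserving_correlation_le[OF h] by (intro ennreal_leI sum_mono) auto

text \<open>The components of such a map lie in the eigenspace of \<open>lam\<close>, where
  \<open>T t\<close> is exactly multiplication by \<open>exp (- lam * t)\<close>; preservation of
  the law supplies their norm.\<close>

lemma linear_AE_optimal:
  assumes h: "h \<in> preserving" and Q: "AE z in P. h z = Q *v z"
  shows "alignment_loss P (K t) h = optimal_loss"
proof -
  have t0: "0 \<le> t" using t_pos by simp
  have "L2_inner P (\<lambda>z. h z $ j) (T t (\<lambda>z. h z $ j)) = exp (- lam * t) * c" for j
  proof -
    have hL: "(\<lambda>z. h z $ j) \<in> L2 P" by (rule preserving_component(1)[OF h])
    have "AE z in P. h z $ j = (\<Sum>k\<in>UNIV. Q $ j $ k * z $ k)"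
      using Q by eventually_elim (simp add: matrix_vector_mult_def)
    then have "(\<lambda>z. h z $ j) \<in> eigenspace P A lam" unfolding eigenspace_lam using hL by blast
    then have "AE z in P. T t (\<lambda>z. h z $ j) z = exp (- lam * t) * h z $ j"
      by (intro eigenfunction_decay t0) (simp add: eigenspace_def)
    then have "L2_inner P (\<lambda>z. h z $ j) (T t (\<lambda>z. h z $ j)) =
        L2_inner P (\<lambda>z. h z $ j) (\<lambda>z. exp (- lam * t) * h z $ j)"
      by (intro L2_inner_cong_AE hL T_L2 t0 L2_cmult)
    also have "\<dots> = exp (- lam * t) * L2_inner P (\<lambda>z. h z $ j) (\<lambda>z. h z $ j)"
      by (rule L2_inner_cmult_right)
    finally show ?thesis using preserving_component(3)[OF h, of j j] by simp
  qed
  then show ?thesis unfolding alignment_loss_eq[OF h] optimal_loss_def by simp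
qed

lemma norm_orthogonal: "orthogonal_matrix Q \<Longrightarrow> norm (Q *v z) = norm z" for Q :: "real^'d^'d"
  using orthogonal_transformation_matrix[of "(*v) Q"] orthogonal_transformation_norm[of "(*v) Q" z] by simp

lemma orthogonal_preserving:
  assumes Q: "orthogonal_matrix Q" "(\<lambda>z. Q *v z) ` M = M"
  shows "(\<lambda>z. Q *v z) \<in> preserving" "distr P (borel_of M) (\<lambda>z. Q *v z) = P"
proof -
  have "p (Q *v z) = p z" if "z \<in> M" for z
    using that Q norm_orthogonal[OF Q(1)] by (intro radial) auto
  from geo.law_orthogonal[OF Q this]
  show "(\<lambda>z. Q *v z) \<in> preserving" "distr P (borel_of M) (\<lambda>z. Q *v z) = P"
    by (simp_all add: distribution_preserving_def)
qed

lemma AE_orthogonal_preserving: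
  assumes h: "h \<in> borel_of M \<rightarrow>\<^sub>M borel_of M" and Q: "orthogonal_matrix Q" "(\<lambda>z. Q *v z) ` M = M"
    and eq: "AE z in P. h z = Q *v z"
  shows "h \<in> preserving"
proof -
  have "distr P (borel_of M) h = distr P (borel_of M) (\<lambda>z. Q *v z)"
    using h orthogonal_preserving(1)[OF Q] eq
    by (intro distr_cong_AE) (auto simp: measurable_P distribution_preserving_def)
  then show ?thesis using h orthogonal_preserving(2)[OF Q] by (simp add: distribution_preserving_def)
qed

text \<open>\<open>Q *v z\<close> lies in the closed set \<open>M\<close> for almost every, hence
  for every \<open>z\<close> of \<open>M\<close>. For the other inclusion,
  \<open>transpose Q\<close> maps \<open>h z\<close> to \<open>z\<close> almost surely; since
  \<open>h z\<close> has law \<open>P\<close>, almost every point is mapped into \<open>M\<close> by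
  \<open>transpose Q\<close>, and full support applies again.\<close>

lemma preserving_orthogonal_onto:
  assumes h: "h \<in> preserving" and Q: "orthogonal_matrix Q" and eq: "AE z in P. h z = Q *v z"
  shows "(\<lambda>z. Q *v z) ` M = M"
proof
  have cont: "continuous_on UNIV ((*v) B)" for B :: "real^'d^'d"
    by (intro linear_continuous_on matrix_vector_mul_bounded_linear)
  have hP: "h \<in> P \<rightarrow>\<^sub>M borel_of M" and d: "distr P (borel_of M) h = P"
    using h by (auto simp: distribution_preserving_def measurable_P)
  have "M \<subseteq> {z. Q *v z \<in> M}"
  proof (rule geo.full_support)
    have "AE z in P. Q *v z \<in> M"
      using eq AE_space
    proof eventually_elim
      case (elim z)
      then show ?case using measurable_space[OF hP, of z] by (simp add: space_restrict_space)
    qed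
    then show "AE z in vol. z \<in> {z. Q *v z \<in> M}" by (simp add: geo.AE_law_iff)
    show "closed {z. Q *v z \<in> M}"
      using continuous_closed_preimage[OF cont closed_UNIV closed_M] by (simp add: vimage_def)
  qed
  then show "(\<lambda>z. Q *v z) ` M \<subseteq> M" by auto
  have "M \<subseteq> {z. transpose Q *v z \<in> M}"
  proof (rule geo.full_support)
    have clos: "closed {z. transpose Q *v z \<in> M}"
      using continuous_closed_preimage[OF cont closed_UNIV closed_M] by (simp add: vimage_def del: transpose_matrix_vector)
    then have "{z \<in> space (borel_of M). z \<in> {z. transpose Q *v z \<in> M}} \<in> sets (borel_of M)"
      using borel_of_closed[OF clos, of M] by (simp add: space_restrict_space Int_def)
    moreover have "AE z in P. h z \<in> {z. transpose Q *v z \<in> M}"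
      using eq AE_space
      by eventually_elim (simp add: orthogonal_cancel[OF Q] space_P)
    ultimately have "AE z in distr P (borel_of M) h. z \<in> {z. transpose Q *v z \<in> M}"
      using hP by (subst AE_distr_iff) auto
    then show "AE z in vol. z \<in> {z. transpose Q *v z \<in> M}" unfolding d geo.AE_law_iff .
    show "closed {z. transpose Q *v z \<in> M}" by (rule clos)
  qed
  then show "M \<subseteq> (\<lambda>z. Q *v z) ` M"
    using orthogonal_cancel(2)[OF Q] by (metis (no_types, lifting) image_eqI mem_Collect_eq subset_iff)
qed

text \<open>The deficits of the components against the gap bound are nonnegative and sum to 0, so
  every component is linear. That \<open>h\<close> has covariance \<open>c\<close> times the
  identity then reads \<open>Q ** transpose Q = mat 1\<close>.\<close>

lemma minimizer_orthogonal:
  assumes h: "h \<in> preserving" and le: "alignment_loss P (K t) h \<le> optimal_loss"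
  obtains Q where "orthogonal_matrix Q" "(\<lambda>z. Q *v z) ` M = M" "AE z in P. h z = Q *v z"
proof -
  let ?x = "\<lambda>j. L2_inner P (\<lambda>z. h z $ j) (T t (\<lambda>z. h z $ j))"
  note hL = preserving_component(1)[OF h]
  \<comment> \<open>Makes the optimal value a nonnegative real, so that the inequality between
    extended values can be read in the reals.\<close>
  have e1: "exp (- lam * t) \<le> 1" using lam_pos t_pos by simp
  then have "0 \<le> (\<Sum>j\<in>(UNIV :: 'd set). 2 * (c - exp (- lam * t) * c))" using c_pos by (intro sum_nonneg) simp
  then have "(\<Sum>j\<in>UNIV. 2 * (c - ?x j)) \<le> (\<Sum>j\<in>(UNIV :: 'd set). 2 * (c - exp (- lam * t) * c))"
    using le unfolding alignment_loss_eq[OF h] optimal_loss_def by simp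
  then have "(\<Sum>j\<in>UNIV. 2 * (exp (- lam * t) * c - ?x j)) \<le> 0"
    by (simp add: sum_subtractf algebra_simps sum_distrib_left[symmetric])
  moreover have nonneg: "0 \<le> 2 * (exp (- lam * t) * c - ?x j)" for j using preserving_correlation_le[OF h, of j] by simp
  ultimately have "(\<Sum>j\<in>UNIV. 2 * (exp (- lam * t) * c - ?x j)) = 0"
    by (intro antisym sum_nonneg) auto
  then have "2 * (exp (- lam * t) * c - ?x j) = 0" for j
    using nonneg by (subst (asm) sum_nonneg_eq_0_iff) auto
  then have eq: "exp (- lam * t) * L2_inner P (\<lambda>z. h z $ j) (\<lambda>z. h z $ j) \<le> ?x j" for j
    using preserving_component(3)[OF h, of j j] by simp
  define Q :: "real^'d^'d" where "Q = (\<chi> i k. L2_inner P (\<lambda>z. h z $ i) (\<lambda>z. z $ k) / c)"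
  have comp: "AE z in P. h z $ j = (\<Sum>k\<in>UNIV. Q $ j $ k * z $ k)" for j
    using spectral_gap_equality[OF hL preserving_component(2)[OF h] t_pos eq, of j] by (simp add: Q_def)
  then have "AE z in P. \<forall>j. h z $ j = (\<Sum>k\<in>UNIV. Q $ j $ k * z $ k)" by (simp add: AE_all_countable)
  then have hQ: "AE z in P. h z = Q *v z"
    by eventually_elim (simp add: vec_eq_iff matrix_vector_mult_def)
  have "(Q ** transpose Q) $ i $ j = mat 1 $ i $ j" for i j
  proof -
    have "(if i = j then c else 0) = L2_inner P (\<lambda>z. h z $ i) (\<lambda>z. \<Sum>k\<in>UNIV. Q $ j $ k * z $ k)"
      using preserving_component(3)[OF h, of i j]
        L2_inner_cong_AE[OF hL[of i] hL[of j] linear_L2_inner(2)[OF hL[of i]] comp[of j]] by simp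
    also have "\<dots> = (\<Sum>k\<in>UNIV. Q $ j $ k * L2_inner P (\<lambda>z. h z $ i) (\<lambda>z. z $ k))"
      by (rule linear_L2_inner(1)[OF hL])
    also have "\<dots> = c * (Q ** transpose Q) $ i $ j"
      using c_pos by (simp add: Q_def matrix_matrix_mult_def transpose_def sum_distrib_left field_simps)
    finally show ?thesis using c_pos by (simp add: mat_def split: if_splits)
  qed
  then have "Q ** transpose Q = mat 1" by (simp add: vec_eq_iff)
  then have oQ: "orthogonal_matrix Q" by (simp add: orthogonal_matrix_def matrix_left_right_inverse)
  show ?thesis by (rule that[OF oQ preserving_orthogonal_onto[OF h oQ hQ] hQ])
qed

text \<open>The identity matrix is an admissible symmetry and attains the lower bound, so minimizing
  is the same as attaining it.\<close>

lemma minimizers_eq: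
  "alignment_minimizers M P (K t) = {h \<in> borel_of M \<rightarrow>\<^sub>M borel_of M.
     \<exists>Q. orthogonal_matrix Q \<and> (\<lambda>z. Q *v z) ` M = M \<and> (AE z in P. h z = Q *v z)}"
proof safe
  fix h assume "h \<in> alignment_minimizers M P (K t)"
  then have h: "h \<in> preserving" and min: "\<And>g. g \<in> preserving \<Longrightarrow> alignment_loss P (K t) h \<le> alignment_loss P (K t) g"
    by (auto simp: alignment_minimizers_def)
  show "h \<in> borel_of M \<rightarrow>\<^sub>M borel_of M" by (rule preserving_measurable[OF h])
  have id: "orthogonal_matrix (mat 1 :: real^'d^'d)" "(\<lambda>z. mat 1 *v z) ` M = M"
    by (simp_all add: orthogonal_matrix_def transpose_mat)
  have "alignment_loss P (K t) h \<le> optimal_loss"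
    using min[OF orthogonal_preserving(1)[OF id]] linear_AE_optimal[OF orthogonal_preserving(1)[OF id], of "mat 1"]
    by simp
  then show "\<exists>Q. orthogonal_matrix Q \<and> (\<lambda>z. Q *v z) ` M = M \<and> (AE z in P. h z = Q *v z)"
    using minimizer_orthogonal[OF h] by metis
next
  fix h Q assume h: "h \<in> borel_of M \<rightarrow>\<^sub>M borel_of M" "orthogonal_matrix Q" "(\<lambda>z. Q *v z) ` M = M"
    "AE z in P. h z = Q *v z"
  have "h \<in> preserving" by (rule AE_orthogonal_preserving[OF h])
  then show "h \<in> alignment_minimizers M P (K t)"
    using linear_AE_optimal[OF _ h(4)] optimal_loss_le by (simp add: alignment_minimizers_def)
qed

end

theorem theorem4p3:
  fixes M :: "(real^'d) set"
    and vol :: "(real^'d) measure"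
    and p :: "real^'d \<Rightarrow> real"
    and K :: "real \<Rightarrow> real^'d \<Rightarrow> (real^'d) measure"
    and c lam t :: real
  assumes "properly_embedded_submanifold TYPE('m::finite) M"
    and "connected M"
    and "riemannian_volume TYPE('m) M vol"
    and "smooth_on_submanifold M p"
    and "\<forall>z\<in>M. p z > 0"
    and "prob_space (law_of vol p)"
    and "langevin_kernels M p K"
    and "stationary K (law_of vol p)"
    and "c > 0"
    and "centered_isotropic (law_of vol p) c"
    and "self_adjoint (law_of vol p) (neg_generator M vol p)"
    and "discrete_spectrum (law_of vol p) (neg_generator M vol p)"
    and "t > 0"
    and "lam > 0"
    and "linearly_admissible M vol p lam"
  shows "alignment_minimizers M (law_of vol p) (K t) =
           {h \<in> borel_of M \<rightarrow>\<^sub>M borel_of M.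
              \<exists>Q. orthogonal_matrix Q \<and> (\<lambda>z. Q *v z) ` M = M \<and>
                  (AE z in law_of vol p. h z = Q *v z)}
       \<and> (\<forall>h\<in>alignment_minimizers M (law_of vol p) (K t).
            \<exists>Q. linear_symmetry M (law_of vol p) Q \<and> (AE z in law_of vol p. h z = Q *v z))"
proof -
  interpret geo: submanifold_density "TYPE('m)" M vol p
    by (rule submanifold_density.intro)
      (use assms(1,3,5) smooth_on_submanifold_continuous_on[OF assms(4)] in simp_all)
  interpret langevin M vol p K
    by (rule langevin.intro[OF geo.closed_M geo.sets_vol assms(6,7,8,11)])
  obtain C where C: "\<And>z. z \<in> M \<Longrightarrow> p z = C * exp (- (lam / 2) * (norm z)\<^sup>2)"
    using assms(15) unfolding linearly_admissible_def by blast
  have spec: "\<And>\<mu>. eigenvalue_of P A \<mu> \<Longrightarrow> \<mu> \<noteq> 0 \<Longrightarrow> lam \<le> \<mu>"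
    "eigenspace P A lam = {f \<in> L2 P. \<exists>a. AE z in P. f z = (\<Sum>j\<in>UNIV. a j * z $ j)}"
    using assms(15) unfolding linearly_admissible_def Let_def by blast+
  interpret alignment "TYPE('m)" M vol p K lam c t
  proof
    show "(AE z in P. z \<in> B) \<or> (AE z in P. z \<notin> B)" if "AE z in P. indicator B z *\<^sub>R z = S *v z" for B and S :: "real^'d^'d"
      using geo.AE_trivial_set[OF assms(2)] that by (simp add: geo.AE_law_iff)
    show "p w = p z" if "z \<in> M" "w \<in> M" "norm w = norm z" for z w using that C by simp
  qed (fact assms spec)+
  show ?thesis
  proof
    show "alignment_minimizers M P (K t) = {h \<in> borel_of M \<rightarrow>\<^sub>M borel_of M.
        \<exists>Q. orthogonal_matrix Q \<and> (\<lambda>z. Q *v z) ` M = M \<and> (AE z in P. h z = Q *v z)}"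
      by (rule minimizers_eq)
    show "\<forall>h\<in>alignment_minimizers M P (K t). \<exists>Q. linear_symmetry M P Q \<and> (AE z in P. h z = Q *v z)"
      unfolding minimizers_eq linear_symmetry_def using orthogonal_preserving(2) by blast
  qed
qed

end
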